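(* Consider the problem $\min_{x\in\mathcal X} f(x)=\sum_{j=1}^m f_j(x)$ with $f_j(x)=\mathbb E[F_j(x;\xi_j)]$ and the sequences $x_{j,k}, z_{j,k}$ ($1\le j\le m$), $\bar z_k,\bar x_k$ generated by the distributed dual averaging algorithm described in the context, and assume the optimal solution set $\mathcal X^*$ is nonempty. Suppose: 1. (Objective) For every $1\le j\le m$ and every $\xi_j$, the function $F_j(\cdot;\xi_j)$ is differentiable and convex on $\mathcal X$, and $|F_j(x;\xi_j)-F_j(y;\xi_j)|\le L_{0,j}(\xi_j)\|x-y\|$ for all $x,y\in\mathcal X$, where $L_{0,j}$ is measurable and $\mathbb E[L_{0,j}^2(\xi_j)]<\infty$. 2. (Weight matrices) $(A_k)_{k\ge1}$ is a sequence of random $m\times m$ matrices with nonnegative entries such that $A_k\mathbf 1=\mathbf 1$ and $\mathbf 1^T\mathbb E[A_k]=\mathbf 1^T$ for all $k\ge 1$; with $\rho_k$ the spectral norm of $\mathbb E\big[A_k^T(I_m-\tfrac{\mathbf 1\mathbf 1^T}{m})A_k\big]$ one has $\lim_{k\to\infty}k(1-\rho_k)=\infty$; and $A_k$ is independent of $\mathcal F_k$ for every $k$. 3. (Step-size) $\alpha_k>0$ is nonincreasing, $\sum_{k=1}^\infty\alpha_k=\infty$, and there exists $\beta>0.5$ with $\lim_{k\to\infty}k^\beta\alpha_k=0$ and $\liminf_{k\to\infty}\frac{1-\rho_k}{k^\beta\alpha_k}>0$. 4. (Sampling) For all $1\le i,j\le m$: $\xi_{j,1},\xi_{j,2},\dots$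 is an i.i.d. sample of $\xi_j$; for $i\ne j$, $\xi_{i,k}$ and $\xi_{j,k}$ are conditionally independent given $\mathcal F_k'=\sigma(\mathcal F_k\cup\sigma(A_k))$; and $\xi_{j,k}$ is conditionally independent of $A_k$ given $\mathcal F_k$. 5. (Regularizer) For every $x\in\mathcal X$ and every sequence $(z_k)$ in $\mathbb R^d$, $\mathrm Q(z_k)\to x$ implies $R(x,z_k)\to0$. Then, almost surely, the sequences $x_{1,k},\dots,x_{m,k}$ and $\bar x_k$ all converge, as $k\to\infty$, to some (common, possibly random) point of $\mathcal X^*$.
   Context: Setting. $m$ agents; $\mathcal X\subset\mathbb R^d$ is a (nonempty) closed convex set; for each $1\le j\le m$, $\xi_j$ is a random vector on a probability space $(\Omega,\mathcal F,\mathbb P)$ with support $\Xi_j$, $F_j(x;\xi_j)$ is a real-valued function, $f_j(x)=\mathbb E[F_j(x;\xi_j)]$ and $f=\sum_{j=1}^m f_j$. Put $f^*=\inf_{x\in\mathcal X}f(x)$ and $\mathcal X^*=\{x\in\mathcal X: f(x)=f^*\}$. $\nabla F_j$ denotes the gradient in $x$. $\mathbf 1\in\mathbb R^m$ is the all-ones vector, $\|\cdot\|$ is the Euclidean norm of vectors and the spectral norm of matrices. Regularizer. $\psi:\mathcal X\to\mathbb R$ is continuous and strongly convex: there is $\sigma>0$ with $\psi(\lambda x+(1-\lambda)y)\le\lambda\psi(x)+(1-\lambda)\psi(y)-\frac\sigma2\lambda(1-\lambda)\|x-y\|^2$ for all $x,y\in\mathcal X$, $\lambda\in[0,1]$. The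 mirror map is $\mathrm Q(z)=\arg\max_{x\in\mathcal X}\{\langle z,x\rangle-\psi(x)\}$. The conjugate is $\psi^*(z)=\sup_{x\in\mathcal X}\{\langle z,x\rangle-\psi(x)\}$ and the Fenchel coupling is $R(x,z)=\psi(x)+\psi^*(z)-\langle x,z\rangle$ for $x\in\mathcal X$, $z\in\mathbb R^d$. Distributed dual averaging algorithm. Each agent $j$ is initialized with $z_{j,0}\in\mathbb R^d$ (possibly random). For $k=1,2,\dots$, with a random weight matrix $A_k\in\mathbb R^{m\times m}$ and step-size $\alpha_k>0$, each agent $j$ sets $$x_{j,k}=\mathrm Q(z_{j,k-1}),\qquad z_{j,k}=\sum_{i=1}^m[A_k]_{ji}z_{i,k-1}-\alpha_k\nabla F_j(x_{j,k};\xi_{j,k}),$$ where $\xi_{j,k}$ is a sample of $\xi_j$ drawn at step $k$. Filtration. $\mathcal F_1=\sigma\{z_{j,0}:1\le j\le m\}$ and $\mathcal F_k=\sigma\{z_{j,0},\xi_{j,t},A_t:1\le j\le m,\,1\le t\le k-1\}$. Averages. $\bar z_k=\frac1m\sum_{j=1}^m z_{j,k}$ and $\bar x_{k+1}=\mathrm Q(\bar z_k)$ for $k\ge0$. Conventions. The sample $\xi_{j,k}$ is drawn afresh, i.e. it is distributed as $\xi_j$ and independent of $\mathcal F_k$, so that $\mathbb E[\nabla F_j(x_{j,k};\xi_{j,k})-\nabla f_j(x_{j,k})\mid\mathcal F_k]=0$. The Lipschitz hypothesis is understood to include $\|\nabla F_j(x;\xi_j)\|\le L_{0,j}(\xi_j)$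 and $\nabla f_j(x)=\mathbb E[\nabla F_j(x;\xi_j)]$ for $x\in\mathcal X$. *)

theory Defs
  imports "HOL-Probability.Probability"
begin

text \<open>Agents are indexed by a finite type \<open>'m\<close>, so their number is \<open>CARD('m)\<close>.  In
  \<open>real ^ 'm\<close> the constant \<open>1\<close> is the all-ones vector.\<close>

definition grad :: "('v::real_inner \<Rightarrow> real) \<Rightarrow> 'v \<Rightarrow> 'v" where
  "grad f x = (THE D. GDERIV f x :> D)"

definition support_of :: "'a measure \<Rightarrow> ('a \<Rightarrow> 's::topological_space) \<Rightarrow> 's set" where
  "support_of M Y = {y. \<forall>U. open U \<longrightarrow> y \<in> U \<longrightarrow> measure M (Y -` U \<inter> space M) > 0}"

definition expected_objective ::
  "'a measure \<Rightarrow> ('m \<Rightarrow> 'v \<Rightarrow> 's \<Rightarrow> real) \<Rightarrow> ('m \<Rightarrow> 'a \<Rightarrow> 's) \<Rightarrow> 'm \<Rightarrow> 'v \<Rightarrow> real" where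
  "expected_objective M F \<xi> j x = (LINT \<omega>|M. F j x (\<xi> j \<omega>))"

definition total_objective ::
  "'a measure \<Rightarrow> ('m::finite \<Rightarrow> 'v \<Rightarrow> 's \<Rightarrow> real) \<Rightarrow> ('m \<Rightarrow> 'a \<Rightarrow> 's) \<Rightarrow> 'v \<Rightarrow> real" where
  "total_objective M F \<xi> x = (\<Sum>j\<in>UNIV. expected_objective M F \<xi> j x)"

text \<open>The infimum is taken in the extended reals: for \<open>f\<close> unbounded below on \<open>X\<close> it is
  \<open>-\<infinity>\<close> and there are no solutions, whereas the infimum in \<open>real\<close> would be an unspecified number.\<close>

definition solution_set :: "'v set \<Rightarrow> ('v \<Rightarrow> real) \<Rightarrow> 'v set" where
  "solution_set X f = {x \<in> X. ereal (f x) = (INF y\<in>X. ereal (f y))}"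

definition strongly_convex_on :: "'v::real_normed_vector set \<Rightarrow> ('v \<Rightarrow> real) \<Rightarrow> bool" where
  "strongly_convex_on X \<psi> \<longleftrightarrow> (\<exists>\<sigma>>0. \<forall>x\<in>X. \<forall>y\<in>X. \<forall>l\<in>{0..1}.
     \<psi> (l *\<^sub>R x + (1 - l) *\<^sub>R y)
       \<le> l * \<psi> x + (1 - l) * \<psi> y - \<sigma> / 2 * l * (1 - l) * (norm (x - y))\<^sup>2)"

text \<open>For a continuous strongly convex \<open>\<psi>\<close> on a nonempty closed convex set, the maximizer below
  exists and is unique, and the supremum below is finite.\<close>

definition mirror_map :: "'v::real_inner set \<Rightarrow> ('v \<Rightarrow> real) \<Rightarrow> 'v \<Rightarrow> 'v" where
  "mirror_map X \<psi> z = arg_max_on (\<lambda>x. inner z x - \<psi> x) X"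

definition conjugate_on :: "'v::real_inner set \<Rightarrow> ('v \<Rightarrow> real) \<Rightarrow> 'v \<Rightarrow> real" where
  "conjugate_on X \<psi> z = (SUP x\<in>X. inner z x - \<psi> x)"

definition fenchel_coupling :: "'v::real_inner set \<Rightarrow> ('v \<Rightarrow> real) \<Rightarrow> 'v \<Rightarrow> 'v \<Rightarrow> real" where
  "fenchel_coupling X \<psi> x z = \<psi> x + conjugate_on X \<psi> z - inner x z"

definition sigma_sets_of :: "'a measure \<Rightarrow> ('a \<Rightarrow> 'b::topological_space) \<Rightarrow> 'a set set" where
  "sigma_sets_of M Y = sets (vimage_algebra (space M) Y borel)"

text \<open>For \<open>k = 1\<close> the index set \<open>{1..<k}\<close> is empty, and only the initial values contribute.\<close>

definition history ::
  "'a measure \<Rightarrow> ('m \<Rightarrow> 'a \<Rightarrow> 'v::topological_space) \<Rightarrow> ('m \<Rightarrow> nat \<Rightarrow> 'a \<Rightarrow> 's::topological_space)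
    \<Rightarrow> (nat \<Rightarrow> 'a \<Rightarrow> 'w::topological_space) \<Rightarrow> nat \<Rightarrow> 'a measure" where
  "history M z0 \<xi>s A k = sigma (space M)
     ((\<Union>j. sigma_sets_of M (z0 j))
      \<union> (\<Union>j. \<Union>t\<in>{1..<k}. sigma_sets_of M (\<xi>s j t))
      \<union> (\<Union>t\<in>{1..<k}. sigma_sets_of M (A t)))"

definition extended_history ::
  "'a measure \<Rightarrow> ('m \<Rightarrow> 'a \<Rightarrow> 'v::topological_space) \<Rightarrow> ('m \<Rightarrow> nat \<Rightarrow> 'a \<Rightarrow> 's::topological_space)
    \<Rightarrow> (nat \<Rightarrow> 'a \<Rightarrow> 'w::topological_space) \<Rightarrow> nat \<Rightarrow> 'a measure" where
  "extended_history M z0 \<xi>s A k =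
     sigma (space M) (sets (history M z0 \<xi>s A k) \<union> sigma_sets_of M (A k))"

definition cond_indep_set :: "'a measure \<Rightarrow> 'a measure \<Rightarrow> 'a set set \<Rightarrow> 'a set set \<Rightarrow> bool" where
  "cond_indep_set M G S T \<longleftrightarrow> (\<forall>B\<in>S. \<forall>C\<in>T. AE \<omega> in M.
     real_cond_exp M G (indicator (B \<inter> C)) \<omega>
       = real_cond_exp M G (indicator B) \<omega> * real_cond_exp M G (indicator C) \<omega>)"

definition spectral_norm :: "real ^ 'm ^ 'n \<Rightarrow> real" where
  "spectral_norm B = onorm (\<lambda>v. B *v v)"

definition centering_matrix :: "real ^ 'm ^ 'm" where
  "centering_matrix = mat 1 - (\<chi> i j. 1 / real CARD('m))"

definition contraction_factor :: "'a measure \<Rightarrow> ('a \<Rightarrow> real ^ 'm ^ 'm) \<Rightarrow> real" where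
  "contraction_factor M A =
     spectral_norm (LINT \<omega>|M. transpose (A \<omega>) ** centering_matrix ** A \<omega>)"

end

(* The sample and the weight matrix of a step are independent of the past, so instead of conditional
   expectations one can freeze the past and integrate out one fresh variable at a time (Fubini).

   Consensus.  Let U be the squared deviation of the dual variables from their average.  On the event that
   the initial values are bounded by N, Young's inequality with parameter (1 - rho_k)/2 and the spectral
   hypothesis give E U_k <= (1 - d_k) E U_{k-1} + C d_k k^(-2 beta) with d_k = (1 - rho_k)/2, and since
   k d_k tends to infinity, E U_k = O(k^(-min(2 beta, 2))), which is summable.

   Descent.  For a minimizer p, the Fenchel coupling R(p, zbar_k) is an almost supermartingale with drift
   -(alpha_k/m) (f(xbar_k) - f(p)) and error C (alpha_k^2 + U_{k-1}).  Doob's upcrossing inequality shows that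
   it converges and that the drifts are summable, so a subsequence of xbar_k tends to a minimizer y.

   The minimizer y depends on the outcome, so an exceptional null set for each p would not suffice.  But
   R(p, z) - psi(p) is affine in p: convergence of R(p, zbar_k) for the finitely many p of an affine basis of
   the solution set gives it for all p in the solution set at once.  In particular R(y, zbar_k) converges, and
   by the regularizer hypothesis its limit is 0. *)

theory Submission
  imports Defs
begin

section \<open>The mirror map\<close>

text \<open>The columns of the weight matrices sum to one only in expectation, so mixing moves the
  average of the dual variables: it adds the mean of the mixed deviations. To first order this
  perturbation integrates to zero, because its expected coefficients are all 1/m and the deviations
  sum to zero; its square, however, is of the size of U. This is how U enters the error of the
  descent, and why consensus must hold with a summable rate and not merely in the limit. Integrating
  out one fresh variable at a time requires that no term of a one-step estimate contain two of them.
  Hence mixing and gradient parts are always separated by Young's inequality, and products of a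
  step-size with a deviation are split into squares. The descent inequality is integrated over an
  arbitrary event of the past. This is the form of the supermartingale property that is used, and it
  survives localization: the event of bounded initial values belongs to every past, so intersecting
  with it gives another admissible test event.\<close>

locale mirror =
  fixes X :: "'v::euclidean_space set" and \<psi> :: "'v \<Rightarrow> real" and \<sigma> :: real
  assumes closed_X: "closed X" and convex_X: "convex X" and nonempty_X: "X \<noteq> {}"
    and psi_cont: "continuous_on X \<psi>" and sigma_pos: "\<sigma> > 0"
    and psi_strong: "\<And>x y l. x \<in> X \<Longrightarrow> y \<in> X \<Longrightarrow> l \<in> {0..1} \<Longrightarrow>
      \<psi> (l *\<^sub>R x + (1 - l) *\<^sub>R y)
        \<le> l * \<psi> x + (1 - l) * \<psi> y - \<sigma> / 2 * l * (1 - l) * (norm (x - y))\<^sup>2"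
begin

abbreviation "Q \<equiv> mirror_map X \<psi>"
abbreviation "cj \<equiv> conjugate_on X \<psi>"
abbreviation "R \<equiv> fenchel_coupling X \<psi>"

text \<open>A far point is pulled back along the segment to the unit sphere around
  \<open>x0\<close>, where compactness bounds \<psi> from below; strong convexity with weight 1/r on
  that segment then turns this bound into quadratic growth at distance r.\<close>

lemma psi_lower_bound:
  assumes x0: "x0 \<in> X"
  obtains c where "\<And>x. x \<in> X \<Longrightarrow> norm (x - x0) \<ge> 1 \<Longrightarrow>
      \<psi> x \<ge> \<psi> x0 + \<sigma> / 2 * (norm (x - x0))\<^sup>2 - c * norm (x - x0)"
proof -
  have comp: "compact (X \<inter> cball x0 1)"
    using closed_X by (simp add: closed_Int_compact)
  moreover have "X \<inter> cball x0 1 \<noteq> {}" using x0 by auto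
  moreover have "continuous_on (X \<inter> cball x0 1) \<psi>"
    using psi_cont continuous_on_subset by blast
  ultimately obtain p where p: "\<And>y. y \<in> X \<inter> cball x0 1 \<Longrightarrow> \<psi> p \<le> \<psi> y"
    using continuous_attains_inf[of "X \<inter> cball x0 1" \<psi>] by blast
  show thesis
  proof (rule that)
    fix x assume x: "x \<in> X" and r1: "norm (x - x0) \<ge> 1"
    define r where "r = norm (x - x0)"
    have r: "r \<ge> 1" using r1 r_def by simp
    let ?y = "(1/r) *\<^sub>R x + (1 - 1/r) *\<^sub>R x0"
    have "?y \<in> X" using convexD[OF convex_X x x0, of "1/r" "1-1/r"] r by auto
    moreover have "x0 - ?y = (1/r) *\<^sub>R (x0 - x)" by (simp add: algebra_simps)
    hence "dist x0 ?y = (1/r) * r" using r by (simp add: dist_norm norm_minus_commute[of x0 x] r_def)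
    hence "dist x0 ?y = 1" using r by simp
    ultimately have "\<psi> p \<le> \<psi> ?y" using p by auto
    also have "\<dots> \<le> 1/r * \<psi> x + (1 - 1/r) * \<psi> x0 - \<sigma> / 2 * (1/r) * (1 - 1/r) * r\<^sup>2"
      using psi_strong[OF x x0, of "1/r"] r unfolding r_def[symmetric] by simp
    finally have "r * \<psi> p \<le> r * (1/r * \<psi> x + (1 - 1/r) * \<psi> x0 - \<sigma> / 2 * (1/r) * (1 - 1/r) * r\<^sup>2)"
      using r by (intro mult_left_mono) auto
    also have "\<dots> = \<psi> x + (r - 1) * \<psi> x0 - \<sigma>/2 * (r\<^sup>2 - r)"
      using r by (simp add: field_simps power2_eq_square)
    finally have "\<psi> x \<ge> r * \<psi> p - (r - 1) * \<psi> x0 + \<sigma>/2 * (r\<^sup>2 - r)" by simp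
    thus "\<psi> x \<ge> \<psi> x0 + \<sigma> / 2 * (norm (x - x0))\<^sup>2 - (\<sigma>/2 + \<psi> x0 - \<psi> p) * norm (x - x0)"
      unfolding r_def by (simp add: algebra_simps)
  qed
qed

lemma maximizer_exists: "\<exists>p\<in>X. \<forall>y\<in>X. inner z y - \<psi> y \<le> inner z p - \<psi> p"
proof -
  obtain x0 where x0: "x0 \<in> X" using nonempty_X by auto
  obtain c where c: "\<And>x. x \<in> X \<Longrightarrow> norm (x - x0) \<ge> 1 \<Longrightarrow>
      \<psi> x \<ge> \<psi> x0 + \<sigma> / 2 * (norm (x - x0))\<^sup>2 - c * norm (x - x0)"
    using psi_lower_bound[OF x0] by blast
  \<comment> \<open>Beyond this radius the quadratic growth of \<psi> exceeds the linear terms with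
    coefficients \<open>norm z\<close> and \<open>c\<close>, so no far point beats \<open>x0\<close>
    and the maximum over a compact ball is global.\<close>
  define r where "r = max 1 (2 * (norm z + \<bar>c\<bar>) / \<sigma>)"
  have far: "inner z x - \<psi> x \<le> inner z x0 - \<psi> x0" if x: "x \<in> X" "norm (x - x0) > r" for x
  proof -
    let ?n = "norm (x - x0)"
    have n: "?n \<ge> 1" and n2: "?n \<ge> 2 * (norm z + \<bar>c\<bar>) / \<sigma>" using x(2) r_def by auto
    have "\<sigma> * ?n \<ge> 2 * (norm z + \<bar>c\<bar>)" using n2 sigma_pos by (simp add: field_simps)
    hence "\<sigma> * ?n * ?n \<ge> 2 * (norm z + \<bar>c\<bar>) * ?n" using n by (intro mult_right_mono) auto
    hence "\<sigma> / 2 * ?n\<^sup>2 \<ge> norm z * ?n + \<bar>c\<bar> * ?n" by (simp add: power2_eq_square algebra_simps)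
    moreover have "\<bar>c\<bar> * ?n \<ge> c * ?n" by (intro mult_right_mono) auto
    moreover have "inner z x - inner z x0 \<le> norm z * ?n"
      by (metis inner_diff_right norm_cauchy_schwarz)
    ultimately show ?thesis using c[OF x(1) n] by linarith
  qed
  have r0: "r \<ge> 0" unfolding r_def by simp
  have "compact (X \<inter> cball x0 r)" using closed_X by (simp add: closed_Int_compact)
  moreover have "X \<inter> cball x0 r \<noteq> {}" using x0 r0 by auto
  moreover have "continuous_on (X \<inter> cball x0 r) (\<lambda>y. inner z y - \<psi> y)"
    by (intro continuous_intros continuous_on_subset[OF psi_cont]) auto
  ultimately obtain p where p: "p \<in> X" "\<And>y. y \<in> X \<inter> cball x0 r \<Longrightarrow> inner z y - \<psi> y
      \<le> inner z p - \<psi> p"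
    using continuous_attains_sup[of "X \<inter> cball x0 r" "\<lambda>y. inner z y - \<psi> y"] by blast
  have "inner z y - \<psi> y \<le> inner z p - \<psi> p" if "y \<in> X" for y
  proof (cases "norm (y - x0) > r")
    case True
    have "inner z x0 - \<psi> x0 \<le> inner z p - \<psi> p" using p(2) x0 r0 by auto
    thus ?thesis using far[OF that True] by linarith
  next
    case False
    thus ?thesis using p(2)[of y] that by (auto simp: dist_norm norm_minus_commute)
  qed
  thus ?thesis using p(1) by blast
qed

lemma Q_maximizer: "Q z \<in> X" "y \<in> X \<Longrightarrow> inner z y - \<psi> y \<le> inner z (Q z) - \<psi> (Q z)"
proof -
  have "\<exists>p. is_arg_max (\<lambda>x. inner z x - \<psi> x) (\<lambda>x. x \<in> X) p"
    using maximizer_exists[of z] by (auto simp: is_arg_max_linorder)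
  hence "is_arg_max (\<lambda>x. inner z x - \<psi> x) (\<lambda>x. x \<in> X) (Q z)"
    unfolding mirror_map_def arg_max_on_def arg_max_def by (rule someI_ex)
  thus "Q z \<in> X" "y \<in> X \<Longrightarrow> inner z y - \<psi> y \<le> inner z (Q z) - \<psi> (Q z)"
    by (auto simp: is_arg_max_linorder)
qed

lemma conj_eq: "cj z = inner z (Q z) - \<psi> (Q z)"
  unfolding conjugate_on_def
  by (rule cSup_eq_maximum) (use Q_maximizer in auto)

text \<open>The maximizer \<open>Q z\<close> is compared with the point at parameter l on the
  segment from it to y. Strong convexity gives the bound with an extra factor 1 - l after division
  by l, and l tends to 0 from the right.\<close>

lemma fenchel_coupling_ge:
  assumes y: "y \<in> X"
  shows "\<sigma> / 2 * (norm (y - Q z))\<^sup>2 \<le> R y z"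
proof (rule tendsto_upperbound)
  show "((\<lambda>l. \<sigma> / 2 * (1 - l) * (norm (y - Q z))\<^sup>2) \<longlongrightarrow> \<sigma> / 2 * (norm (y
      - Q z))\<^sup>2) (at_right (0::real))"
    by (auto intro!: tendsto_eq_intros)
  show "eventually (\<lambda>l. \<sigma> / 2 * (1 - l) * (norm (y - Q z))\<^sup>2 \<le> R y z) (at_right (0::real))"
  proof -
    have "\<sigma> / 2 * (1 - l) * (norm (y - Q z))\<^sup>2 \<le> R y z" if l: "0 < l" "l < 1" for l
    proof -
      let ?p = "Q z" and ?w = "l *\<^sub>R y + (1 - l) *\<^sub>R Q z"
      have "?w \<in> X" using convexD[OF convex_X y Q_maximizer(1), of l "1-l"] l by auto
      hence "inner z ?w - \<psi> ?w \<le> inner z ?p - \<psi> ?p" by (rule Q_maximizer)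
      moreover have "\<psi> ?w \<le> l * \<psi> y + (1 - l) * \<psi> ?p - \<sigma> / 2 * l * (1 - l) * (norm (y - ?p))\<^sup>2"
        using psi_strong[OF y Q_maximizer(1), of l] l by auto
      ultimately have "l * (\<sigma> / 2 * (1 - l) * (norm (y - Q z))\<^sup>2) \<le> l * R y z"
        unfolding fenchel_coupling_def conj_eq
        by (simp add: algebra_simps inner_add_right inner_commute)
      thus ?thesis using l by simp
    qed
    thus ?thesis unfolding eventually_at_right_field by (intro exI[of _ 1]) auto
  qed
qed simp

lemma fenchel_coupling_nonneg: "y \<in> X \<Longrightarrow> 0 \<le> R y z"
  using sigma_pos by (intro order_trans[OF _ fenchel_coupling_ge]) auto

lemma fenchel_coupling_Q: "R y z = \<psi> y - inner z y - (\<psi> (Q z) - inner z (Q z))"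
  unfolding fenchel_coupling_def conj_eq by (simp add: inner_commute)

text \<open>The quadratic lower bounds for the two crossed couplings are added; all values of \<psi>
  cancel and only an inner product of differences remains.\<close>

lemma Q_lipschitz: "norm (Q z - Q w) \<le> norm (z - w) / \<sigma>"
proof -
  let ?d = "norm (Q z - Q w)"
  have "\<sigma> * ?d\<^sup>2 \<le> R (Q w) z + R (Q z) w"
    using fenchel_coupling_ge[OF Q_maximizer(1), of w z] fenchel_coupling_ge[OF Q_maximizer(1), of z w]
    by (simp add: norm_minus_commute[of "Q w"])
  also have "\<dots> = inner (z - w) (Q z - Q w)"
    unfolding fenchel_coupling_Q by (simp add: algebra_simps inner_diff)
  also have "\<dots> \<le> norm (z - w) * ?d" by (rule norm_cauchy_schwarz)
  finally have "?d * (\<sigma> * ?d) \<le> ?d * norm (z - w)" by (simp add: power2_eq_square algebra_simps)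
  hence "\<sigma> * ?d \<le> norm (z - w)"
    by (cases "?d = 0") (use sigma_pos in \<open>auto simp: mult_le_cancel_left\<close>)
  thus ?thesis using sigma_pos by (simp add: field_simps)
qed

lemma continuous_Q: "continuous_on UNIV Q"
proof (rule lipschitz_on_continuous_on)
  show "(1/\<sigma>)-lipschitz_on UNIV Q"
    using Q_lipschitz sigma_pos by (auto simp: lipschitz_on_def dist_norm)
qed

text \<open>This is smoothness of the conjugate with constant 1/\<sigma>. The remainder after the
  linear term is an inner product minus a coupling, and the quadratic bound on that coupling allows
  completing the square in \<open>norm (Q w - Q z)\<close>.\<close>

lemma fenchel_coupling_step:
  "R y w \<le> R y z + inner (w - z) (Q z - y) + (norm (w - z))\<^sup>2 / (2 * \<sigma>)"
proof -
  let ?d = "norm (Q w - Q z)" and ?e = "norm (w - z)"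
  have "R y w - R y z - inner (w - z) (Q z - y) = inner (w - z) (Q w - Q z) - R (Q w) z"
    unfolding fenchel_coupling_Q by (simp add: algebra_simps inner_diff)
  also have "\<dots> \<le> ?e * ?d - \<sigma> / 2 * ?d\<^sup>2"
    using fenchel_coupling_ge[OF Q_maximizer(1), of w z] norm_cauchy_schwarz[of "w - z" "Q w - Q z"]
    by linarith
  also have "\<dots> = ?e\<^sup>2 / (2 * \<sigma>) - \<sigma> / 2 * (?d - ?e / \<sigma>)\<^sup>2"
    using sigma_pos by (simp add: field_simps power2_eq_square)
  also have "\<dots> \<le> ?e\<^sup>2 / (2 * \<sigma>)" using sigma_pos by simp
  finally show ?thesis by linarith
qed

text \<open>The weights may be negative, as they are for affine hulls. The correction in front of
  the last sum does not depend on z, so convergence along a sequence of z carries over to the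
  combination.\<close>

lemma fenchel_coupling_affine_combination:
  assumes "finite S" "sum u S = 1"
  shows "R (\<Sum>v\<in>S. u v *\<^sub>R v) z = \<psi> (\<Sum>v\<in>S. u v *\<^sub>R v) - (\<Sum>v\<in>S. u v * \<psi> v)
      + (\<Sum>v\<in>S. u v * R v z)"
proof -
  have "(\<Sum>v\<in>S. u v * R v z) = (\<Sum>v\<in>S. u v * \<psi> v) + (\<Sum>v\<in>S. u v) * cj z
      - (\<Sum>v\<in>S. u v * inner v z)"
    unfolding fenchel_coupling_def by (simp add: algebra_simps sum.distrib sum_subtractf sum_distrib_left sum_distrib_right)
  moreover have "inner (\<Sum>v\<in>S. u v *\<^sub>R v) z = (\<Sum>v\<in>S. u v * inner v z)"
    by (simp add: inner_sum_left)
  ultimately show ?thesis using assms unfolding fenchel_coupling_def by simp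
qed

text \<open>The deterministic part of the argument, applied to a single outcome. One convergent
  coupling makes the primal sequence bounded, divergence of the step sum makes the objective gap
  small infinitely often, and a limit point y is then a minimizer whose own coupling converges,
  necessarily to 0.\<close>

lemma mirror_convergence:
  fixes zb :: "nat \<Rightarrow> 'v" and f :: "'v \<Rightarrow> real"
  assumes recip: "\<And>y zs. y \<in> X \<Longrightarrow> (\<lambda>k. Q (zs k)) \<longlonglongrightarrow> y
      \<Longrightarrow> (\<lambda>k. R y (zs k)) \<longlonglongrightarrow> 0"
    and fmin: "\<And>y. y \<in> X \<Longrightarrow> fmin \<le> f y" and fcont: "continuous_on X f"
    and P: "P \<subseteq> X" "P \<noteq> {}" "{y\<in>X. f y = fmin} \<subseteq> affine hull P"
    and conv: "\<And>p. p \<in> P \<Longrightarrow> convergent (\<lambda>n. R p (zb n))"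
    and a: "\<And>n. a n > 0" "\<not> summable a"
    and sum: "summable (\<lambda>n. a n * (f (Q (zb n)) - fmin))"
  shows "\<exists>y\<in>{y\<in>X. f y = fmin}. (\<lambda>n. Q (zb n)) \<longlonglongrightarrow> y"
proof -
  have conv': "convergent (\<lambda>n. R y (zb n))" if y: "y \<in> affine hull P" for y
  proof -
    obtain S u where S: "finite S" "S \<subseteq> P" "sum u S = 1" "(\<Sum>v\<in>S. u v *\<^sub>R v) = y"
      using y unfolding affine_hull_explicit by blast
    have "convergent (\<lambda>n. \<psi> y - (\<Sum>v\<in>S. u v * \<psi> v) + (\<Sum>v\<in>S. u v * R v (zb n)))"
      using S conv by (intro convergent_add convergent_sum convergent_mult convergent_const) auto
    thus ?thesis using fenchel_coupling_affine_combination[OF S(1,3)] unfolding S(4) by simp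
  qed
  \<comment> \<open>If the gap stayed above 1/(k+1) from index k on, summability of the weighted
    gaps would force summability of the steps.\<close>
  have small: "\<exists>n\<ge>k. f (Q (zb n)) - fmin < 1 / real (Suc k)" for k
  proof (rule ccontr)
    assume "\<not> ?thesis"
    hence big: "f (Q (zb n)) - fmin \<ge> 1 / real (Suc k)" if "n \<ge> k" for n using that by force
    have "summable (\<lambda>n. a n * (1 / real (Suc k)))"
    proof (rule summable_comparison_test[OF _ sum], intro exI allI impI)
      fix n assume "n \<ge> k"
      thus "norm (a n * (1 / real (Suc k))) \<le> a n * (f (Q (zb n)) - fmin)"
        using mult_left_mono[OF big[of n], of "a n"] a(1)[of n] by (simp add: abs_mult less_imp_le del: of_nat_Suc)
    qed
    hence "summable a" using summable_mult2[of "\<lambda>n. a n * (1 / real (Suc k))" "real (Suc k)"] by simp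
    thus False using a by simp
  qed
  then obtain \<nu> where \<nu>: "\<And>k. \<nu> k \<ge> k" "\<And>k. f (Q (zb (\<nu> k))) - fmin < 1 / real (Suc k)" by metis
  obtain p where p: "p \<in> P" "p \<in> X" using P by auto
  obtain b where b: "\<And>n. norm (R p (zb n)) \<le> b"
    using Bseq_def convergent_imp_Bseq[OF conv[OF p(1)]] by metis
  have in_ball: "Q (zb n) \<in> X \<inter> cball p (sqrt (2 * b / \<sigma>))" for n
  proof -
    have "\<sigma> / 2 * (norm (p - Q (zb n)))\<^sup>2 \<le> b"
      using fenchel_coupling_ge[OF p(2), of "zb n"] b[of n] by auto
    hence "(norm (p - Q (zb n)))\<^sup>2 \<le> 2 * b / \<sigma>" using sigma_pos by (simp add: field_simps)
    hence "norm (p - Q (zb n)) \<le> sqrt (2 * b / \<sigma>)" by (rule real_le_rsqrt)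
    thus ?thesis using Q_maximizer(1) by (simp add: dist_norm)
  qed
  have "compact (X \<inter> cball p (sqrt (2 * b / \<sigma>)))" using closed_X by (simp add: closed_Int_compact)
  then obtain y r where y: "y \<in> X"
      and r: "strict_mono r" "((\<lambda>k. Q (zb (\<nu> k))) \<circ> r) \<longlonglongrightarrow> y"
    unfolding compact_def using in_ball by (metis (no_types, lifting) IntD1)
  have r2: "(\<lambda>k. Q (zb (\<nu> (r k)))) \<longlonglongrightarrow> y" using r(2) by (simp add: o_def)
  have "(\<lambda>k. f (Q (zb (\<nu> (r k))))) \<longlonglongrightarrow> f y"
    by (rule continuous_on_tendsto_compose[OF fcont r2 y]) (simp add: Q_maximizer)
  moreover have "(\<lambda>k. f (Q (zb (\<nu> k)))) \<longlonglongrightarrow> fmin"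
  proof (rule real_tendsto_sandwich)
    show "\<forall>\<^sub>F k in sequentially. fmin \<le> f (Q (zb (\<nu> k)))" by (simp add: fmin Q_maximizer)
    show "\<forall>\<^sub>F k in sequentially. f (Q (zb (\<nu> k))) \<le> fmin + 1 / real (Suc k)"
      using \<nu>(2) by (intro always_eventually allI) (smt (verit))
    show "(\<lambda>k. fmin + 1 / real (Suc k)) \<longlonglongrightarrow> fmin"
      using tendsto_add[OF tendsto_const LIMSEQ_inverse_real_of_nat] by (simp add: inverse_eq_divide)
  qed simp
  hence "(\<lambda>k. f (Q (zb (\<nu> (r k))))) \<longlonglongrightarrow> fmin"
    using LIMSEQ_subseq_LIMSEQ[OF _ r(1)] by (fastforce simp: o_def)
  ultimately have fy: "f y = fmin" using LIMSEQ_unique by blast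
  obtain l where l: "(\<lambda>n. R y (zb n)) \<longlonglongrightarrow> l"
    using conv'[of y] P(3) y fy by (auto simp: convergent_def)
  \<comment> \<open>The indices \<open>\<nu> (r k)\<close> need not be increasing; it is enough that
    they tend to infinity.\<close>
  have "k \<le> \<nu> (r k)" for k using seq_suble[OF r(1), of k] \<nu>(1)[of "r k"] by simp
  hence "filterlim (\<lambda>k. \<nu> (r k)) sequentially sequentially"
    by (intro filterlim_at_top_mono[OF filterlim_ident]) auto
  from filterlim_compose[OF l this] have "(\<lambda>k. R y (zb (\<nu> (r k)))) \<longlonglongrightarrow> l" .
  moreover have "(\<lambda>k. R y (zb (\<nu> (r k)))) \<longlonglongrightarrow> 0" using recip[OF y r2] .
  ultimately have l0: "(\<lambda>n. R y (zb n)) \<longlonglongrightarrow> 0" using l LIMSEQ_unique by blast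
  have "(\<lambda>n. (norm (y - Q (zb n)))\<^sup>2) \<longlonglongrightarrow> 0"
  proof (rule tendsto_sandwich[where f = "\<lambda>_. 0" and h = "\<lambda>n. 2 / \<sigma> * R y (zb n)"])
    show "\<forall>\<^sub>F n in sequentially. (norm (y - Q (zb n)))\<^sup>2 \<le> 2 / \<sigma> * R y (zb n)"
      using fenchel_coupling_ge[OF y] sigma_pos by (auto simp: field_simps)
    show "(\<lambda>n. 2 / \<sigma> * R y (zb n)) \<longlonglongrightarrow> 0"
        using tendsto_mult[OF tendsto_const[of "2 / \<sigma>"] l0] by simp
  qed auto
  hence d0: "(\<lambda>n. norm (y - Q (zb n))) \<longlonglongrightarrow> 0"
    using tendsto_real_sqrt by fastforce
  have "(\<lambda>n. Q (zb n)) \<longlonglongrightarrow> y"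
    by (rule LIM_zero_cancel, rule tendsto_norm_zero_cancel) (use d0 in \<open>simp add: norm_minus_commute\<close>)
  thus ?thesis using y fy by blast
qed

end

section \<open>Mean and squared deviation of a finite family of vectors\<close>

definition mean :: "('m::finite \<Rightarrow> 'v::real_vector) \<Rightarrow> 'v" where
  "mean y = (1 / real CARD('m)) *\<^sub>R (\<Sum>j\<in>UNIV. y j)"

lemma sum_deviation: "(\<Sum>j\<in>UNIV. y j - mean y) = 0" for y :: "'m::finite \<Rightarrow> 'v::real_vector"
  unfolding mean_def by (simp add: sum_subtractf scaleR_sum_right[symmetric] sum_constant_scaleR)

lemma mean_add: "mean (\<lambda>j. a j + b j) = mean a + mean b"
  and mean_diff: "mean (\<lambda>j. a j - b j) = mean a - mean b"
  and mean_scaleR: "mean (\<lambda>j. c *\<^sub>R a j) = c *\<^sub>R mean a"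
  unfolding mean_def by (simp_all add: sum.distrib sum_subtractf scaleR_sum_right algebra_simps)

lemma mean_const: "mean (\<lambda>j::'m::finite. c) = c"
  unfolding mean_def by (simp add: sum_constant_scaleR)

definition deviation :: "('m::finite \<Rightarrow> 'v::real_inner) \<Rightarrow> real" where
  "deviation y = (\<Sum>j\<in>UNIV. (norm (y j - mean y))\<^sup>2)"

lemma deviation_eq:
  fixes y :: "'m::finite \<Rightarrow> 'v::real_inner"
  shows "deviation y = (\<Sum>j\<in>UNIV. (norm (y j))\<^sup>2) - real CARD('m) * (norm (mean y))\<^sup>2"
proof -
  have s: "(\<Sum>j\<in>UNIV. y j) = real CARD('m) *\<^sub>R mean y" unfolding mean_def by simp
  have "deviation y = (\<Sum>j\<in>UNIV. (norm (y j))\<^sup>2 - 2 * inner (y j) (mean y) + (norm (mean y))\<^sup>2)"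
    unfolding deviation_def
    by (intro sum.cong refl) (simp add: power2_norm_eq_inner algebra_simps inner_commute)
  also have "\<dots> = (\<Sum>j\<in>UNIV. (norm (y j))\<^sup>2) - 2 * inner (\<Sum>j\<in>UNIV. y j) (mean y)
      + real CARD('m) * (norm (mean y))\<^sup>2"
    by (simp add: sum.distrib sum_subtractf sum_distrib_left inner_sum_left)
  finally show ?thesis unfolding s by (simp add: power2_norm_eq_inner)
qed

lemma deviation_le: "deviation y \<le> (\<Sum>j\<in>UNIV. (norm (y j))\<^sup>2)"
  unfolding deviation_eq by simp

lemma norm_mean_le: "(norm (mean y))\<^sup>2 \<le> (\<Sum>j\<in>UNIV. (norm (y j))\<^sup>2)"
  for y :: "'m::finite \<Rightarrow> 'v::real_inner"
proof -
  have "deviation y \<ge> 0" unfolding deviation_def by (simp add: sum_nonneg)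
  moreover have "1 * (norm (mean y))\<^sup>2 \<le> real CARD('m) * (norm (mean y))\<^sup>2"
    by (intro mult_right_mono) (auto simp: Suc_le_eq)
  ultimately show ?thesis unfolding deviation_eq by linarith
qed

lemma deviation_diff_le:
  fixes a b :: "'m::finite \<Rightarrow> 'v::real_inner"
  assumes "\<eta> > 0"
  shows "deviation (\<lambda>j. a j - b j) \<le> (1 + \<eta>) * deviation a + (1 + 1 / \<eta>) * deviation b"
proof -
  have "(norm (p - q))\<^sup>2 \<le> (1 + \<eta>) * (norm p)\<^sup>2 + (1 + 1 / \<eta>) * (norm q)\<^sup>2" for p q :: 'v
  proof -
    \<comment> \<open>Expanding this square gives Young's inequality with parameter \<eta> together
      with its exact defect.\<close>
    have "0 \<le> (norm (\<eta> *\<^sub>R p + q))\<^sup>2 / \<eta>" using assms by simp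
    also have "\<dots> = (1 + \<eta>) * (norm p)\<^sup>2 + (1 + 1 / \<eta>) * (norm q)\<^sup>2 - (norm (p - q))\<^sup>2"
      using assms unfolding power2_norm_eq_inner
      by (simp add: field_simps inner_add_left inner_add_right inner_diff_left inner_diff_right inner_commute)
    finally show ?thesis by simp
  qed
  hence "(norm (a j - b j - mean (\<lambda>j. a j - b j)))\<^sup>2 \<le>
      (1 + \<eta>) * (norm (a j - mean a))\<^sup>2 + (1 + 1 / \<eta>) * (norm (b j - mean b))\<^sup>2" for j
    unfolding mean_diff by (metis (no_types, lifting) add_diff_eq diff_add_eq diff_diff_eq2 diff_diff_add)
  hence "deviation (\<lambda>j. a j - b j) \<le> (\<Sum>j\<in>UNIV. (1 + \<eta>) * (norm (a j - mean a))\<^sup>2 + (1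
      + 1 / \<eta>) * (norm (b j - mean b))\<^sup>2)"
    unfolding deviation_def by (intro sum_mono) auto
  thus ?thesis by (simp add: deviation_def sum.distrib sum_distrib_left)
qed

lemma deviation_scaleR: "deviation (\<lambda>j. c *\<^sub>R y j) = c\<^sup>2 * deviation y"
  unfolding deviation_eq mean_scaleR
  by (simp add: power_mult_distrib sum_distrib_left algebra_simps)

lemma deviation_shift: "deviation (\<lambda>j. y j + c) = deviation y"
  unfolding deviation_def mean_add mean_const by simp

text \<open>The centering matrix is the orthogonal projection that removes the mean, so it
  represents the deviation as a quadratic form. This is the link to the matrix in the spectral
  hypothesis.\<close>

lemma deviation_quadratic:
  fixes y :: "'m::finite \<Rightarrow> 'v::real_inner"
  shows "deviation y = (\<Sum>j\<in>UNIV. \<Sum>k\<in>UNIV. (centering_matrix :: real^'m^'m) $ j $ k * inner (y j) (y k))"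
proof -
  have c: "(centering_matrix :: real^'m^'m) $ j $ k = (if k = j then 1 else 0) - 1 / real CARD('m)" for j k
    by (auto simp: centering_matrix_def mat_def)
  have "(\<Sum>j\<in>UNIV. \<Sum>k\<in>UNIV. (centering_matrix :: real^'m^'m) $ j $ k * inner (y j) (y k))
    = (\<Sum>j\<in>UNIV. inner (y j) (y j)) - inner (\<Sum>j\<in>UNIV. y j) (mean y)"
    unfolding c mean_def
    by (simp add: left_diff_distrib sum_subtractf if_distrib[of "\<lambda>x. x * _"] cong: if_cong)
       (simp add: inner_sum_left inner_sum_right sum_divide_distrib, rule sum.swap)
  also have "(\<Sum>j\<in>UNIV. y j) = real CARD('m) *\<^sub>R mean y" unfolding mean_def by simp
  finally show ?thesis unfolding deviation_eq by (simp add: power2_norm_eq_inner)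
qed

text \<open>Here the random matrix occurs only through the entries of
  \<open>transpose A ** centering_matrix ** A\<close>, so its expectation can later be taken entry
  by entry. The chain of swaps merely moves the sums over the rows of A to the inside.\<close>

lemma deviation_mixing:
  fixes A :: "real^'m^'m" and u :: "'m::finite \<Rightarrow> 'v::real_inner"
  shows "deviation (\<lambda>j. \<Sum>i\<in>UNIV. A $ j $ i *\<^sub>R u i) =
    (\<Sum>i\<in>UNIV. \<Sum>l\<in>UNIV. (transpose A ** centering_matrix ** A) $ i $ l * inner (u i) (u l))"
proof -
  let ?C = "centering_matrix :: real^'m^'m"
  have "deviation (\<lambda>j. \<Sum>i\<in>UNIV. A $ j $ i *\<^sub>R u i) =
     (\<Sum>j\<in>UNIV. \<Sum>k\<in>UNIV. \<Sum>i\<in>UNIV. \<Sum>l\<in>UNIV. A $ j $ i * ?C $ j $ k * A $ k $ l * inner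
         (u i) (u l))"
    unfolding deviation_quadratic
    by (simp add: inner_sum_left inner_sum_right sum_distrib_left mult_ac)
       (intro sum.cong refl sum.swap)
  also have "\<dots> = (\<Sum>k\<in>UNIV. \<Sum>j\<in>UNIV. \<Sum>i\<in>UNIV. \<Sum>l\<in>UNIV. A $ j $ i * ?C $ j $ k *
      A $ k $ l * inner (u i) (u l))"
    by (rule sum.swap)
  also have "\<dots> = (\<Sum>k\<in>UNIV. \<Sum>i\<in>UNIV. \<Sum>j\<in>UNIV. \<Sum>l\<in>UNIV. A $ j $ i * ?C $ j $ k *
      A $ k $ l * inner (u i) (u l))"
    by (intro sum.cong refl sum.swap)
  also have "\<dots> = (\<Sum>k\<in>UNIV. \<Sum>i\<in>UNIV. \<Sum>l\<in>UNIV. \<Sum>j\<in>UNIV. A $ j $ i * ?C $ j $ k *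
      A $ k $ l * inner (u i) (u l))"
    by (intro sum.cong refl sum.swap)
  also have "\<dots> = (\<Sum>i\<in>UNIV. \<Sum>k\<in>UNIV. \<Sum>l\<in>UNIV. \<Sum>j\<in>UNIV. A $ j $ i * ?C $ j $ k *
      A $ k $ l * inner (u i) (u l))"
    by (rule sum.swap)
  also have "\<dots> = (\<Sum>i\<in>UNIV. \<Sum>l\<in>UNIV. \<Sum>k\<in>UNIV. \<Sum>j\<in>UNIV. A $ j $ i * ?C $ j $ k *
      A $ k $ l * inner (u i) (u l))"
    by (intro sum.cong refl sum.swap)
  finally show ?thesis
    by (simp add: matrix_matrix_mult_def transpose_def sum_distrib_right)
qed

text \<open>Serves integrability: the bound is the same for all matrices with entries in the unit
  interval.\<close>

lemma abs_contraction_entry_le: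
  fixes B :: "real^'m::finite^'m"
  assumes "\<And>i j. 0 \<le> B $ i $ j" "\<And>i j. B $ i $ j \<le> 1"
  shows "\<bar>(transpose B ** centering_matrix ** B) $ i $ l\<bar>
      \<le> (\<Sum>k\<in>UNIV. \<Sum>j\<in>UNIV. \<bar>(centering_matrix :: real^'m^'m) $ j $ k\<bar>)"
proof -
  let ?C = "centering_matrix :: real^'m^'m"
  have "\<bar>(\<Sum>j\<in>UNIV. B $ j $ i * ?C $ j $ k) * B $ k $ l\<bar> \<le> (\<Sum>j\<in>UNIV. \<bar>?C $ j $ k\<bar>)" for k
  proof -
    have "\<bar>B $ j $ i * ?C $ j $ k\<bar> \<le> \<bar>?C $ j $ k\<bar>" for j
      using mult_right_mono[OF assms(2)[of j i], of "\<bar>?C $ j $ k\<bar>"] assms(1)[of j i] by (simp add: abs_mult)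
    hence "\<bar>\<Sum>j\<in>UNIV. B $ j $ i * ?C $ j $ k\<bar> \<le> (\<Sum>j\<in>UNIV. \<bar>?C $ j $ k\<bar>)"
      by (intro order_trans[OF sum_abs] sum_mono)
    moreover have "\<bar>B $ k $ l\<bar> \<le> 1" by (simp add: assms abs_of_nonneg)
    ultimately have "\<bar>\<Sum>j\<in>UNIV. B $ j $ i * ?C $ j $ k\<bar> * \<bar>B $ k $ l\<bar>
        \<le> (\<Sum>j\<in>UNIV. \<bar>?C $ j $ k\<bar>) * 1"
      by (intro mult_mono) (auto simp: sum_nonneg)
    thus ?thesis by (simp add: abs_mult)
  qed
  hence "\<bar>\<Sum>k\<in>UNIV. (\<Sum>j\<in>UNIV. B $ j $ i * ?C $ j $ k) * B $ k $ l\<bar>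
      \<le> (\<Sum>k\<in>UNIV. \<Sum>j\<in>UNIV. \<bar>?C $ j $ k\<bar>)"
    by (intro order_trans[OF sum_abs] sum_mono)
  thus ?thesis by (simp add: matrix_matrix_mult_def transpose_def)
qed

text \<open>The scalar inequality is applied to each coordinate of the vectors with respect to the
  standard basis and the results are added.\<close>

lemma quadratic_form_inner_le:
  fixes P :: "'m::finite \<Rightarrow> 'm \<Rightarrow> real" and u :: "'m \<Rightarrow> 'v::euclidean_space"
  assumes "\<And>v. (\<Sum>i\<in>UNIV. \<Sum>l\<in>UNIV. P i l * (v i * v l)) \<le> r * (\<Sum>i\<in>UNIV. (v i)\<^sup>2)"
  shows "(\<Sum>i\<in>UNIV. \<Sum>l\<in>UNIV. P i l * inner (u i) (u l)) \<le> r * (\<Sum>i\<in>UNIV. (norm (u i))\<^sup>2)"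
proof -
  have "(\<Sum>i\<in>UNIV. \<Sum>l\<in>UNIV. P i l * inner (u i) (u l))
      = (\<Sum>i\<in>UNIV. \<Sum>l\<in>UNIV. \<Sum>b\<in>Basis. P i l * ((u i \<bullet> b) * (u l \<bullet> b)))"
    by (subst euclidean_inner) (simp add: sum_distrib_left)
  also have "\<dots> = (\<Sum>i\<in>UNIV. \<Sum>b\<in>Basis. \<Sum>l\<in>UNIV. P i l * ((u i \<bullet> b) * (u l \<bullet> b)))"
    by (intro sum.cong refl sum.swap)
  also have "\<dots> = (\<Sum>b\<in>Basis. \<Sum>i\<in>UNIV. \<Sum>l\<in>UNIV. P i l * ((u i \<bullet> b) * (u l \<bullet> b)))"
    by (rule sum.swap)
  also have "\<dots> \<le> (\<Sum>b\<in>Basis. r * (\<Sum>i\<in>UNIV. (u i \<bullet> b)\<^sup>2))"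
    using assms by (intro sum_mono) auto
  also have "\<dots> = r * (\<Sum>i\<in>UNIV. \<Sum>b\<in>Basis. (u i \<bullet> b)\<^sup>2)"
    by (simp add: sum_distrib_left) (rule sum.swap)
  also have "\<dots> = r * (\<Sum>i\<in>UNIV. (norm (u i))\<^sup>2)"
    unfolding power2_norm_eq_inner by (subst euclidean_inner[of "u _" "u _"]) (simp add: power2_eq_square)
  finally show ?thesis .
qed

section \<open>Almost supermartingales\<close>

text \<open>Induction on the ansatz B n^(-\<gamma>). With k = n + 1 and q = 1 - 1/k, passing from n
  to k costs the factor q^(-\<gamma>). Since \<gamma> is at most 2, q^\<gamma> is at least 1 - 2/k,
  hence at least 1 - \<delta>/2 by the assumption on k \<delta>. So half of the contraction pays for
  the change of index and the other half absorbs the forcing term.\<close>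

lemma recursion_rate:
  fixes v :: "nat \<Rightarrow> real"
  assumes rec: "\<And>n. n \<ge> K \<Longrightarrow> v (Suc n) \<le> (1 - \<delta> n) * v n
      + C * \<delta> n * real (Suc n) powr -\<gamma>"
    and \<delta>: "\<And>n. n \<ge> K \<Longrightarrow> 0 < \<delta> n \<and> \<delta> n \<le> 1 \<and> 4
        \<le> real (Suc n) * \<delta> n"
    and \<gamma>: "0 \<le> \<gamma>" "\<gamma> \<le> 2" and C: "C \<ge> 0" and K: "K \<ge> 1"
  shows "\<exists>B. \<forall>n\<ge>K. v n \<le> B * real n powr -\<gamma>"
proof -
  \<comment> \<open>The first argument of the maximum lets B \<delta>/2 dominate the forcing C
    \<delta>, the second covers the base case.\<close>
  define B where "B = max (2 * C) (\<bar>v K\<bar> * real K powr \<gamma>)"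
  have B0: "B \<ge> 0" using C unfolding B_def by simp
  have "v n \<le> B * real n powr -\<gamma>" if "n \<ge> K" for n
    using that
  proof (induction n rule: dec_induct)
    case base
    have "v K \<le> \<bar>v K\<bar> * real K powr \<gamma> * real K powr -\<gamma>"
      using K by (simp add: powr_minus field_simps)
    also have "\<dots> \<le> B * real K powr -\<gamma>" by (intro mult_right_mono) (auto simp: B_def)
    finally show ?case .
  next
    case (step n)
    note d = \<delta>[OF step(1)]
    let ?d = "\<delta> n"
    define k where "k = real (Suc n)"
    have kn: "real n = k - 1" and "k > 0" by (auto simp: k_def)
    note d = d[folded k_def]
    have "k * ?d \<le> k * 1" using d \<open>k > 0\<close> by (intro mult_left_mono) auto
    hence k4: "k \<ge> 4" using d by linarith
    define q where "q = 1 - 1 / k"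
    have q: "0 < q" "q \<le> 1" using k4 by (auto simp: q_def field_simps)
    have nq: "real n = k * q" using k4 by (simp add: q_def field_simps kn)
    have "q ^ 2 \<le> q powr \<gamma>"
      using powr_mono'[of \<gamma> 2 q] q \<gamma> by (simp add: powr_numeral)
    have "q\<^sup>2 \<ge> 1 - 2 / k" unfolding q_def by (simp add: power2_eq_square algebra_simps)
    hence "(1 - ?d / 2) * q powr \<gamma> \<ge> (1 - ?d / 2) * (1 - 2 / k)"
      using \<open>q ^ 2 \<le> q powr \<gamma>\<close> d by (intro mult_left_mono) auto
    moreover have "2 / k \<le> ?d / 2" using d k4 by (simp add: field_simps)
    moreover have "(1 - ?d / 2) * (1 - 2 / k) = 1 - ?d / 2 - 2 / k + ?d / 2 * (2 / k)"
      by (simp add: algebra_simps)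
    moreover have "0 \<le> ?d / 2 * (2 / k)" using d k4 by simp
    ultimately have "(1 - ?d) \<le> (1 - ?d / 2) * q powr \<gamma>" by argo
    hence "(1 - ?d) * q powr -\<gamma> \<le> (1 - ?d / 2) * q powr \<gamma> * q powr -\<gamma>"
      by (intro mult_right_mono) auto
    also have "\<dots> = 1 - ?d / 2" using q by (simp add: powr_minus)
    finally have *: "(1 - ?d) * q powr -\<gamma> \<le> 1 - ?d / 2" .
    have "v (Suc n) \<le> (1 - ?d) * v n + C * ?d * k powr -\<gamma>" unfolding k_def by (rule rec[OF step(1)])
    also have "\<dots> \<le> (1 - ?d) * (B * real n powr -\<gamma>) + C * ?d * k powr -\<gamma>"
      using step.IH d by (intro add_right_mono mult_left_mono) auto
    also have "\<dots> = k powr -\<gamma> * (B * ((1 - ?d) * q powr -\<gamma>) + C * ?d)"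
      unfolding nq using q k4 by (simp add: powr_mult algebra_simps)
    also have "\<dots> \<le> k powr -\<gamma> * (B * (1 - ?d / 2) + C * ?d)"
      using * B0 by (intro mult_left_mono add_right_mono) auto
    also have "\<dots> \<le> k powr -\<gamma> * B"
    proof (rule mult_left_mono)
      have "2 * C * ?d \<le> B * ?d" using d by (intro mult_right_mono) (auto simp: B_def)
      thus "B * (1 - ?d / 2) + C * ?d \<le> B" by (simp add: algebra_simps)
    qed simp
    finally show ?case by (simp add: mult.commute k_def)
  qed
  thus ?thesis by blast
qed

text \<open>Doob's strategy holds the process from the moment it drops below \<open>a\<close> until it reaches
    \<open>b\<close>.\<close>

fun inside_upcrossing :: "real \<Rightarrow> real \<Rightarrow> (nat \<Rightarrow> real) \<Rightarrow> nat \<Rightarrow>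
    bool" where
  "inside_upcrossing a b s 0 \<longleftrightarrow> s 0 < a"
| "inside_upcrossing a b s (Suc n) \<longleftrightarrow>
     (if inside_upcrossing a b s n then s (Suc n) < b else s (Suc n) < a)"

fun upcrossings :: "real \<Rightarrow> real \<Rightarrow> (nat \<Rightarrow> real) \<Rightarrow> nat \<Rightarrow> nat" where
  "upcrossings a b s 0 = 0"
| "upcrossings a b s (Suc n) =
     upcrossings a b s n + of_bool (inside_upcrossing a b s n \<and> s (Suc n) \<ge> b)"

text \<open>The second summand on the left is the value of a position still open at time n. It makes
  the induction go through: opening a position below a only makes it negative, and closing at b or
  above realizes at least b - a.\<close>

lemma upcrossings_le_gain:
  assumes "a < b"
  shows "(b - a) * real (upcrossings a b s n) + (if inside_upcrossing a b s n then s n - a else 0)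
    \<le> (\<Sum>i<n. of_bool (inside_upcrossing a b s i) * (s (Suc i) - s i))"
proof (induction n)
  case (Suc n)
  then show ?case using assms by (auto simp: algebra_simps split: if_splits)
qed auto

lemma upcrossings_mono: "m \<le> n \<Longrightarrow> upcrossings a b s m \<le> upcrossings a b s n"
  by (induction n rule: dec_induct) auto

lemma inside_upcrossing_exits:
  assumes ab: "a < b" and freq: "\<exists>\<^sub>\<infinity>n. s n > b"
  shows "\<exists>n\<ge>m. \<not> inside_upcrossing a b s n"
proof -
  obtain n where n: "n > m" "s n > b" using freq unfolding INFM_nat by blast
  then obtain k where "n = Suc k" by (cases n) auto
  hence "\<not> inside_upcrossing a b s n" using n ab by auto
  thus ?thesis using n by (intro exI[of _ n]) auto
qed

text \<open>A visit below a opens a position, a later visit above b forces an exit, and the first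
  exit is exactly where the counter increases.\<close>

lemma upcrossings_unbounded:
  assumes ab: "a < b" and freq: "\<exists>\<^sub>\<infinity>n. s n < a" "\<exists>\<^sub>\<infinity>n. s n > b"
  shows "\<exists>n. upcrossings a b s n \<ge> N"
proof (induction N)
  case (Suc N)
  then obtain n0 where n0: "upcrossings a b s n0 \<ge> N" by blast
  obtain n1 where n1: "n1 > n0" "s n1 < a" using freq(1) unfolding INFM_nat by blast
  then obtain k where k: "n1 = Suc k" by (cases n1) auto
  have in1: "inside_upcrossing a b s n1" using n1 ab by (auto simp: k)
  define n2 where "n2 = (LEAST n. n \<ge> n1 \<and> \<not> inside_upcrossing a b s n)"
  have n2: "n2 \<ge> n1" "\<not> inside_upcrossing a b s n2"
    using LeastI_ex[OF inside_upcrossing_exits[OF ab freq(2), of n1, unfolded Bex_def]]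
    unfolding n2_def by auto
  hence "n2 > n1" using in1 by (cases "n2 = n1") auto
  then obtain l where l: "n2 = Suc l" "l \<ge> n1" by (cases n2) auto
  have "inside_upcrossing a b s l"
    using not_less_Least[of l "\<lambda>n. n \<ge> n1 \<and> \<not> inside_upcrossing a b s n"] l
    unfolding n2_def[symmetric] by auto
  moreover have "s n2 \<ge> b" using n2 calculation by (auto simp: l)
  ultimately have "upcrossings a b s n2 = upcrossings a b s l + 1" by (auto simp: l)
  moreover have "upcrossings a b s n0 \<le> upcrossings a b s l"
    by (rule upcrossings_mono) (use l n1 in auto)
  ultimately have "upcrossings a b s n2 \<ge> Suc N" using n0 by linarith
  thus ?case by blast
qed auto

text \<open>Only rational levels are excluded, so that countably many null sets suffice in the
  application. The upper bound need hold only infinitely often: together with the absence of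
  oscillation between two levels above d it bounds the sequence eventually.\<close>

lemma convergent_if_no_oscillation:
  fixes s :: "nat \<Rightarrow> real"
  assumes osc: "\<And>a b. a \<in> \<rat> \<Longrightarrow> b \<in> \<rat> \<Longrightarrow> a < b
      \<Longrightarrow> \<not> ((\<exists>\<^sub>\<infinity>n. s n < a) \<and> (\<exists>\<^sub>\<infinity>n. s n > b))"
    and lower: "\<And>n. c \<le> s n" and upper: "\<exists>\<^sub>\<infinity>n. s n \<le> d"
  shows "convergent s"
proof -
  obtain a where a: "a \<in> \<rat>" "d < a" using Rats_dense_in_real[of d "d + 1"] by auto
  have "\<exists>\<^sub>\<infinity>n. s n < a" using upper by (rule INFM_mono) (use a in auto)
  hence "\<not> (\<exists>\<^sub>\<infinity>n. s n > a + 1)" using osc[of a "a + 1"] a by auto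
  hence bdd: "\<forall>\<^sub>F n in sequentially. s n \<le> a + 1"
    by (simp add: not_frequently not_less cofinite_eq_sequentially)
  have lim: "liminf (\<lambda>n. ereal (s n)) = limsup (\<lambda>n. ereal (s n))"
  proof (rule ccontr)
    assume "\<not> ?thesis"
    hence "liminf (\<lambda>n. ereal (s n)) < limsup (\<lambda>n. ereal (s n))"
      using Liminf_le_Limsup[of sequentially "\<lambda>n. ereal (s n)"] by auto
    then obtain q r where qr: "liminf (\<lambda>n. ereal (s n)) < ereal q" "ereal q < ereal r" "ereal r < limsup
        (\<lambda>n. ereal (s n))"
      using ereal_dense2 by (metis ereal_less_eq(3) less_le_not_le)
    obtain q' where q': "q' \<in> \<rat>" "q < q'" "q' < (q + r)/2" using Rats_dense_in_real[of q "(q + r)/2"] qr by auto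
    obtain r' where r': "r' \<in> \<rat>" "(q + r)/2 < r'" "r' < r" using Rats_dense_in_real[of "(q + r)/2" r] qr by auto
    have "\<exists>\<^sub>\<infinity>n. s n < q'"
    proof (rule ccontr)
      assume "\<not> ?thesis"
      hence "\<forall>\<^sub>F n in sequentially. ereal q \<le> ereal (s n)"
        by (auto simp: not_frequently not_less cofinite_eq_sequentially elim!: eventually_mono intro: less_imp_le
            less_le_trans[OF q'(2)])
      hence "ereal q \<le> liminf (\<lambda>n. ereal (s n))" by (rule Liminf_bounded)
      thus False using qr by auto
    qed
    moreover have "\<exists>\<^sub>\<infinity>n. s n > r'"
    proof (rule ccontr)
      assume "\<not> ?thesis"
      hence "\<forall>\<^sub>F n in sequentially. ereal (s n) \<le> ereal r"
        by (auto simp: not_frequently not_less cofinite_eq_sequentially elim!: eventually_mono intro: less_imp_le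
            le_less_trans[OF _ r'(3)])
      hence "limsup (\<lambda>n. ereal (s n)) \<le> ereal r" by (rule Limsup_bounded)
      thus False using qr by auto
    qed
    ultimately show False using osc[of q' r'] q' r' by auto
  qed
  have "ereal c \<le> liminf (\<lambda>n. ereal (s n))" by (intro Liminf_bounded) (auto simp: lower)
  moreover have "limsup (\<lambda>n. ereal (s n)) \<le> ereal (a + 1)"
    using bdd by (intro Limsup_bounded) (auto elim: eventually_mono)
  ultimately obtain l where l: "limsup (\<lambda>n. ereal (s n)) = ereal l"
    using lim by (cases "limsup (\<lambda>n. ereal (s n))") auto
  have "s \<longlonglongrightarrow> l"
    by (rule limsup_le_liminf_real) (use lim l in auto)
  thus ?thesis by (auto simp: convergent_def)
qed

text \<open>By monotone convergence the series has a finite integral, so it is finite almost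
  everywhere.\<close>

lemma AE_summable_if_integrals_summable:
  fixes b :: "nat \<Rightarrow> 'a \<Rightarrow> real"
  assumes int: "\<And>n. integrable M (b n)" and nonneg: "\<And>n \<omega>. \<omega> \<in> space M \<Longrightarrow> 0
      \<le> b n \<omega>"
    and sum: "summable (\<lambda>n. LINT \<omega>|M. b n \<omega>)"
  shows "AE \<omega> in M. summable (\<lambda>n. b n \<omega>)"
proof -
  have [measurable]: "b n \<in> borel_measurable M" for n using int by auto
  have int_nonneg: "0 \<le> (LINT \<omega>|M. b n \<omega>)" for n
    by (rule Bochner_Integration.integral_nonneg_AE) (auto simp: nonneg)
  have "(\<integral>\<^sup>+\<omega>. (\<Sum>n. ennreal (b n \<omega>)) \<partial>M)
      = (\<Sum>n. \<integral>\<^sup>+\<omega>. ennreal (b n \<omega>) \<partial>M)"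
    by (rule nn_integral_suminf) simp
  also have "\<dots> = (\<Sum>n. ennreal (LINT \<omega>|M. b n \<omega>))"
    by (intro suminf_cong nn_integral_eq_integral int AE_I2 nonneg)
  also have "\<dots> \<noteq> \<infinity>" using ennreal_suminf_neq_top[OF sum int_nonneg] by simp
  finally have "AE \<omega> in M. (\<Sum>n. ennreal (b n \<omega>)) \<noteq> \<infinity>"
    by (intro nn_integral_noteq_infinite) auto
  thus ?thesis
    by (rule AE_mp[OF _ AE_I2]) (auto intro!: summable_suminf_not_top nonneg)
qed

text \<open>Subtracting the accumulated errors leaves a supermartingale \<open>S\<close>. It is
  bounded below only by minus an integrable sum, which is enough to bound its expected upcrossings.
  These rule out oscillation, Fatou's lemma rules out escape to infinity, and the errors converge by
  themselves.\<close>

theorem (in prob_space) almost_supermartingale_converges: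
  fixes Y b :: "nat \<Rightarrow> 'a \<Rightarrow> real"
  assumes sub: "\<And>n. subalgebra M (G n)" and mono: "\<And>n. sets (G n) \<subseteq> sets (G (Suc n))"
    and Y_meas: "\<And>n. Y n \<in> borel_measurable (G n)" and b_meas: "\<And>n. b n \<in> borel_measurable (G n)"
    and Y_int: "\<And>n. integrable M (Y n)" and b_int: "\<And>n. integrable M (b n)"
    and Y_nonneg: "\<And>n \<omega>. \<omega> \<in> space M \<Longrightarrow> 0 \<le> Y n \<omega>"
        and b_nonneg: "\<And>n \<omega>. \<omega> \<in> space M \<Longrightarrow> 0 \<le> b n \<omega>"
    and b_sum: "summable (\<lambda>n. LINT \<omega>|M. b n \<omega>)"
    and super: "\<And>n B. B \<in> sets (G n) \<Longrightarrow>
      (LINT \<omega>|M. indicator B \<omega> * Y (Suc n) \<omega>)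
          \<le> (LINT \<omega>|M. indicator B \<omega> * (Y n \<omega> + b n \<omega>))"
  shows "AE \<omega> in M. convergent (\<lambda>n. Y n \<omega>)"
proof -
  define S where "S n \<omega> = Y n \<omega> - (\<Sum>i<n. b i \<omega>)" for n \<omega>
  define K where "K = (\<Sum>n. LINT \<omega>|M. b n \<omega>)"
  have space_G: "space (G n) = space M" for n using sub by (auto simp: subalgebra_def)
  have sets_G: "sets (G n) \<subseteq> sets M" for n using sub by (auto simp: subalgebra_def)
  have G_le: "subalgebra (G n) (G i)" if "i \<le> n" for i n
    using lift_Suc_mono_le[of "\<lambda>n. sets (G n)", OF mono that] by (simp add: subalgebra_def space_G)
  have YG: "Y i \<in> borel_measurable (G n)" and bG: "b i \<in> borel_measurable (G n)" if "i \<le> n" for i n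
    using measurable_from_subalg[OF G_le[OF that]] Y_meas b_meas by auto
  have S_meas: "S i \<in> borel_measurable (G n)" if "i \<le> n" for i n
    unfolding S_def using that by (intro borel_measurable_diff borel_measurable_sum YG bG) auto
  have M_meas: "f \<in> borel_measurable M" if "f \<in> borel_measurable (G n)" for f :: "'a \<Rightarrow> real" and n
    by (rule measurable_from_subalg[OF sub that])
  have S_int: "integrable M (S n)" for n unfolding S_def using Y_int b_int by auto
  have b_int_nonneg: "0 \<le> (LINT \<omega>|M. b n \<omega>)" for n
    by (rule Bochner_Integration.integral_nonneg_AE) (auto simp: b_nonneg)
  have b_part: "(\<Sum>i<n. LINT \<omega>|M. b i \<omega>) \<le> K" for n
    unfolding K_def by (rule sum_le_suminf[OF b_sum]) (auto simp: b_int_nonneg)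

  have no_osc: "AE \<omega> in M. \<not> ((\<exists>\<^sub>\<infinity>n. S n \<omega> < a) \<and>
      (\<exists>\<^sub>\<infinity>n. S n \<omega> > c))" if ac: "a < c" for a c
  proof -
    define I where "I n \<omega> \<longleftrightarrow> inside_upcrossing a c (\<lambda>k. S k \<omega>) n" for n \<omega>
    define U where "U n \<omega> = upcrossings a c (\<lambda>k. S k \<omega>) n" for n \<omega>
    \<comment> \<open>Whether a position is held after time n is decided by the values up to n. This
      predictability makes the holding event an admissible test set in \<open>super\<close>.\<close>
    have I_meas: "Measurable.pred (G n) (I n)" for n
    proof (induction n)
      case 0
      have [measurable]: "S 0 \<in> borel_measurable (G 0)" by (rule S_meas) simp
      show ?case unfolding I_def by simp
    next
      case (Suc n)
      have [measurable]: "S (Suc n) \<in> borel_measurable (G (Suc n))" by (rule S_meas) simp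
      have [measurable]: "Measurable.pred (G (Suc n)) (I n)"
        by (rule measurable_from_subalg[OF G_le Suc.IH]) simp
      have "I (Suc n) = (\<lambda>\<omega>. if I n \<omega> then S (Suc n) \<omega> < c else S (Suc n) \<omega> < a)"
        by (auto simp: I_def fun_eq_iff)
      thus ?case by simp
    qed
    have [measurable]: "Measurable.pred M (I n)" for n
      by (rule measurable_from_subalg[OF sub I_meas])
    have [measurable]: "S n \<in> borel_measurable M" for n by (rule M_meas[OF S_meas[OF order_refl]])
    have U_Suc: "U (Suc n) \<omega> = U n \<omega> + of_bool (I n \<omega> \<and> S (Suc n) \<omega> \<ge> c)" for n \<omega>
      by (simp add: U_def I_def)
    have U_meas[measurable]: "(\<lambda>\<omega>. real (U n \<omega>)) \<in> borel_measurable M" for n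
    proof (induction n)
      case (Suc n)
      have "(\<lambda>\<omega>. real (U (Suc n) \<omega>)) = (\<lambda>\<omega>. real (U n \<omega>)
          + (if I n \<omega> \<and> S (Suc n) \<omega> \<ge> c then 1 else 0))"
        by (auto simp: U_Suc fun_eq_iff)
      thus ?case using Suc by simp
    qed (simp add: U_def)
    have U_le: "U n \<omega> \<le> n" for n \<omega>
      by (induction n) (auto simp: U_Suc, simp_all add: U_def)
    have U_incseq: "i \<le> j \<Longrightarrow> U i \<omega> \<le> U j \<omega>" for i j \<omega>
      by (simp add: U_def upcrossings_mono)
    have U_int: "integrable M (\<lambda>\<omega>. real (U n \<omega>))" for n
      by (rule integrable_const_bound[of _ "real n"]) (auto simp: U_le)
    have gain_int: "integrable M (\<lambda>\<omega>. of_bool (I i \<omega>) * (S (Suc i) \<omega> - S i \<omega>))" for i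
      by (rule Bochner_Integration.integrable_bound[of _ "\<lambda>\<omega>. S (Suc i) \<omega>
          - S i \<omega>"]) (auto simp: S_int)
    have gain: "(LINT \<omega>|M. of_bool (I i \<omega>) * (S (Suc i) \<omega> - S i \<omega>)) \<le> 0" for i
    proof -
      define H where "H = {\<omega>\<in>space M. I i \<omega>}"
      have H: "H \<in> sets (G i)" using I_meas[of i] unfolding H_def by (simp add: pred_def space_G)
      hence HM: "H \<in> sets M" using sets_G by auto
      have "(LINT \<omega>|M. of_bool (I i \<omega>) * (S (Suc i) \<omega> - S i \<omega>))
          = (LINT \<omega>|M. indicator H \<omega> * Y (Suc i) \<omega> - indicator H \<omega> * (Y i \<omega> + b i \<omega>))"
        by (rule Bochner_Integration.integral_cong) (auto simp: S_def H_def indicator_def algebra_simps)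
      also have "\<dots> = (LINT \<omega>|M. indicator H \<omega> * Y (Suc i) \<omega>)
          - (LINT \<omega>|M. indicator H \<omega> * (Y i \<omega> + b i \<omega>))"
        using HM Y_int b_int by (intro Bochner_Integration.integral_diff integrable_mult_indicator[where 'b=real,
            simplified]) auto
      finally show ?thesis using super[OF H] by simp
    qed
    have U_bound: "(LINT \<omega>|M. (c - a) * real (U n \<omega>)) \<le> \<bar>a\<bar> + K" for n
    proof -
      have "(LINT \<omega>|M. (c - a) * real (U n \<omega>)) \<le>
          (LINT \<omega>|M. (\<Sum>i<n. of_bool (I i \<omega>) * (S (Suc i) \<omega> - S i \<omega>)) + (\<bar>a\<bar>
              + (\<Sum>i<n. b i \<omega>)))"
      proof (rule integral_mono)
        show "integrable M (\<lambda>\<omega>. (c - a) * real (U n \<omega>))" using U_int by simp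
        show "integrable M (\<lambda>\<omega>. (\<Sum>i<n. of_bool (I i \<omega>) * (S (Suc i) \<omega> - S i \<omega>))
            + (\<bar>a\<bar> + (\<Sum>i<n. b i \<omega>)))"
          by (intro Bochner_Integration.integrable_add Bochner_Integration.integrable_sum gain_int b_int) auto
        fix \<omega> assume w: "\<omega> \<in> space M"
        \<comment> \<open>A position open at time n is worth \<open>S n - a\<close>, which is at
          least minus the accumulated errors minus |a|; hence the bound |a| + K below.\<close>
        have "S n \<omega> \<ge> - (\<Sum>i<n. b i \<omega>)" using Y_nonneg[OF w] by (simp add: S_def)
        moreover have "0 \<le> (\<Sum>i<n. b i \<omega>)" using b_nonneg[OF w] by (intro sum_nonneg) auto
        ultimately show "(c - a) * real (U n \<omega>) \<le> (\<Sum>i<n. of_bool (I i \<omega>) * (S (Suc i) \<omega>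
            - S i \<omega>)) + (\<bar>a\<bar> + (\<Sum>i<n. b i \<omega>))"
          using upcrossings_le_gain[OF ac, of "\<lambda>k. S k \<omega>" n] unfolding U_def I_def
          by (auto split: if_splits)
      qed
      also have "\<dots> = (\<Sum>i<n. LINT \<omega>|M. of_bool (I i \<omega>) * (S (Suc i) \<omega> - S i \<omega>))
          + (\<bar>a\<bar> + (\<Sum>i<n. LINT \<omega>|M. b i \<omega>))"
        using gain_int b_int by (simp add: prob_space del: sum_of_bool_mult_eq sum_mult_of_bool_eq)
      also have "\<dots> \<le> 0 + (\<bar>a\<bar> + K)"
        using gain b_part by (intro add_mono sum_nonpos) auto
      finally show ?thesis by simp
    qed
    \<comment> \<open>The bound on the expected number of upcrossings is uniform in time, so
      monotone convergence makes their total number finite almost surely.\<close>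
    have "(\<integral>\<^sup>+\<omega>. (SUP n. ennreal ((c - a) * real (U n \<omega>))) \<partial>M)
        = (SUP n. \<integral>\<^sup>+\<omega>. ennreal ((c - a) * real (U n \<omega>)) \<partial>M)"
      by (rule nn_integral_monotone_convergence_SUP)
         (use ac in \<open>auto simp: incseq_def le_fun_def intro!: ennreal_leI mult_left_mono U_incseq\<close>)
    also have "\<dots> \<le> ennreal (\<bar>a\<bar> + K)"
    proof (rule SUP_least)
      fix n
      have "(\<integral>\<^sup>+\<omega>. ennreal ((c - a) * real (U n \<omega>)) \<partial>M) = ennreal (LINT \<omega>|M. (c
          - a) * real (U n \<omega>))"
        by (rule nn_integral_eq_integral) (use U_int ac in auto)
      thus "(\<integral>\<^sup>+\<omega>. ennreal ((c - a) * real (U n \<omega>)) \<partial>M) \<le> ennreal (\<bar>a\<bar> + K)"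
        using U_bound by (simp add: ennreal_leI)
    qed
    finally have "(\<integral>\<^sup>+\<omega>. (SUP n. ennreal ((c
        - a) * real (U n \<omega>))) \<partial>M) \<noteq> \<infinity>"
      by (auto simp: top_unique)
    hence "AE \<omega> in M. (SUP n. ennreal ((c - a) * real (U n \<omega>))) \<noteq> \<infinity>"
      by (intro nn_integral_noteq_infinite) auto
    thus ?thesis
    proof (rule AE_mp[OF _ AE_I2], intro impI notI)
      fix \<omega> assume fin: "(SUP n. ennreal ((c - a) * real (U n \<omega>))) \<noteq> \<infinity>"
        and osc: "(\<exists>\<^sub>\<infinity>n. S n \<omega> < a) \<and> (\<exists>\<^sub>\<infinity>n. S n \<omega> > c)"
      then obtain B where B: "(SUP n. ennreal ((c - a) * real (U n \<omega>))) = ennreal B" "B \<ge> 0"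
        by (metis ennreal_cases infinity_ennreal_def)
      obtain N where N: "real N > B / (c - a)" using reals_Archimedean2 by blast
      obtain n where "U n \<omega> \<ge> N"
        using upcrossings_unbounded[OF ac, of "\<lambda>k. S k \<omega>" N] osc unfolding U_def by blast
      hence "B / (c - a) < real (U n \<omega>)" using N by linarith
      hence "B < (c - a) * real (U n \<omega>)" using ac by (simp add: field_simps)
      moreover have "ennreal ((c - a) * real (U n \<omega>)) \<le> ennreal B"
        unfolding B(1)[symmetric] by (rule SUP_upper) simp
      ultimately show False using B by simp
    qed
  qed
  have osc: "AE \<omega> in M. \<forall>a\<in>\<rat>. \<forall>c\<in>\<rat>. a < c \<longrightarrow> \<not>
      ((\<exists>\<^sub>\<infinity>n. S n \<omega> < a) \<and> (\<exists>\<^sub>\<infinity>n. S n \<omega> > c))"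
    by (intro AE_ball_countable[OF countable_rat, THEN iffD2] ballI AE_impI no_osc)

  have [measurable]: "Y n \<in> borel_measurable M" "b n \<in> borel_measurable M" for n
    by (rule M_meas[OF Y_meas], rule M_meas[OF b_meas])
  have summ: "AE \<omega> in M. summable (\<lambda>n. b n \<omega>)"
    by (rule AE_summable_if_integrals_summable[OF b_int b_nonneg b_sum])

  have Y_bound: "(LINT \<omega>|M. Y n \<omega>) \<le> (LINT \<omega>|M. Y 0 \<omega>)
      + (\<Sum>i<n. LINT \<omega>|M. b i \<omega>)" for n
  proof (induction n)
    case (Suc n)
    have "(LINT \<omega>|M. indicator (space M) \<omega> * Y (Suc n) \<omega>)
        \<le> (LINT \<omega>|M. indicator (space M) \<omega> * (Y n \<omega> + b n \<omega>))"
      by (rule super) (metis space_G sets.top)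
    also have "(LINT \<omega>|M. indicator (space M) \<omega> * Y (Suc n) \<omega>) = (LINT \<omega>|M. Y (Suc n) \<omega>)"
      by (rule Bochner_Integration.integral_cong) auto
    also have "(LINT \<omega>|M. indicator (space M) \<omega> * (Y n \<omega> + b n \<omega>))
        = (LINT \<omega>|M. Y n \<omega> + b n \<omega>)"
      by (rule Bochner_Integration.integral_cong) auto
    finally show ?case using Suc Y_int b_int by simp
  qed simp
  \<comment> \<open>The absence of oscillation still permits divergence to infinity; bounded
    expectations and Fatou's lemma exclude it.\<close>
  have "(\<integral>\<^sup>+\<omega>. liminf (\<lambda>n. ennreal (Y n \<omega>)) \<partial>M)
      \<le> liminf (\<lambda>n. \<integral>\<^sup>+\<omega>. ennreal (Y n \<omega>) \<partial>M)"
    by (rule nn_integral_liminf) simp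
  also have "\<dots> \<le> ennreal ((LINT \<omega>|M. Y 0 \<omega>) + K)"
  proof (rule Liminf_le, simp, rule always_eventually, rule allI)
    fix n
    have "(\<integral>\<^sup>+\<omega>. ennreal (Y n \<omega>) \<partial>M) = ennreal (LINT \<omega>|M. Y n \<omega>)"
      by (intro nn_integral_eq_integral Y_int AE_I2 Y_nonneg)
    also have "\<dots> \<le> ennreal ((LINT \<omega>|M. Y 0 \<omega>) + K)"
      using Y_bound[of n] b_part[of n] by (intro ennreal_leI) linarith
    finally show "(\<integral>\<^sup>+\<omega>. ennreal (Y n \<omega>) \<partial>M)
        \<le> ennreal ((LINT \<omega>|M. Y 0 \<omega>) + K)" .
  qed
  finally have "(\<integral>\<^sup>+\<omega>. liminf (\<lambda>n. ennreal (Y n \<omega>)) \<partial>M) \<noteq> \<infinity>"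
      by (auto simp: top_unique)
  hence Y_fin: "AE \<omega> in M. liminf (\<lambda>n. ennreal (Y n \<omega>)) \<noteq> \<infinity>"
    by (intro nn_integral_noteq_infinite) auto

  show ?thesis
    using AE_space osc summ Y_fin
  proof eventually_elim
    fix \<omega> assume w: "\<omega> \<in> space M"
      and osc: "\<forall>a\<in>\<rat>. \<forall>c\<in>\<rat>. a < c \<longrightarrow> \<not>
          ((\<exists>\<^sub>\<infinity>n. S n \<omega> < a) \<and> (\<exists>\<^sub>\<infinity>n. S n \<omega> > c))"
      and summ: "summable (\<lambda>n. b n \<omega>)" and fin: "liminf (\<lambda>n. ennreal (Y n \<omega>)) \<noteq> \<infinity>"
    obtain B where B: "liminf (\<lambda>n. ennreal (Y n \<omega>)) = ennreal B" "B \<ge> 0"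
      using fin by (metis ennreal_cases infinity_ennreal_def)
    have "\<exists>\<^sub>\<infinity>n. Y n \<omega> \<le> B + 1"
    proof (rule ccontr)
      assume "\<not> ?thesis"
      hence "\<forall>\<^sub>F n in sequentially. ennreal (B + 1) \<le> ennreal (Y n \<omega>)"
        by (auto simp: not_frequently not_le cofinite_eq_sequentially elim!: eventually_mono intro!: ennreal_leI)
      hence "ennreal (B + 1) \<le> liminf (\<lambda>n. ennreal (Y n \<omega>))" by (rule Liminf_bounded)
      thus False using B by simp
    qed
    hence up: "\<exists>\<^sub>\<infinity>n. S n \<omega> \<le> B + 1"
    proof (rule INFM_mono)
      fix n assume "Y n \<omega> \<le> B + 1"
      moreover have "0 \<le> (\<Sum>i<n. b i \<omega>)" using b_nonneg[OF w] by (intro sum_nonneg) auto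
      ultimately show "S n \<omega> \<le> B + 1" by (simp add: S_def)
    qed
    \<comment> \<open>This lower bound depends on the outcome, which is harmless because the
      oscillation criterion is applied path by path.\<close>
    have low: "- (\<Sum>i. b i \<omega>) \<le> S n \<omega>" for n
      using sum_le_suminf[OF summ, of "{..<n}"] b_nonneg[OF w] Y_nonneg[OF w, of n] by (simp add: S_def)
    have "convergent (\<lambda>n. S n \<omega>)"
      by (rule convergent_if_no_oscillation[OF _ low up]) (use osc in blast)
    moreover have "convergent (\<lambda>n. \<Sum>i<n. b i \<omega>)"
      using summ by (simp add: summable_iff_convergent)
    ultimately have "convergent (\<lambda>n. S n \<omega> + (\<Sum>i<n. b i \<omega>))" by (rule convergent_add)
    thus "convergent (\<lambda>n. Y n \<omega>)" by (simp add: S_def)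
  qed
qed

section \<open>Gradients, supports and histories\<close>

text \<open>By second countability the complement of the support is a union of countably many basic
  open sets of probability zero; it is therefore open and has probability zero.\<close>

lemma
  fixes Y :: "'a \<Rightarrow> 's::second_countable_topology"
  assumes "prob_space M" and Y[measurable]: "Y \<in> M \<rightarrow>\<^sub>M borel"
  shows closed_support_of: "closed (support_of M Y)"
    and AE_in_support_of: "AE \<omega> in M. Y \<omega> \<in> support_of M Y"
proof -
  interpret prob_space M by fact
  obtain \<B> :: "'s set set" where \<B>: "countable \<B>" "topological_basis \<B>" using ex_countable_basis by blast
  define \<N> where "\<N> = {b\<in>\<B>. measure M (Y -` b \<inter> space M) = 0}"
  have op: "open b" if "b \<in> \<B>" for b using topological_basis_open[OF \<B>(2) that] .
  have eq: "- support_of M Y = \<Union>\<N>"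
  proof (intro set_eqI iffI)
    fix y assume "y \<in> - support_of M Y"
    then obtain U where U: "open U" "y \<in> U" "measure M (Y -` U \<inter> space M) = 0"
      unfolding support_of_def using measure_nonneg[of M] by (force simp: not_less less_le)
    obtain b where b: "b \<in> \<B>" "y \<in> b" "b \<subseteq> U" using topological_basisE[OF \<B>(2) U(1,2)] by blast
    have "measure M (Y -` b \<inter> space M) \<le> measure M (Y -` U \<inter> space M)"
      by (rule finite_measure_mono) (use b(3) measurable_sets[OF Y borel_open[OF U(1)]] in auto)
    hence "b \<in> \<N>" using U(3) b(1) measure_nonneg[of M "Y -` b \<inter> space M"] by (simp add: \<N>_def)
    thus "y \<in> \<Union>\<N>" using b(2) by blast
  next
    fix y assume "y \<in> \<Union>\<N>"
    then obtain b where "b \<in> \<B>" "measure M (Y -` b \<inter> space M) = 0" "y \<in> b" by (auto simp: \<N>_def)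
    thus "y \<in> - support_of M Y" using op unfolding support_of_def by fastforce
  qed
  have "open (- support_of M Y)" unfolding eq using op by (intro open_Union) (auto simp: \<N>_def)
  thus "closed (support_of M Y)" by (simp add: closed_def)
  have "countable \<N>" using \<B>(1) by (simp add: \<N>_def)
  have "AE \<omega> in M. \<forall>b\<in>\<N>. Y \<omega> \<notin> b"
  proof (rule AE_ball_countable[OF \<open>countable \<N>\<close>, THEN iffD2], rule ballI)
    fix b assume b: "b \<in> \<N>"
    have "Y -` b \<inter> space M \<in> sets M" using b op by (intro measurable_sets[OF Y]) (auto simp: \<N>_def)
    moreover have "emeasure M (Y -` b \<inter> space M) = 0" using b by (simp add: \<N>_def emeasure_eq_measure)
    ultimately have "Y -` b \<inter> space M \<in> null_sets M" by (simp add: null_setsI)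
    thus "AE \<omega> in M. Y \<omega> \<notin> b" by (rule AE_I') auto
  qed
  thus "AE \<omega> in M. Y \<omega> \<in> support_of M Y"
    by eventually_elim (use eq in blast)
qed

text \<open>\<open>grad\<close> is a definite description, so existence and uniqueness are both
  required: the first comes from representing the derivative in the standard basis, the second from
  uniqueness of derivatives.\<close>

lemma GDERIV_grad:
  fixes f :: "'v::euclidean_space \<Rightarrow> real"
  assumes "f differentiable (at y)"
  shows "GDERIV f y :> grad f y"
proof -
  obtain f' where f': "(f has_derivative f') (at y)" using assms by (auto simp: differentiable_def)
  interpret f': bounded_linear f' by (rule has_derivative_bounded_linear[OF f'])
  have "f' = (\<lambda>h. inner h (\<Sum>b\<in>Basis. f' b *\<^sub>R b))"
  proof
    fix h
    have "f' h = f' (\<Sum>b\<in>Basis. (h \<bullet> b) *\<^sub>R b)" by (simp add: euclidean_representation)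
    also have "\<dots> = (\<Sum>b\<in>Basis. (h \<bullet> b) * f' b)" by (simp add: f'.sum f'.scaleR)
    finally show "f' h = inner h (\<Sum>b\<in>Basis. f' b *\<^sub>R b)" by (simp add: inner_sum_right mult.commute)
  qed
  hence D: "GDERIV f y :> (\<Sum>b\<in>Basis. f' b *\<^sub>R b)" using f' unfolding gderiv_def by simp
  show ?thesis unfolding grad_def
  proof (rule theI[of "\<lambda>D. GDERIV f y :> D", OF D])
    fix E assume "GDERIV f y :> E"
    hence "(\<lambda>h. inner h E) = (\<lambda>h. inner h (\<Sum>b\<in>Basis. f' b *\<^sub>R b))"
      using D unfolding gderiv_def by (rule has_derivative_unique)
    thus "E = (\<Sum>b\<in>Basis. f' b *\<^sub>R b)" by (metis vector_eq_ldot)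
  qed
qed

lemma GDERIV_directional:
  assumes "GDERIV f y :> D"
  shows "((\<lambda>t. f (y + t *\<^sub>R v)) has_real_derivative inner D v) (at 0)"
proof -
  have 1: "((\<lambda>t. y + t *\<^sub>R v) has_derivative (\<lambda>t. t *\<^sub>R v)) (at 0)"
    by (auto intro!: derivative_eq_intros)
  have 2: "(f has_derivative (\<lambda>h. inner h D)) (at (y + 0 *\<^sub>R v))"
    using assms unfolding gderiv_def by simp
  have "((\<lambda>t. f (y + t *\<^sub>R v)) has_derivative (\<lambda>t. inner (t *\<^sub>R v) D)) (at 0)"
    by (rule has_derivative_compose[OF 1 2])
  thus ?thesis by (rule has_derivative_imp_has_field_derivative) (simp add: inner_commute)
qed

text \<open>The point y may lie on the boundary of X, where convexity says nothing about both
  directions. Only difference quotients from the right along the segment towards v are used.\<close>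

lemma convex_on_grad_ineq:
  fixes f :: "'v::euclidean_space \<Rightarrow> real"
  assumes cf: "convex_on X f" and df: "f differentiable (at y)" and y: "y \<in> X" and v: "v \<in> X"
  shows "f y + inner (grad f y) (v - y) \<le> f v"
proof -
  have "((\<lambda>t. f (y + t *\<^sub>R (v - y))) has_real_derivative inner (grad f y) (v - y)) (at 0)"
    by (rule GDERIV_directional[OF GDERIV_grad[OF df]])
  hence "((\<lambda>t. (f (y + t *\<^sub>R (v - y)) - f y) / t) \<longlongrightarrow> inner (grad f y) (v - y)) (at 0)"
    by (simp add: has_field_derivative_iff)
  hence "((\<lambda>t. (f (y + t *\<^sub>R (v - y)) - f y) / t) \<longlongrightarrow> inner (grad f y) (v - y)) (at_right 0)"
    by (rule tendsto_mono[OF at_le, rotated]) simp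
  moreover have "\<forall>\<^sub>F t in at_right 0. (f (y + t *\<^sub>R (v - y)) - f y) / t \<le> f v - f y"
  proof -
    have "(f (y + t *\<^sub>R (v - y)) - f y) / t \<le> f v - f y" if t: "0 < t" "t < 1" for t :: real
    proof -
      have "f ((1 - t) *\<^sub>R y + t *\<^sub>R v) \<le> (1 - t) * f y + t * f v"
        using t by (intro convex_onD[OF cf] y v) auto
      moreover have "(1 - t) *\<^sub>R y + t *\<^sub>R v = y + t *\<^sub>R (v - y)" by (simp add: algebra_simps)
      ultimately show ?thesis using t by (simp add: field_simps)
    qed
    thus ?thesis unfolding eventually_at_right_field by (intro exI[of _ 1]) auto
  qed
  ultimately have "inner (grad f y) (v - y) \<le> f v - f y"
    by (rule tendsto_upperbound) simp
  thus ?thesis by simp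
qed

text \<open>Each coordinate of the gradient is a limit of forward difference quotients with steps
  1/(n+1). The shifted points may leave X, but F is jointly measurable on the whole space.\<close>

lemma clipped_grad_measurable:
  fixes F :: "'v::euclidean_space \<Rightarrow> 's::topological_space \<Rightarrow> real"
  assumes F: "(\<lambda>(y, s). F y s) \<in> borel_measurable (borel \<Otimes>\<^sub>M borel)"
    and X[measurable]: "X \<in> sets borel" and S[measurable]: "S \<in> sets borel"
    and diff: "\<And>y s. y \<in> X \<Longrightarrow> s \<in> S \<Longrightarrow> (\<lambda>y. F y s) differentiable (at y)"
  shows "(\<lambda>(y, s). if y \<in> X \<and> s \<in> S then grad (\<lambda>y. F y s) y else 0) \<in> borel_measurable
      (borel \<Otimes>\<^sub>M borel)"
proof (rule borel_measurable_euclidean_space[THEN iffD2], rule ballI)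
  fix b :: 'v assume "b \<in> Basis"
  let ?g = "\<lambda>(y, s). if y \<in> X \<and> s \<in> S then grad (\<lambda>y. F y s) y else 0"
  define q where "q n p = (if fst p \<in> X \<and> snd p \<in> S
      then (F (fst p + (1 / real (Suc n)) *\<^sub>R b) (snd p) - F (fst p) (snd p)) / (1 / real (Suc n)) else 0)" for n p
  show "(\<lambda>p. ?g p \<bullet> b) \<in> borel_measurable (borel \<Otimes>\<^sub>M borel)"
  proof (rule borel_measurable_LIMSEQ_real)
    fix n
    have [measurable]: "(\<lambda>p. F (fst p
        + (1 / real (Suc n)) *\<^sub>R b) (snd p)) \<in> borel_measurable (borel \<Otimes>\<^sub>M borel)"
      "(\<lambda>p. F (fst p) (snd p)) \<in> borel_measurable (borel \<Otimes>\<^sub>M borel)"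
      using measurable_compose[OF _ F, of "\<lambda>p. (fst p
          + (1 / real (Suc n)) *\<^sub>R b, snd p)" "borel \<Otimes>\<^sub>M borel"]
        measurable_compose[OF _ F, of "\<lambda>p. (fst p, snd p)" "borel \<Otimes>\<^sub>M borel"] by simp_all
    show "q n \<in> borel_measurable (borel \<Otimes>\<^sub>M borel)" unfolding q_def[abs_def] by measurable
  next
    fix p :: "'v \<times> 's"
    show "(\<lambda>n. q n p) \<longlonglongrightarrow> ?g p \<bullet> b"
    proof (cases "fst p \<in> X \<and> snd p \<in> S")
      case True
      let ?f = "\<lambda>y. F y (snd p)"
      have "((\<lambda>t. ?f (fst p + t *\<^sub>R b)) has_real_derivative inner (grad ?f (fst p)) b) (at 0)"
        using True by (intro GDERIV_directional GDERIV_grad diff) auto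
      hence lim: "((\<lambda>t. (?f (fst p + t *\<^sub>R b)
          - ?f (fst p)) / t) \<longlongrightarrow> inner (grad ?f (fst p)) b) (at 0)"
        by (simp add: has_field_derivative_iff)
      have "filterlim (\<lambda>n. 1 / real (Suc n)) (at 0) sequentially"
        unfolding filterlim_at using LIMSEQ_inverse_real_of_nat by (simp add: inverse_eq_divide)
      from filterlim_compose[OF lim this] show ?thesis using True by (simp add: q_def split_beta)
    next
      case False
      have "q n p = 0" for n using False by (auto simp: q_def)
      moreover have "?g p = 0" using False by (auto simp: split_beta)
      ultimately show ?thesis by simp
    qed
  qed
qed

section \<open>Sigma-algebras generated by the past\<close>

lemma sigma_sets_of_measurable:
  assumes "Y \<in> M \<rightarrow>\<^sub>M borel" shows "sigma_sets_of M Y \<subseteq> sets M"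
  unfolding sigma_sets_of_def using assms by (subst sets_vimage_algebra2) auto

lemma history_generators:
  fixes M :: "'a measure"
  assumes z0: "\<And>j. z0 j \<in> borel_measurable M" and \<xi>s: "\<And>j t. t \<ge> 1
      \<Longrightarrow> \<xi>s j t \<in> borel_measurable M"
    and A: "\<And>t. t \<ge> 1 \<Longrightarrow> A t \<in> borel_measurable M"
  shows subalgebra_history: "subalgebra M (history M z0 \<xi>s A k)"
    and history_mono: "sets (history M z0 \<xi>s A k) \<subseteq> sets (history M z0 \<xi>s A (Suc k))"
    and history_z0: "z0 j \<in> borel_measurable (history M z0 \<xi>s A k)"
    and history_sample: "1 \<le> t \<Longrightarrow> t < k
        \<Longrightarrow> \<xi>s j t \<in> borel_measurable (history M z0 \<xi>s A k)"
    and history_matrix: "1 \<le> t \<Longrightarrow> t < k \<Longrightarrow> A t \<in> borel_measurable (history M z0 \<xi>s A k)"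
proof -
  define \<E> where "\<E> k
      = (\<Union>j. sigma_sets_of M (z0 j)) \<union> (\<Union>j. \<Union>t\<in>{1..<k}. sigma_sets_of M (\<xi>s j t))
      \<union> (\<Union>t\<in>{1..<k}. sigma_sets_of M (A t))" for k
  have EM: "\<E> k \<subseteq> sets M" for k
    unfolding \<E>_def using sigma_sets_of_measurable[OF z0] sigma_sets_of_measurable[OF \<xi>s] sigma_sets_of_measurable[OF A]
    by fastforce
  hence EP: "\<E> k \<subseteq> Pow (space M)" for k using sets.space_closed by blast
  have h: "history M z0 \<xi>s A k = sigma (space M) (\<E> k)" for k unfolding history_def \<E>_def ..
  have hs: "sets (history M z0 \<xi>s A k) = sigma_sets (space M) (\<E> k)" "space (history M z0 \<xi>s A k) = space M" for k
    unfolding h using EP by (simp_all add: sets_measure_of space_measure_of)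
  show "subalgebra M (history M z0 \<xi>s A k)"
    unfolding subalgebra_def hs using sets.sigma_sets_subset[OF EM] by simp
  have "\<E> k \<subseteq> \<E> (Suc k)" unfolding \<E>_def by fastforce
  thus "sets (history M z0 \<xi>s A k) \<subseteq> sets (history M z0 \<xi>s A (Suc k))"
    unfolding hs by (rule sigma_sets_mono')
  have meas: "Y \<in> borel_measurable (history M z0 \<xi>s A k)" if "sigma_sets_of M Y \<subseteq> \<E> k" for Y :: "'a
      \<Rightarrow> 'x::topological_space"
  proof (rule measurableI)
    fix T :: "'x set" assume T: "T \<in> sets borel"
    have "Y -` T \<inter> space M \<in> sigma_sets_of M Y" unfolding sigma_sets_of_def by (rule in_vimage_algebra[OF T])
    thus "Y -` T \<inter> space (history M z0 \<xi>s A k) \<in> sets (history M z0 \<xi>s A k)"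
      unfolding hs using that by blast
  qed simp
  show "z0 j \<in> borel_measurable (history M z0 \<xi>s A k)" by (rule meas) (auto simp: \<E>_def)
  show "\<xi>s j t \<in> borel_measurable (history M z0 \<xi>s A k)" if "1 \<le> t" "t < k"
    by (rule meas) (use that in \<open>auto simp: \<E>_def\<close>)
  show "A t \<in> borel_measurable (history M z0 \<xi>s A k)" if "1 \<le> t" "t < k"
    by (rule meas) (use that in \<open>auto simp: \<E>_def\<close>)
qed

text \<open>Lets independence of the past pass from the weight matrix to any measurable function of
  it.\<close>

lemma sigma_sets_of_comp_subset:
  assumes "h \<in> borel \<rightarrow>\<^sub>M borel"
  shows "sigma_sets_of M (\<lambda>\<omega>. h (Y \<omega>)) \<subseteq> sigma_sets_of M Y"
  unfolding sigma_sets_of_def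
  by (subst sets_vimage_algebra2, simp)
     (use measurable_sets[OF measurable_compose[OF measurable_vimage_algebra1[of Y "space M" borel] assms]] in auto)

text \<open>The hypotheses on the weights concern integrals of matrix-valued functions, whereas the
  estimates use scalar integrals. Expanding in the matrix units gives integrability of the matrix,
  and evaluation of an entry is bounded and linear.\<close>

lemma matrix_integral_entries:
  fixes B :: "'a \<Rightarrow> real^'m::finite^'n::finite"
  assumes int: "\<And>i l. integrable M (\<lambda>\<omega>. B \<omega> $ i $ l)"
  shows "(LINT \<omega>|M. B \<omega>) $ i $ l = (LINT \<omega>|M. B \<omega> $ i $ l)"
proof -
  have [simp]: "(\<Sum>x\<in>UNIV. if c then h x else 0) = (if c then sum h UNIV else 0)" for c and h :: "'m \<Rightarrow> real"
    by simp
  have "B \<omega> = (\<Sum>i\<in>UNIV. \<Sum>l\<in>UNIV. B \<omega> $ i $ l *\<^sub>R axis i (axis l 1))" for \<omega>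
    by (simp add: vec_eq_iff axis_def if_distrib[of "\<lambda>v. _ * v"] if_distrib[of "\<lambda>v. v $ _"] cong: if_cong)
  hence "integrable M B \<longleftrightarrow> integrable M (\<lambda>\<omega>. \<Sum>i\<in>UNIV. \<Sum>l\<in>UNIV. B
      \<omega> $ i $ l *\<^sub>R (axis i (axis l 1) :: real^'m^'n))"
    by presburger
  hence "integrable M B" using int by auto
  moreover have "bounded_linear (\<lambda>B::real^'m^'n. B $ i $ l)"
    by (rule bounded_linear_compose[OF bounded_linear_vec_nth bounded_linear_vec_nth])
  ultimately show ?thesis using integral_bounded_linear[of "\<lambda>B. B $ i $ l" M B] by simp
qed

lemma quadratic_form_le_spectral_norm:
  fixes P :: "real^'m::finite^'m"
  shows "(\<Sum>i\<in>UNIV. \<Sum>l\<in>UNIV. P $ i $ l * (v i * v l)) \<le> spectral_norm P * (\<Sum>i\<in>UNIV. (v i)\<^sup>2)"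
proof -
  let ?v = "\<chi> i. v i"
  have lin: "bounded_linear (\<lambda>v. P *v v)" by (rule matrix_vector_mul_bounded_linear)
  have "(\<Sum>i\<in>UNIV. \<Sum>l\<in>UNIV. P $ i $ l * (v i * v l)) = inner ?v (P *v ?v)"
    by (simp add: inner_vec_def matrix_vector_mult_def sum_distrib_left mult_ac)
  also have "\<dots> \<le> norm ?v * norm (P *v ?v)" by (rule norm_cauchy_schwarz)
  also have "\<dots> \<le> norm ?v * (spectral_norm P * norm ?v)"
    unfolding spectral_norm_def by (intro mult_left_mono onorm[OF lin]) auto
  also have "\<dots> = spectral_norm P * (norm ?v)\<^sup>2" by (simp add: power2_eq_square)
  also have "(norm ?v)\<^sup>2 = (\<Sum>i\<in>UNIV. (v i)\<^sup>2)"
    unfolding power2_norm_eq_inner by (simp add: inner_vec_def power2_eq_square)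
  finally show ?thesis .
qed

lemma spectral_norm_nonneg: "0 \<le> spectral_norm P"
  unfolding spectral_norm_def by (rule onorm_pos_le[OF matrix_vector_mul_bounded_linear])

section \<open>Distributed dual averaging with everywhere stochastic weights\<close>

lemma inner_le_squares: "\<bar>inner a b\<bar> \<le> (norm a)\<^sup>2 + (norm b)\<^sup>2" for a b :: "'b::real_inner"
proof -
  have "\<bar>inner a b\<bar> \<le> norm a * norm b" by (rule Cauchy_Schwarz_ineq2)
  also have "\<dots> \<le> (norm a)\<^sup>2 + (norm b)\<^sup>2"
    using sum_squares_bound[of "norm a" "norm b"] mult_nonneg_nonneg[OF norm_ge_zero[of a] norm_ge_zero[of b]]
    by linarith
  finally show ?thesis .
qed

lemma norm_diff_squared_le: "(norm (a - b))\<^sup>2 \<le> 2 * (norm a)\<^sup>2 + 2 * (norm b)\<^sup>2" for a b :: "'b::real_inner"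
proof -
  have "0 \<le> (norm (a + b))\<^sup>2" by simp
  thus ?thesis unfolding power2_norm_eq_inner by (simp add: inner_add inner_diff inner_commute)
qed

section \<open>Integrating out one fresh variable\<close>

lemma sigma_sets_preimages_subset:
  assumes "X \<in> K \<rightarrow>\<^sub>M N"
  shows "sigma_sets (space K) {X -` A \<inter> space K |A. A \<in> sets N} \<subseteq> sets K"
  using measurable_sets[OF assms] by (intro sets.sigma_sets_subset) auto

text \<open>The version for a product of a fresh factor and a past factor; here integrability of the
  product is a conclusion, not a hypothesis.\<close>

lemma (in prob_space) expectation_fresh_mult:
  fixes h :: "'s::topological_space \<Rightarrow> real" and Y :: "'a \<Rightarrow> real"
  assumes H: "subalgebra M H"
    and ind: "indep_set (sigma_sets_of M \<xi>) (sets H)" and Y: "Y \<in> borel_measurable H"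
    and h: "h \<in> borel_measurable borel" and int: "integrable M (\<lambda>\<omega>. h (\<xi> \<omega>))" "integrable M Y"
  shows "integrable M (\<lambda>\<omega>. h (\<xi> \<omega>) * Y \<omega>)"
    "(LINT \<omega>|M. h (\<xi> \<omega>) * Y \<omega>) = (LINT \<omega>|M. h (\<xi> \<omega>)) * (LINT \<omega>|M. Y \<omega>)"
proof -
  let ?V = "vimage_algebra (space M) \<xi> borel"
  have "(\<lambda>\<omega>. h (\<xi> \<omega>)) \<in> borel_measurable ?V"
    by (rule measurable_compose[OF measurable_vimage_algebra1 h]) auto
  from sigma_sets_preimages_subset[OF this]
  have "sigma_sets (space M) {(\<lambda>\<omega>. h (\<xi> \<omega>)) -` A \<inter> space M |A. A \<in> sets borel}
      \<subseteq> sigma_sets_of M \<xi>"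
    by (simp add: sigma_sets_of_def)
  moreover have "sigma_sets (space M) {Y -` A \<inter> space M |A. A \<in> sets borel} \<subseteq> sets H"
    using sigma_sets_preimages_subset[OF Y] H by (simp add: subalgebra_def)
  ultimately have "indep_set (sigma_sets (space M) {(\<lambda>\<omega>. h (\<xi> \<omega>)) -` A \<inter> space M |A. A
      \<in> sets borel})
      (sigma_sets (space M) {Y -` A \<inter> space M |A. A \<in> sets borel})"
    using ind unfolding indep_set_def
    by (elim indep_sets_mono_sets) (auto split: bool.split)
  hence i: "indep_var borel (\<lambda>\<omega>. h (\<xi> \<omega>)) borel Y"
    unfolding indep_var_eq using int by auto
  show "integrable M (\<lambda>\<omega>. h (\<xi> \<omega>) * Y \<omega>)"
    "(LINT \<omega>|M. h (\<xi> \<omega>) * Y \<omega>) = (LINT \<omega>|M. h (\<xi> \<omega>)) * (LINT \<omega>|M. Y \<omega>)"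
    using indep_var_integrable[OF i int] indep_var_lebesgue_integral[OF i int] by auto
qed

text \<open>Independence makes the joint law of the past variable and the fresh one a product
  measure, and Fubini's theorem integrates the fresh coordinate first. This covers functions in
  which the two variables are not separated into factors.\<close>

lemma (in prob_space) expectation_fresh:
  fixes \<Phi> :: "'b \<times> 's::topological_space \<Rightarrow> real"
  assumes H: "subalgebra M H" and \<xi>[measurable]: "\<xi> \<in> M \<rightarrow>\<^sub>M borel"
    and ind: "indep_set (sigma_sets_of M \<xi>) (sets H)" and Y: "Y \<in> H \<rightarrow>\<^sub>M N"
    and \<Phi>[measurable]: "\<Phi> \<in> borel_measurable (N \<Otimes>\<^sub>M borel)"
    and int: "integrable M (\<lambda>\<omega>. \<Phi> (Y \<omega>, \<xi> \<omega>))"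
  shows "(LINT \<omega>|M. \<Phi> (Y \<omega>, \<xi> \<omega>))
      = (LINT \<omega>|M. (LINT s|distr M borel \<xi>. \<Phi> (Y \<omega>, s)))"
proof -
  have YM[measurable]: "Y \<in> M \<rightarrow>\<^sub>M N" using measurable_from_subalg[OF H Y] .
  interpret D: prob_space "distr M borel \<xi>" by (rule prob_space_distr[OF \<xi>])
  interpret E: prob_space "distr M N Y" by (rule prob_space_distr[OF YM])
  interpret P: pair_sigma_finite "distr M N Y" "distr M borel \<xi>" ..
  have eq: "distr M N Y \<Otimes>\<^sub>M distr M borel \<xi>
      = distr M (N \<Otimes>\<^sub>M borel) (\<lambda>\<omega>. (Y \<omega>, \<xi> \<omega>))"
  proof (rule pair_measure_eqI)
    fix S T assume "S \<in> sets (distr M N Y)" "T \<in> sets (distr M borel \<xi>)"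
    hence S[measurable]: "S \<in> sets N" and T[measurable]: "T \<in> sets borel" by auto
    have "\<xi> -` T \<inter> space M \<in> sigma_sets_of M \<xi>"
      unfolding sigma_sets_of_def by (rule in_vimage_algebra[OF T])
    moreover have "Y -` S \<inter> space M \<in> sets H"
      using measurable_sets[OF Y S] H by (simp add: subalgebra_def)
    ultimately have "prob ((\<xi> -` T \<inter> space M) \<inter> (Y -` S \<inter> space M))
        = prob (\<xi> -` T \<inter> space M) * prob (Y -` S \<inter> space M)"
      by (rule indep_setD[OF ind])
    moreover have "(\<lambda>\<omega>. (Y \<omega>, \<xi> \<omega>)) -` (S \<times> T) \<inter> space M
        = (\<xi> -` T \<inter> space M) \<inter> (Y -` S \<inter> space M)" by auto
    ultimately show "emeasure (distr M N Y) S * emeasure (distr M borel \<xi>) T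
        = emeasure (distr M (N \<Otimes>\<^sub>M borel) (\<lambda>\<omega>. (Y \<omega>, \<xi> \<omega>))) (S \<times> T)"
      by (simp add: emeasure_distr emeasure_eq_measure ennreal_mult'' mult.commute)
  qed (auto intro: D.sigma_finite_measure_axioms E.sigma_finite_measure_axioms cong: sets_pair_measure_cong)
  have "integrable (distr M N Y \<Otimes>\<^sub>M distr M borel \<xi>) \<Phi>"
    unfolding eq by (subst integrable_distr_eq) (use int in auto)
  hence "(LINT y|distr M N Y. (LINT s|distr M borel \<xi>. \<Phi> (y, s)))
      = integral\<^sup>L (distr M N Y \<Otimes>\<^sub>M distr M borel \<xi>) \<Phi>"
    by (rule P.integral_fst')
  also have "\<dots> = (LINT \<omega>|M. \<Phi> (Y \<omega>, \<xi> \<omega>))" unfolding eq by (subst integral_distr) auto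
  finally show ?thesis
    by (subst (asm) integral_distr) (auto intro!: D.borel_measurable_lebesgue_integral)
qed

text \<open>Step \<open>n\<close> of the locale is step \<open>n + 1\<close> of the algorithm,
    and \<open>G n\<close> is the history before that step.\<close>

locale dual_averaging = prob_space M + mirror X \<psi> \<sigma>
  for M :: "'a measure" and X :: "'v::euclidean_space set" and \<psi> :: "'v \<Rightarrow> real" and \<sigma> :: real +
  fixes G :: "nat \<Rightarrow> 'a measure" and A :: "nat \<Rightarrow> 'a \<Rightarrow> real^'m^'m"
    and \<xi> :: "'m::finite \<Rightarrow> nat \<Rightarrow> 'a \<Rightarrow> 's::topological_space"
        and D :: "'m \<Rightarrow> 's measure"
    and F :: "'m \<Rightarrow> 'v \<Rightarrow> 's \<Rightarrow> real"
        and g :: "'m \<Rightarrow> 'v \<Rightarrow> 's \<Rightarrow> 'v" and L :: "'m \<Rightarrow> 's \<Rightarrow> real"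
    and \<alpha> \<rho> :: "nat \<Rightarrow> real" and z :: "'m \<Rightarrow> nat \<Rightarrow> 'a \<Rightarrow> 'v"
  assumes sub: "\<And>n. subalgebra M (G n)" and G_mono: "\<And>n. sets (G n) \<subseteq> sets (G (Suc n))"
    and z0_meas: "\<And>j. z j 0 \<in> borel_measurable (G 0)"
    and A_meas: "\<And>n. A n \<in> borel_measurable (G (Suc n))"
    and xi_meas: "\<And>j n. \<xi> j n \<in> borel_measurable (G (Suc n))"
    and A_fresh: "\<And>n. indep_set (sigma_sets_of M (A n)) (sets (G n))"
    and xi_fresh: "\<And>j n. indep_set (sigma_sets_of M (\<xi> j n)) (sets (G n))"
    and xi_distr: "\<And>j n. distr M borel (\<xi> j n) = D j"
    and A_nonneg: "\<And>n \<omega> i j. 0 \<le> A n \<omega> $ i $ j"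
    and A_row: "\<And>n \<omega> i. (\<Sum>j\<in>UNIV. A n \<omega> $ i $ j) = 1"
    and A_col: "\<And>n j. (\<Sum>i\<in>UNIV. LINT \<omega>|M. A n \<omega> $ i $ j) = 1"
    and A_contr: "\<And>n v. (\<Sum>i\<in>UNIV. \<Sum>l\<in>UNIV.
        (LINT \<omega>|M. (transpose (A n \<omega>) ** centering_matrix ** A n \<omega>) $ i $ l) * (v i * v l))
            \<le> \<rho> n * (\<Sum>i\<in>UNIV. (v i)\<^sup>2)"
    and F_meas: "\<And>j. (\<lambda>(y, s). F j y s) \<in> borel_measurable (borel \<Otimes>\<^sub>M borel)"
    and g_meas: "\<And>j. (\<lambda>(y, s). g j y s) \<in> borel_measurable (borel \<Otimes>\<^sub>M borel)"
    and L_meas: "\<And>j. L j \<in> borel_measurable borel"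
    and F_int: "\<And>j y. y \<in> X \<Longrightarrow> integrable (D j) (F j y)"
    and L_int: "\<And>j. integrable (D j) (\<lambda>s. (L j s)\<^sup>2)"
    and L_nonneg: "\<And>j s. 0 \<le> L j s"
    and F_lip: "\<And>j s u v. u \<in> X \<Longrightarrow> v \<in> X \<Longrightarrow> \<bar>F j u s - F j v s\<bar>
        \<le> L j s * norm (u - v)"
    and g_bound: "\<And>j s y. y \<in> X \<Longrightarrow> norm (g j y s) \<le> L j s"
    and g_tangent: "\<And>j s u v. u \<in> X \<Longrightarrow> v \<in> X \<Longrightarrow> F j u s + inner (g j u s) (v - u)
        \<le> F j v s"
    and alpha_pos: "\<And>n. 0 < \<alpha> n" and rho_nonneg: "\<And>n. 0 \<le> \<rho> n"
    and z_step: "\<And>j n \<omega>. z j (Suc n) \<omega> =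
        (\<Sum>i\<in>UNIV. (A n \<omega> $ j $ i) *\<^sub>R z i n \<omega>)
            - \<alpha> n *\<^sub>R g j (Q (z j n \<omega>)) (\<xi> j n \<omega>)"
begin

definition "zbar n \<omega> = mean (\<lambda>j. z j n \<omega>)"
definition "dev n \<omega> = deviation (\<lambda>j. z j n \<omega>)"
definition "obj j y = (LINT s|D j. F j y s)"
definition "objective y = (\<Sum>j\<in>UNIV. obj j y)"
definition "EL j = (LINT s|D j. L j s)"
definition "EL2 j = (LINT s|D j. (L j s)\<^sup>2)"

section \<open>Adaptedness, moments of the samples and Lipschitz bounds for the objective\<close>

lemma space_G: "space (G n) = space M" and sets_G: "sets (G n) \<subseteq> sets M"
  using sub by (auto simp: subalgebra_def)

lemma G_le: "i \<le> n \<Longrightarrow> subalgebra (G n) (G i)"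
  using lift_Suc_mono_le[of "\<lambda>n. sets (G n)", OF G_mono] by (simp add: subalgebra_def space_G)

lemma G_lift: "i \<le> n \<Longrightarrow> f \<in> G i \<rightarrow>\<^sub>M N
    \<Longrightarrow> f \<in> G n \<rightarrow>\<^sub>M N"
  by (rule measurable_from_subalg[OF G_le])

lemma M_lift: "f \<in> G n \<rightarrow>\<^sub>M N \<Longrightarrow> f \<in> M \<rightarrow>\<^sub>M N"
  by (rule measurable_from_subalg[OF sub])

lemma Q_meas[measurable]: "Q \<in> borel_measurable borel"
  by (rule borel_measurable_continuous_onI[OF continuous_Q])

lemma mat_entry_meas[measurable]: "(\<lambda>B::real^'m^'m. B $ i $ j) \<in> borel_measurable borel"
  by (intro borel_measurable_continuous_onI continuous_intros)

lemma z_meas: "z j n \<in> borel_measurable (G n)"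
proof (induction n arbitrary: j)
  case (Suc n)
  have [measurable]: "z i n \<in> borel_measurable (G (Suc n))" for i
    by (rule G_lift[OF _ Suc.IH]) simp
  note A_meas[measurable] xi_meas[measurable]
  have [measurable]: "(\<lambda>\<omega>. g j (Q (z j n \<omega>)) (\<xi> j n \<omega>)) \<in> borel_measurable (G (Suc n))"
    using measurable_compose[OF _ g_meas[of j], of "\<lambda>\<omega>. (Q (z j n \<omega>), \<xi> j n \<omega>)" "G (Suc n)"]
        by simp
  have [measurable]: "(\<lambda>\<omega>. A n \<omega> $ j $ i) \<in> borel_measurable (G (Suc n))" for i
    using measurable_compose[OF A_meas mat_entry_meas] .
  have "z j (Suc n) = (\<lambda>\<omega>. (\<Sum>i\<in>UNIV. (A n \<omega> $ j $ i) *\<^sub>R z i n \<omega>)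
      - \<alpha> n *\<^sub>R g j (Q (z j n \<omega>)) (\<xi> j n \<omega>))"
    by (simp add: z_step fun_eq_iff)
  thus ?case by simp
qed (rule z0_meas)

lemma zbar_meas: "zbar n \<in> borel_measurable (G n)"
proof -
  note z_meas[measurable]
  show ?thesis unfolding zbar_def[abs_def] mean_def by measurable
qed

lemma dev_meas: "dev n \<in> borel_measurable (G n)"
proof -
  note z_meas[measurable] zbar_meas[measurable]
  have "dev n = (\<lambda>\<omega>. \<Sum>j\<in>UNIV. (norm (z j n \<omega> - zbar n \<omega>))\<^sup>2)"
    by (simp add: dev_def deviation_def zbar_def fun_eq_iff)
  thus ?thesis by simp
qed

lemma [measurable]: "z j n \<in> borel_measurable M" "zbar n \<in> borel_measurable M" "dev n \<in> borel_measurable M"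
    "A n \<in> borel_measurable M" "\<xi> j n \<in> M \<rightarrow>\<^sub>M borel"
  using M_lift z_meas zbar_meas dev_meas A_meas xi_meas by blast+

lemma dev_nonneg: "0 \<le> dev n \<omega>"
  unfolding dev_def deviation_def by (simp add: sum_nonneg)

lemma prob_D: "prob_space (D j)"
  using prob_space_distr[of "\<xi> j 0" borel] by (simp add: xi_distr)

lemma sets_D[measurable_cong]: "sets (D j) = sets borel"
  using xi_distr[of j 0] by (metis sets_distr)

lemma L_int1: "integrable (D j) (L j)"
proof -
  interpret P: prob_space "D j" by (rule prob_D)
  show ?thesis
    by (rule P.square_integrable_imp_integrable)
        (use L_meas L_int in \<open>auto simp: measurable_cong_sets[OF sets_D refl]\<close>)
qed

lemma xi_integral:
  fixes h :: "'s \<Rightarrow> real"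
  assumes "h \<in> borel_measurable borel"
  shows "integrable M (\<lambda>\<omega>. h (\<xi> j n \<omega>)) \<longleftrightarrow> integrable (D j) h"
    and "(LINT \<omega>|M. h (\<xi> j n \<omega>)) = (LINT s|D j. h s)"
  unfolding xi_distr[of j n, symmetric]
  using assms by (auto simp: integrable_distr_eq integral_distr)

lemma L_xi:
  "integrable M (\<lambda>\<omega>. L j (\<xi> j n \<omega>))" "(LINT \<omega>|M. L j (\<xi> j n \<omega>)) = EL j"
  "integrable M (\<lambda>\<omega>. (L j (\<xi> j n \<omega>))\<^sup>2)" "(LINT \<omega>|M. (L j (\<xi> j n
      \<omega>))\<^sup>2) = EL2 j"
  using xi_integral[OF L_meas] xi_integral[of "\<lambda>s. (L j s)\<^sup>2" j] L_meas L_int1 L_int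
  by (auto simp: EL_def EL2_def)

lemma EL_nonneg: "0 \<le> EL j" "0 \<le> EL2 j"
  unfolding EL_def EL2_def by (simp_all add: L_nonneg)

lemma A_le_1: "A n \<omega> $ i $ j \<le> 1"
  using member_le_sum[of j UNIV "\<lambda>j. A n \<omega> $ i $ j"] A_nonneg A_row[of n \<omega> i] by auto

lemma obj_lip:
  assumes "u \<in> X" "v \<in> X"
  shows "\<bar>obj j u - obj j v\<bar> \<le> EL j * norm (u - v)"
proof -
  have "obj j u - obj j v = (LINT s|D j. F j u s - F j v s)"
    unfolding obj_def by (rule Bochner_Integration.integral_diff[symmetric]) (auto intro: F_int assms)
  also have "\<bar>\<dots>\<bar> \<le> (LINT s|D j. \<bar>F j u s - F j v s\<bar>)" by (rule integral_abs_bound)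
  also have "\<dots> \<le> (LINT s|D j. L j s * norm (u - v))"
    by (rule integral_mono) (auto intro!: F_lip assms F_int L_int1)
  finally show ?thesis by (simp add: EL_def)
qed

lemma objective_lip:
  assumes "u \<in> X" "v \<in> X"
  shows "\<bar>objective u - objective v\<bar> \<le> (\<Sum>j\<in>UNIV. EL j) * norm (u - v)"
proof -
  have "\<bar>objective u - objective v\<bar> \<le> (\<Sum>j\<in>UNIV. \<bar>obj j u - obj j v\<bar>)"
    unfolding objective_def sum_subtractf[symmetric] by (rule sum_abs)
  also have "\<dots> \<le> (\<Sum>j\<in>UNIV. EL j * norm (u - v))" by (intro sum_mono obj_lip assms)
  finally show ?thesis by (simp add: sum_distrib_right)
qed

lemma objective_continuous: "continuous_on X objective"
proof (rule lipschitz_on_continuous_on)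
  show "(\<Sum>j\<in>UNIV. EL j)-lipschitz_on X objective"
    using objective_lip by (auto simp: lipschitz_on_def dist_norm dist_real_def sum_nonneg EL_nonneg)
qed

lemma obj_meas[measurable]: "obj j \<in> borel_measurable borel"
proof -
  interpret P: prob_space "D j" by (rule prob_D)
  show ?thesis unfolding obj_def[abs_def]
    by (rule P.borel_measurable_lebesgue_integral) (use F_meas[of j] in measurable)
qed

lemma objective_meas[measurable]: "objective \<in> borel_measurable borel"
  unfolding objective_def[abs_def] by measurable

text \<open>The initial values need not be integrable, so all moments are taken on an event \<open>start N\<close>,
  which belongs to every \<open>G n\<close>.\<close>

definition "energy n \<omega> = (\<Sum>j\<in>UNIV. (norm (z j n \<omega>))\<^sup>2)"
definition "start N = {\<omega> \<in> space M. \<forall>j. norm (z j 0 \<omega>) \<le> N}"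
definition "u j n \<omega> = z j n \<omega> - zbar n \<omega>"

lemma u_meas: "u j n \<in> borel_measurable (G n)"
  unfolding u_def[abs_def] using z_meas zbar_meas by measurable

lemma energy_meas: "energy n \<in> borel_measurable (G n)"
proof -
  note z_meas[measurable]
  show ?thesis unfolding energy_def[abs_def] by measurable
qed

lemma [measurable]: "u j n \<in> borel_measurable M" "energy n \<in> borel_measurable M"
  by (rule M_lift[OF u_meas], rule M_lift[OF energy_meas])

lemma start_sets: "start N \<in> sets (G n)"
proof -
  have [measurable]: "z j 0 \<in> borel_measurable (G n)" for j by (rule G_lift[OF _ z_meas]) simp
  have "start N = {\<omega> \<in> space (G n). \<forall>j. norm (z j 0 \<omega>) \<le> N}" unfolding start_def space_G ..
  also have "\<dots> \<in> sets (G n)" by measurable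
  finally show ?thesis .
qed

lemma start_sets_M[measurable]: "start N \<in> sets M"
  using start_sets[of N 0] sets_G by auto

lemma dev_eq: "dev n \<omega> = (\<Sum>j\<in>UNIV. (norm (u j n \<omega>))\<^sup>2)"
  by (simp add: dev_def deviation_def u_def zbar_def)

lemma norm_u_le: "(norm (u j n \<omega>))\<^sup>2 \<le> dev n \<omega>"
  unfolding dev_eq by (rule member_le_sum) auto

lemma sum_u: "(\<Sum>j\<in>UNIV. u j n \<omega>) = 0"
  unfolding u_def zbar_def by (rule sum_deviation)

lemma dev_le_energy: "dev n \<omega> \<le> energy n \<omega>"
  unfolding dev_def energy_def by (rule deviation_le)

lemma energy_nonneg: "0 \<le> energy n \<omega>"
  unfolding energy_def by (simp add: sum_nonneg)

lemma zbar_le_energy: "(norm (zbar n \<omega>))\<^sup>2 \<le> energy n \<omega>"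
  unfolding zbar_def energy_def by (rule norm_mean_le)

section \<open>Second moments on the event of bounded initial values\<close>

lemma norm_mix_le:
  fixes v :: "'m \<Rightarrow> 'v"
  shows "norm (\<Sum>i\<in>UNIV. A n \<omega> $ j $ i *\<^sub>R v i) \<le> (\<Sum>i\<in>UNIV. norm (v i))"
proof -
  have "norm (A n \<omega> $ j $ i *\<^sub>R v i) \<le> norm (v i)" for i
    using mult_right_mono[OF A_le_1[of n \<omega> j i], of "norm (v i)"] A_nonneg[of n \<omega> j i] by simp
  thus ?thesis by (intro order_trans[OF norm_sum] sum_mono) auto
qed

lemma norm_g_le: "(norm (g j (Q (z j n \<omega>)) s))\<^sup>2 \<le> (L j s)\<^sup>2"
  by (intro power_mono g_bound Q_maximizer(1)) auto

text \<open>Deliberately crude: the growth factor may exceed one, since the bound only propagates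
  integrability from one step to the next. Decay is obtained separately for the deviation.\<close>

lemma energy_step:
  "energy (Suc n) \<omega> \<le> 2 * real CARD('m) * real CARD('m) * energy n \<omega>
      + 2 * (\<alpha> n)\<^sup>2 * (\<Sum>j\<in>UNIV. (L j (\<xi> j n \<omega>))\<^sup>2)"
proof -
  have "(norm (z j (Suc n) \<omega>))\<^sup>2 \<le> 2 * (real CARD('m) * energy n \<omega>)
      + 2 * (\<alpha> n)\<^sup>2 * (L j (\<xi> j n \<omega>))\<^sup>2" for j
  proof -
    let ?a = "\<Sum>i\<in>UNIV. A n \<omega> $ j $ i *\<^sub>R z i n \<omega>" and ?b
        = "\<alpha> n *\<^sub>R g j (Q (z j n \<omega>)) (\<xi> j n \<omega>)"
    have "(norm ?a)\<^sup>2 \<le> (\<Sum>i\<in>UNIV. norm (z i n \<omega>))\<^sup>2" by (intro power_mono norm_mix_le) simp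
    also have "\<dots> \<le> energy n \<omega> * real CARD('m)"
      unfolding energy_def by (rule sum_squared_le_sum_of_squares)
    finally have a: "(norm ?a)\<^sup>2 \<le> real CARD('m) * energy n \<omega>" by (simp add: mult.commute)
    have b: "(norm ?b)\<^sup>2 \<le> (\<alpha> n)\<^sup>2 * (L j (\<xi> j n \<omega>))\<^sup>2"
      unfolding norm_scaleR power_mult_distrib power2_abs by (intro mult_left_mono norm_g_le) auto
    show ?thesis unfolding z_step using norm_diff_squared_le[of ?a ?b] a b by argo
  qed
  hence "energy (Suc n) \<omega> \<le> (\<Sum>j\<in>UNIV. 2 * (real CARD('m) * energy n \<omega>)
      + 2 * (\<alpha> n)\<^sup>2 * (L j (\<xi> j n \<omega>))\<^sup>2)"
    unfolding energy_def[of "Suc n"] by (rule sum_mono)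
  thus ?thesis by (simp add: sum.distrib sum_distrib_left algebra_simps)
qed

lemma integrable_indicator_mult:
  fixes h :: "'a \<Rightarrow> real"
  assumes "B \<in> sets M" "integrable M h"
  shows "integrable M (\<lambda>\<omega>. indicator B \<omega> * h \<omega>)"
  using integrable_mult_indicator[OF assms] by simp

lemma energy_integrable: "integrable M (\<lambda>\<omega>. indicator (start N) \<omega> * energy n \<omega>)"
proof (induction n)
  case 0
  show ?case
  proof (rule integrable_const_bound[of _ "real CARD('m) * N\<^sup>2"])
    show "AE \<omega> in M. norm (indicator (start N) \<omega> * energy 0 \<omega>) \<le> real CARD('m) * N\<^sup>2"
    proof (rule AE_I2)
      fix \<omega>
      have "energy 0 \<omega> \<le> real CARD('m) * N\<^sup>2" if "\<omega> \<in> start N"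
        unfolding energy_def
        by (rule sum_bounded_above) (use that in \<open>auto simp: start_def intro!: power_mono\<close>)
      thus "norm (indicator (start N) \<omega> * energy 0 \<omega>) \<le> real CARD('m) * N\<^sup>2"
        by (auto simp: indicator_def energy_nonneg)
    qed
  qed simp
next
  case (Suc n)
  have "integrable M (\<lambda>\<omega>. 2 * real CARD('m) * real CARD('m) * (indicator (start N) \<omega> * energy n
      \<omega>) + 2 * (\<alpha> n)\<^sup>2 * (\<Sum>j\<in>UNIV. (L j (\<xi> j n \<omega>))\<^sup>2))"
    using Suc L_xi by auto
  thus ?case
  proof (rule Bochner_Integration.integrable_bound)
    show "AE \<omega> in M. norm (indicator (start N) \<omega> * energy (Suc n) \<omega>) \<le>
        norm (2 * real CARD('m) * real CARD('m) * (indicator (start N) \<omega> * energy n \<omega>)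
            + 2 * (\<alpha> n)\<^sup>2 * (\<Sum>j\<in>UNIV. (L j (\<xi> j n \<omega>))\<^sup>2))"
      using energy_step[of n] energy_nonneg[of n] energy_nonneg[of "Suc n"]
      by (intro AE_I2) (auto simp: indicator_def sum_nonneg intro: order_trans[OF _ abs_ge_self])
  qed simp
qed

text \<open>The common source of integrability below: a quantity bounded by an affine function of
  the energy is integrable on every event inside \<open>start N\<close>.\<close>

lemma energy_dominated:
  assumes "h \<in> borel_measurable M" "B \<in> sets M" "B \<subseteq> start N"
    and "\<And>\<omega>. \<bar>h \<omega>\<bar> \<le> c1 + c2 * energy n \<omega>"
  shows "integrable M (\<lambda>\<omega>. indicator B \<omega> * h \<omega>)"
proof (rule Bochner_Integration.integrable_bound)
  show "integrable M (\<lambda>\<omega>. c1 + c2 * (indicator (start N) \<omega> * energy n \<omega>))"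
    using energy_integrable by auto
  show "AE \<omega> in M. norm (indicator B \<omega> * h \<omega>) \<le> norm (c1
      + c2 * (indicator (start N) \<omega> * energy n \<omega>))"
  proof (rule AE_I2)
    fix \<omega>
    show "norm (indicator B \<omega> * h \<omega>) \<le> norm (c1 + c2 * (indicator (start N) \<omega> * energy n \<omega>))"
      using assms(3) assms(4)[of \<omega>] by (cases "\<omega> \<in> B") auto
  qed
qed (use assms in measurable)

lemma G_sets_M: "B \<in> sets (G n) \<Longrightarrow> B \<in> sets M"
  using sets_G by auto

lemma dev_integrable:
  assumes "B \<in> sets M" "B \<subseteq> start N"
  shows "integrable M (\<lambda>\<omega>. indicator B \<omega> * dev n \<omega>)"
  by (rule energy_dominated[OF _ assms, of _ 0 1 n]) (auto simp: dev_nonneg dev_le_energy)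

lemma inner_u_integrable:
  assumes "B \<in> sets M" "B \<subseteq> start N"
  shows "integrable M (\<lambda>\<omega>. indicator B \<omega> * inner (u i n \<omega>) (u l n \<omega>))"
proof (rule energy_dominated[OF _ assms, of _ 0 2 n])
  fix \<omega>
  show "\<bar>inner (u i n \<omega>) (u l n \<omega>)\<bar> \<le> 0 + 2 * energy n \<omega>"
    using inner_le_squares[of "u i n \<omega>" "u l n \<omega>"] norm_u_le[of i n \<omega>] norm_u_le[of l n \<omega>]
        dev_le_energy[of n \<omega>]
    by linarith
qed simp

section \<open>Contraction of the expected deviation\<close>

abbreviation contraction :: "real^'m^'m \<Rightarrow> 'm \<Rightarrow> 'm \<Rightarrow> real" where
  "contraction B i l \<equiv> (transpose B ** (centering_matrix :: real^'m^'m) ** B) $ i $ l"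

lemma contraction_eq:
  "contraction B i l = (\<Sum>k\<in>UNIV. (\<Sum>j\<in>UNIV. B $ j $ i * (centering_matrix :: real^'m^'m) $ j $ k) * B $ k $ l)"
  by (simp add: matrix_matrix_mult_def transpose_def)

lemma contraction_meas[measurable]: "(\<lambda>B. contraction B i l) \<in> borel_measurable borel"
  unfolding contraction_eq
  by (intro borel_measurable_sum borel_measurable_times borel_measurable_const mat_entry_meas)

lemma contraction_integrable: "integrable M (\<lambda>\<omega>. contraction (A n \<omega>) i l)"
  by (rule integrable_const_bound[OF AE_I2])
    (auto intro: abs_contraction_entry_le simp: A_nonneg A_le_1)

text \<open>As the rows sum to one, mixing the values differs from mixing the deviations by a common
  shift, which does not change the deviation. Young's inequality then puts the matrix and the
  samples into different summands.\<close>

lemma dev_step: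
  assumes "\<eta> > 0"
  shows "dev (Suc n) \<omega> \<le> (1
      + \<eta>) * (\<Sum>i\<in>UNIV. \<Sum>l\<in>UNIV. contraction (A n \<omega>) i l * inner (u i n \<omega>) (u l n \<omega>))
    + (1 + 1 / \<eta>) * ((\<alpha> n)\<^sup>2 * (\<Sum>j\<in>UNIV. (L j (\<xi> j n \<omega>))\<^sup>2))"
proof -
  let ?a = "\<lambda>j. \<Sum>i\<in>UNIV. A n \<omega> $ j $ i *\<^sub>R z i n \<omega>" and ?g
      = "\<lambda>j. g j (Q (z j n \<omega>)) (\<xi> j n \<omega>)"
  have "?a = (\<lambda>j. (\<Sum>i\<in>UNIV. A n \<omega> $ j $ i *\<^sub>R u i n \<omega>) + zbar n \<omega>)"
    by (simp add: u_def scaleR_diff_right sum_subtractf scaleR_sum_left[symmetric] A_row)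
  hence a: "deviation ?a
      = (\<Sum>i\<in>UNIV. \<Sum>l\<in>UNIV. contraction (A n \<omega>) i l * inner (u i n \<omega>) (u l n \<omega>))"
    by (simp only: deviation_shift deviation_mixing)
  have "deviation ?g \<le> (\<Sum>j\<in>UNIV. (L j (\<xi> j n \<omega>))\<^sup>2)"
    by (rule order_trans[OF deviation_le]) (intro sum_mono norm_g_le)
  hence b: "(\<alpha> n)\<^sup>2 * deviation ?g
      \<le> (\<alpha> n)\<^sup>2 * (\<Sum>j\<in>UNIV. (L j (\<xi> j n \<omega>))\<^sup>2)"
    by (intro mult_left_mono) auto
  have "dev (Suc n) \<omega> \<le> (1 + \<eta>) * deviation ?a + (1 + 1 / \<eta>) * ((\<alpha> n)\<^sup>2 * deviation ?g)"
    unfolding dev_def z_step deviation_scaleR[symmetric] by (rule deviation_diff_le[OF assms])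
  also have "\<dots> \<le> (1 + \<eta>) * deviation ?a + (1
      + 1 / \<eta>) * ((\<alpha> n)\<^sup>2 * (\<Sum>j\<in>UNIV. (L j (\<xi> j n \<omega>))\<^sup>2))"
    using assms by (intro add_left_mono mult_left_mono[OF b]) auto
  finally show ?thesis unfolding a .
qed

lemma expected_dev_step:
  assumes \<eta>: "\<eta> > 0"
  shows "(LINT \<omega>|M. indicator (start N) \<omega> * dev (Suc n) \<omega>) \<le>
    (1 + \<eta>) * \<rho> n * (LINT \<omega>|M. indicator (start N) \<omega> * dev n \<omega>)
    + (1 + 1 / \<eta>) * (\<alpha> n)\<^sup>2 * (\<Sum>j\<in>UNIV. EL2 j)"
proof -
  let ?I = "indicator (start N) :: 'a \<Rightarrow> real"
  \<comment> \<open>Each summand is an entry depending on the fresh matrix times a past factor, so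
    independence replaces the entry by its expectation \<open>P i l\<close>.\<close>
  define T where "T i l \<omega>
      = contraction (A n \<omega>) i l * (?I \<omega> * inner (u i n \<omega>) (u l n \<omega>))" for i l \<omega>
  define P where "P i l = (LINT \<omega>|M. contraction (A n \<omega>) i l)" for i l
  have YG: "(\<lambda>\<omega>. ?I \<omega> * inner (u i n \<omega>) (u l n \<omega>)) \<in> borel_measurable (G n)" for i l
  proof -
    note u_meas[measurable] start_sets[measurable]
    show ?thesis by measurable
  qed
  have T: "integrable M (T i l)" "(LINT \<omega>|M. T i l \<omega>)
      = P i l * (LINT \<omega>|M. ?I \<omega> * inner (u i n \<omega>) (u l n \<omega>))" for i l
    unfolding T_def P_def
    using expectation_fresh_mult[OF sub A_fresh YG contraction_meas contraction_integrable inner_u_integrable[OF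
        start_sets_M order_refl]]
    by auto
  have S: "(\<Sum>i\<in>UNIV. \<Sum>l\<in>UNIV. LINT \<omega>|M. T i l \<omega>)
      \<le> \<rho> n * (LINT \<omega>|M. ?I \<omega> * dev n \<omega>)"
  proof -
    have int: "integrable M (\<lambda>\<omega>. P i l * (?I \<omega> * inner (u i n \<omega>) (u l n \<omega>)))" for i l
      using inner_u_integrable[OF start_sets_M order_refl] by simp
    have "(\<Sum>i\<in>UNIV. \<Sum>l\<in>UNIV. LINT \<omega>|M. T i l \<omega>)
        = (LINT \<omega>|M. (\<Sum>i\<in>UNIV. \<Sum>l\<in>UNIV. P i l * (?I \<omega> * inner (u i n \<omega>) (u l n
            \<omega>))))"
      unfolding T(2) using int by simp
    also have "\<dots> \<le> (LINT \<omega>|M. \<rho> n * (?I \<omega> * dev n \<omega>))"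
    proof (rule integral_mono)
      show "integrable M (\<lambda>\<omega>. \<Sum>i\<in>UNIV. \<Sum>l\<in>UNIV. P i l * (?I \<omega> * inner (u i n
          \<omega>) (u l n \<omega>)))"
        using int by auto
      show "integrable M (\<lambda>\<omega>. \<rho> n * (?I \<omega> * dev n \<omega>))"
        using dev_integrable[OF start_sets_M order_refl] by simp
      fix \<omega>
      \<comment> \<open>With the expected matrix in place, the spectral bound can be used for each
        outcome separately.\<close>
      have "(\<Sum>i\<in>UNIV. \<Sum>l\<in>UNIV. P i l * inner (u i n \<omega>) (u l n \<omega>)) \<le> \<rho> n * dev n \<omega>"
        unfolding dev_eq by (rule quadratic_form_inner_le) (unfold P_def, rule A_contr)
      thus "(\<Sum>i\<in>UNIV. \<Sum>l\<in>UNIV. P i l * (?I \<omega> * inner (u i n \<omega>) (u l n \<omega>)))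
          \<le> \<rho> n * (?I \<omega> * dev n \<omega>)"
        by (cases "\<omega> \<in> start N") auto
    qed
    finally show ?thesis by simp
  qed
  have Lint: "integrable M (\<lambda>\<omega>. \<Sum>j\<in>UNIV. (L j (\<xi> j n \<omega>))\<^sup>2)" using L_xi by auto
  have "(LINT \<omega>|M. ?I \<omega> * dev (Suc n) \<omega>) \<le>
      (LINT \<omega>|M. (1 + \<eta>) * (\<Sum>i\<in>UNIV. \<Sum>l\<in>UNIV. T i l \<omega>) + (1
          + 1 / \<eta>) * ((\<alpha> n)\<^sup>2 * (\<Sum>j\<in>UNIV. (L j (\<xi> j n \<omega>))\<^sup>2)))"
  proof (rule integral_mono)
    show "integrable M (\<lambda>\<omega>. ?I \<omega> * dev (Suc n) \<omega>)"
        by (rule dev_integrable[OF start_sets_M order_refl])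
    show "integrable M (\<lambda>\<omega>. (1 + \<eta>) * (\<Sum>i\<in>UNIV. \<Sum>l\<in>UNIV. T i l \<omega>) + (1
        + 1 / \<eta>) * ((\<alpha> n)\<^sup>2 * (\<Sum>j\<in>UNIV. (L j (\<xi> j n \<omega>))\<^sup>2)))"
      using T(1) Lint by auto
    fix \<omega>
    show "?I \<omega> * dev (Suc n) \<omega> \<le> (1 + \<eta>) * (\<Sum>i\<in>UNIV. \<Sum>l\<in>UNIV. T i l \<omega>) + (1
        + 1 / \<eta>) * ((\<alpha> n)\<^sup>2 * (\<Sum>j\<in>UNIV. (L j (\<xi> j n \<omega>))\<^sup>2))"
      using dev_step[OF \<eta>, of n \<omega>] \<eta>
      by (cases "\<omega> \<in> start N") (auto simp: T_def sum_nonneg)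
  qed
  also have "\<dots> = (1 + \<eta>) * (\<Sum>i\<in>UNIV. \<Sum>l\<in>UNIV. LINT \<omega>|M. T i l \<omega>) + (1
      + 1 / \<eta>) * ((\<alpha> n)\<^sup>2 * (\<Sum>j\<in>UNIV. EL2 j))"
    using T(1) Lint by (simp add: L_xi)
  also have "\<dots> \<le> (1 + \<eta>) * (\<rho> n * (LINT \<omega>|M. ?I \<omega> * dev n \<omega>)) + (1
      + 1 / \<eta>) * ((\<alpha> n)\<^sup>2 * (\<Sum>j\<in>UNIV. EL2 j))"
    using S \<eta> by (intro add_right_mono mult_left_mono) auto
  finally show ?thesis by (simp add: mult.assoc)
qed

lemma expected_dev_summable:
  assumes \<beta>: "\<beta> > 1 / 2" and c: "c > 0"
    and ev_c: "\<forall>\<^sub>F n in sequentially. 1 - \<rho> n \<ge> c * (real (Suc n) powr \<beta> * \<alpha> n)"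
    and gap: "filterlim (\<lambda>n. real (Suc n) * (1 - \<rho> n)) at_top sequentially"
  shows "summable (\<lambda>n. LINT \<omega>|M. indicator (start N) \<omega> * dev n \<omega>)"
proof -
  define v where "v n = (LINT \<omega>|M. indicator (start N) \<omega> * dev n \<omega>)" for n
  define E where "E = (\<Sum>j\<in>UNIV. EL2 j)"
  define \<delta> where "\<delta> n = (1 - \<rho> n) / 2" for n
  \<comment> \<open>The cap at 2 is what \<open>recursion_rate\<close> admits; the exponent still
    exceeds 1 because \<beta> exceeds 1/2.\<close>
  define \<gamma> where "\<gamma> = min (2 * \<beta>) 2"
  have v0: "0 \<le> v n" for n unfolding v_def by (simp add: dev_nonneg)
  have E0: "0 \<le> E" unfolding E_def by (simp add: sum_nonneg EL_nonneg)
  \<comment> \<open>The level 8 for the full gap gives the level 4 for \<delta>, which is half the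
    gap, as \<open>recursion_rate\<close> demands.\<close>
  have "\<forall>\<^sub>F n in sequentially. 8 \<le> real (Suc n) * (1 - \<rho> n)"
    using gap unfolding filterlim_at_top by blast
  with ev_c have "\<forall>\<^sub>F n in sequentially. 1
      - \<rho> n \<ge> c * (real (Suc n) powr \<beta> * \<alpha> n) \<and> 8 \<le> real (Suc n) * (1 - \<rho> n)"
    by eventually_elim auto
  then obtain K0 where K0: "\<And>n. n \<ge> K0 \<Longrightarrow> 1
      - \<rho> n \<ge> c * (real (Suc n) powr \<beta> * \<alpha> n) \<and> 8 \<le> real (Suc n) * (1 - \<rho> n)"
    by (auto simp: eventually_sequentially)
  define K where "K = max K0 1"
  have \<delta>: "0 < \<delta> n \<and> \<delta> n \<le> 1 \<and> 4 \<le> real (Suc n) * \<delta> n" if "n \<ge> K" for n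
  proof -
    have "8 \<le> real (Suc n) * (1 - \<rho> n)" using K0[of n] that by (simp add: K_def)
    moreover from this have "0 < real (Suc n) * (1 - \<rho> n)" by linarith
    hence "0 < 1 - \<rho> n" by (simp add: zero_less_mult_iff del: of_nat_Suc)
    ultimately show ?thesis using rho_nonneg[of n] by (simp add: \<delta>_def)
  qed
  have "\<exists>B. \<forall>n\<ge>K. v n \<le> B * real n powr -\<gamma>"
  \<comment> \<open>The constant 8 E / c^2 is the product of 2/\<delta>, a bound for 1 + 1/\<delta>,
    with 4 \<delta>^2/c^2, which bounds the squared step through the liminf condition; one factor
    \<delta> is left over, as the recursion requires.\<close>
  proof (rule recursion_rate[where \<delta> = \<delta> and C = "8 * E / c\<^sup>2"])
    fix n assume n: "n \<ge> K"
    let ?k = "real (Suc n)"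
    note d = \<delta>[OF n]
    have "c * (?k powr \<beta> * \<alpha> n) \<le> 2 * \<delta> n" using K0[of n] n by (simp add: K_def \<delta>_def)
    hence "\<alpha> n \<le> 2 * \<delta> n / c * ?k powr -\<beta>"
      using c by (simp add: powr_minus field_simps)
    hence "(\<alpha> n)\<^sup>2 \<le> (2 * \<delta> n / c * ?k powr -\<beta>)\<^sup>2"
      using alpha_pos[of n] by (intro power_mono) auto
    also have "\<dots> = 4 * (\<delta> n)\<^sup>2 / c\<^sup>2 * (?k powr -\<beta>)\<^sup>2"
      by (simp add: power_mult_distrib power_divide)
    also have "(?k powr -\<beta>)\<^sup>2 = ?k powr (- (2 * \<beta>))"
      by (simp add: power2_eq_square powr_add[symmetric])
    also have "4 * (\<delta> n)\<^sup>2 / c\<^sup>2 * \<dots> \<le> 4 * (\<delta> n)\<^sup>2 / c\<^sup>2 * ?k powr -\<gamma>"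
      by (intro mult_left_mono powr_mono) (auto simp: \<gamma>_def)
    finally have a2: "(\<alpha> n)\<^sup>2 \<le> 4 * (\<delta> n)\<^sup>2 / c\<^sup>2 * ?k powr -\<gamma>" .
    have "v (Suc n) \<le> (1 + \<delta> n) * \<rho> n * v n + (1 + 1 / \<delta> n) * (\<alpha> n)\<^sup>2 * E"
      unfolding v_def E_def by (rule expected_dev_step) (use d in auto)
    also have "\<dots> \<le> (1 - \<delta> n) * v n
        + 2 / \<delta> n * (4 * (\<delta> n)\<^sup>2 / c\<^sup>2 * ?k powr -\<gamma>) * E"
    proof (intro add_mono mult_right_mono mult_mono a2)
      \<comment> \<open>Half of the gap is spent on Young's inequality: (1 + \<delta>)(1 - 2
        \<delta>) still leaves 1 - \<delta>.\<close>
      have "\<rho> n = 1 - 2 * \<delta> n" by (simp add: \<delta>_def field_simps)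
      hence "(1 + \<delta> n) * \<rho> n = (1 + \<delta> n) * (1 - 2 * \<delta> n)" by simp
      also have "\<dots> \<le> 1 - \<delta> n" by (simp add: algebra_simps)
      finally show "(1 + \<delta> n) * \<rho> n \<le> 1 - \<delta> n" .
      show "1 + 1 / \<delta> n \<le> 2 / \<delta> n" using d by (simp add: field_simps)
    qed (use d v0 E0 in auto)
    also have "2 / \<delta> n * (4 * (\<delta> n)\<^sup>2 / c\<^sup>2 * ?k powr -\<gamma>) * E
        = 8 * E / c\<^sup>2 * \<delta> n * ?k powr -\<gamma>"
      using d by (simp add: power2_eq_square field_simps)
    finally show "v (Suc n) \<le> (1 - \<delta> n) * v n + 8 * E / c\<^sup>2 * \<delta> n * ?k powr -\<gamma>" .
  qed (use \<delta> \<beta> E0 c in \<open>auto simp: \<gamma>_def K_def\<close>)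
  then obtain B where B: "\<And>n. n \<ge> K \<Longrightarrow> v n \<le> B * real n powr -\<gamma>" by blast
  have "summable (\<lambda>n. B * real n powr -\<gamma>)"
    using \<beta> by (intro summable_mult) (auto simp: summable_real_powr_iff \<gamma>_def)
  hence "summable v"
    by (rule summable_comparison_test[rotated]) (use B v0 in auto)
  thus ?thesis unfolding v_def .
qed

section \<open>Descent of the Fenchel coupling in one step\<close>

definition "drift = 2 / \<sigma> * (\<Sum>j\<in>UNIV. EL j) + 1 / \<sigma> * (real CARD('m) * real CARD('m)
    + (\<Sum>j\<in>UNIV. EL2 j))"
definition "xbar n \<omega> = Q (zbar n \<omega>)"
text \<open>The coefficient with which agent i enters the average after mixing. It equals 1/m only
  in expectation.\<close>

definition weight :: "'m \<Rightarrow> real^'m^'m \<Rightarrow> real" where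
  "weight i B = (1 / real CARD('m)) * (\<Sum>j\<in>UNIV. B $ j $ i)"

lemma xbar_X: "xbar n \<omega> \<in> X"
  unfolding xbar_def by (rule Q_maximizer)

lemma drift_nonneg: "0 \<le> drift"
  unfolding drift_def using sigma_pos by (simp add: sum_nonneg EL_nonneg)

lemma weight_meas[measurable]: "weight i \<in> borel_measurable borel"
  unfolding weight_def[abs_def]
  by (intro borel_measurable_sum borel_measurable_times borel_measurable_const mat_entry_meas)

lemma A_entry_integrable: "integrable M (\<lambda>\<omega>. A n \<omega> $ i $ j)"
  by (rule integrable_const_bound[of _ 1])
    (auto simp: A_le_1 A_nonneg abs_of_nonneg intro: measurable_compose[OF _ mat_entry_meas])

lemma weight_A: "integrable M (\<lambda>\<omega>. weight i (A n \<omega>))" "(LINT \<omega>|M. weight i (A n \<omega>))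
    = 1 / real CARD('m)"
  unfolding weight_def using A_entry_integrable A_col[of n i] by simp_all

text \<open>Stochastic rows keep a common value fixed, so mixing moves the average only through the
  deviations \<open>u\<close>. This extra term is the price for columns that are not stochastic
  outcome by outcome.\<close>

lemma zbar_step:
  "zbar (Suc n) \<omega> = zbar n \<omega> + mean (\<lambda>j. \<Sum>i\<in>UNIV. A n \<omega> $ j $ i *\<^sub>R u i n \<omega>)
    - \<alpha> n *\<^sub>R mean (\<lambda>j. g j (Q (z j n \<omega>)) (\<xi> j n \<omega>))"
proof -
  have "(\<Sum>i\<in>UNIV. A n \<omega> $ j $ i *\<^sub>R z i n \<omega>)
      = (\<Sum>i\<in>UNIV. A n \<omega> $ j $ i *\<^sub>R u i n \<omega>) + zbar n \<omega>" for j
    by (simp add: u_def scaleR_diff_right sum_subtractf scaleR_sum_left[symmetric] A_row)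
  thus ?thesis
    unfolding zbar_def[of "Suc n"] z_step mean_diff mean_scaleR by (simp add: mean_add mean_const add.commute)
qed

lemma mean_mix: "mean (\<lambda>j. \<Sum>i\<in>UNIV. A n \<omega> $ j $ i *\<^sub>R u i n \<omega>)
    = (\<Sum>i\<in>UNIV. weight i (A n \<omega>) *\<^sub>R u i n \<omega>)"
proof -
  have "(\<Sum>j\<in>UNIV. \<Sum>i\<in>UNIV. A n \<omega> $ j $ i *\<^sub>R u i n \<omega>)
      = (\<Sum>i\<in>UNIV. (\<Sum>j\<in>UNIV. A n \<omega> $ j $ i) *\<^sub>R u i n \<omega>)"
    unfolding scaleR_sum_left by (rule sum.swap)
  thus ?thesis unfolding mean_def weight_def by (simp add: scaleR_sum_right)
qed

lemma Q_z_xbar: "norm (Q (z j n \<omega>) - xbar n \<omega>) \<le> norm (u j n \<omega>) / \<sigma>"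
  unfolding xbar_def u_def by (rule Q_lipschitz)

text \<open>The gradient is taken at the agent's own point, but the objective gap is wanted at
  \<open>xbar\<close>. After the tangent inequality at the agent's point, moving the function value
  and moving the inner product each cost L times the distance of the two points; hence the factor
  2.\<close>

lemma gradient_gain:
  assumes p: "p \<in> X"
  shows "F j (xbar n \<omega>) s - F j p s - 2 * L j s * (norm (u j n \<omega>) / \<sigma>)
    \<le> inner (g j (Q (z j n \<omega>)) s) (xbar n \<omega> - p)"
proof -
  let ?x = "Q (z j n \<omega>)" and ?y = "xbar n \<omega>"
  let ?g = "g j ?x s"
  have x: "?x \<in> X" by (rule Q_maximizer)
  have d: "L j s * norm (?x - ?y) \<le> L j s * (norm (u j n \<omega>) / \<sigma>)"
    by (intro mult_left_mono Q_z_xbar L_nonneg)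
  have "F j ?x s + inner ?g (p - ?x) \<le> F j p s" by (rule g_tangent[OF x p])
  moreover have "inner ?g (p - ?x) = inner ?g (?y - ?x) - inner ?g (?y - p)" by (simp add: inner_diff_right)
  moreover have "\<bar>F j ?x s - F j ?y s\<bar> \<le> L j s * norm (?x - ?y)" by (rule F_lip[OF x xbar_X])
  moreover have "- inner ?g (?y - ?x) \<le> norm ?g * norm (?x - ?y)"
    using norm_cauchy_schwarz[of ?g "?x - ?y"] by (simp add: inner_diff_right)
  moreover have "norm ?g * norm (?x - ?y) \<le> L j s * norm (?x - ?y)"
    by (intro mult_right_mono g_bound x) auto
  ultimately show ?thesis using d by linarith
qed

text \<open>The smoothness estimate \<open>fenchel_coupling_step\<close> at consecutive averages.
  The linear mixing term is kept as it is, because only its expectation vanishes. Every other term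
  depends on the past and at most one sample.\<close>

lemma descent:
  assumes p: "p \<in> X"
  shows "R p (zbar (Suc n) \<omega>) \<le> R p (zbar n \<omega>)
    + (\<Sum>i\<in>UNIV. weight i (A n \<omega>) * inner (u i n \<omega>) (xbar n \<omega> - p))
    - \<alpha> n / real CARD('m) * (\<Sum>j\<in>UNIV. F j (xbar n \<omega>) (\<xi> j n \<omega>) - F j p (\<xi> j n \<omega>))
    + 2 / \<sigma> * (\<Sum>j\<in>UNIV. L j (\<xi> j n \<omega>) * ((\<alpha> n)\<^sup>2 + dev n \<omega>))
    + 1 / \<sigma> * (real CARD('m) * real CARD('m) * dev n \<omega>
        + (\<alpha> n)\<^sup>2 * (\<Sum>j\<in>UNIV. (L j (\<xi> j n \<omega>))\<^sup>2))"
proof -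
  let ?m = "real CARD('m)"
  let ?e = "mean (\<lambda>j. \<Sum>i\<in>UNIV. A n \<omega> $ j $ i *\<^sub>R u i n \<omega>)"
  let ?g = "\<lambda>j. g j (Q (z j n \<omega>)) (\<xi> j n \<omega>)"
  let ?y = "xbar n \<omega>"
  have m: "?m \<ge> 1" by (simp add: Suc_le_eq)
  have diff: "zbar (Suc n) \<omega> - zbar n \<omega> = ?e - \<alpha> n *\<^sub>R mean ?g" unfolding zbar_step by simp
  have e_in: "inner ?e (?y - p) = (\<Sum>i\<in>UNIV. weight i (A n \<omega>) * inner (u i n \<omega>) (?y - p))"
    unfolding mean_mix by (simp add: inner_sum_left)
  have step1: "\<alpha> n * (F j ?y (\<xi> j n \<omega>) - F j p (\<xi> j n \<omega>))
      - 2 / \<sigma> * (L j (\<xi> j n \<omega>) * ((\<alpha> n)\<^sup>2 + dev n \<omega>))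
      \<le> \<alpha> n * inner (?g j) (?y - p)" for j
  proof -
    let ?a = "norm (u j n \<omega>)" and ?L = "L j (\<xi> j n \<omega>)"
    \<comment> \<open>The product of step-size and deviation is split into squares, since the
      squared steps and the expected squared deviations are the quantities known to be
      summable.\<close>
    have "\<alpha> n * ?a \<le> (\<alpha> n)\<^sup>2 + ?a\<^sup>2"
    proof -
      have "0 \<le> \<alpha> n * ?a" using alpha_pos[of n] by simp
      thus ?thesis using sum_squares_bound[of "\<alpha> n" ?a] by linarith
    qed
    hence "\<alpha> n * ?a \<le> (\<alpha> n)\<^sup>2 + dev n \<omega>" using norm_u_le[of j n \<omega>] by linarith
    hence "2 / \<sigma> * (?L * (\<alpha> n * ?a)) \<le> 2 / \<sigma> * (?L * ((\<alpha> n)\<^sup>2 + dev n \<omega>))"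
      using sigma_pos by (intro mult_left_mono L_nonneg) auto
    moreover have "\<alpha> n * (F j ?y (\<xi> j n \<omega>) - F j p (\<xi> j n \<omega>) - 2 * ?L * (?a / \<sigma>))
        \<le> \<alpha> n * inner (?g j) (?y - p)"
      using gradient_gain[OF p, of j n \<omega> "\<xi> j n \<omega>"] alpha_pos[of n] by (intro mult_left_mono) auto
    moreover have "\<alpha> n * (F j ?y (\<xi> j n \<omega>) - F j p (\<xi> j n \<omega>) - 2 * ?L * (?a / \<sigma>))
        = \<alpha> n * (F j ?y (\<xi> j n \<omega>) - F j p (\<xi> j n \<omega>)) - 2 / \<sigma> * (?L * (\<alpha> n * ?a))"
      by (simp add: algebra_simps)
    ultimately show ?thesis by argo
  qed
  have g_in: "- (\<alpha> n * inner (mean ?g) (?y - p)) \<le>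
     - (\<alpha> n / ?m * (\<Sum>j\<in>UNIV. F j ?y (\<xi> j n \<omega>) - F j p (\<xi> j n \<omega>)))
     + 2 / \<sigma> * (\<Sum>j\<in>UNIV. L j (\<xi> j n \<omega>) * ((\<alpha> n)\<^sup>2 + dev n \<omega>))"
  proof -
    let ?S = "\<Sum>j\<in>UNIV. L j (\<xi> j n \<omega>) * ((\<alpha> n)\<^sup>2 + dev n \<omega>)"
    have "\<alpha> n * (\<Sum>j\<in>UNIV. F j ?y (\<xi> j n \<omega>) - F j p (\<xi> j n \<omega>)) - 2 / \<sigma> * ?S
      \<le> \<alpha> n * inner (\<Sum>j\<in>UNIV. ?g j) (?y - p)"
    proof -
      have "(\<Sum>j\<in>UNIV. \<alpha> n * (F j ?y (\<xi> j n \<omega>) - F j p (\<xi> j n \<omega>))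
          - 2 / \<sigma> * (L j (\<xi> j n \<omega>) * ((\<alpha> n)\<^sup>2 + dev n \<omega>)))
          \<le> (\<Sum>j\<in>UNIV. \<alpha> n * inner (?g j) (?y - p))"
        by (rule sum_mono) (rule step1)
      thus ?thesis by (simp only: sum_subtractf sum_distrib_left inner_sum_left right_diff_distrib)
    qed
    hence "1 / ?m * (\<alpha> n * (\<Sum>j\<in>UNIV. F j ?y (\<xi> j n \<omega>) - F j p (\<xi> j n \<omega>))
        - 2 / \<sigma> * ?S)
      \<le> 1 / ?m * (\<alpha> n * inner (\<Sum>j\<in>UNIV. ?g j) (?y - p))"
      by (intro mult_left_mono) auto
    moreover have "1 / ?m * (2 / \<sigma> * ?S) \<le> 1 * (2 / \<sigma> * ?S)"
      using m sigma_pos by (intro mult_right_mono mult_nonneg_nonneg sum_nonneg L_nonneg add_nonneg_nonneg dev_nonneg) auto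
    moreover have "1 / ?m * (\<alpha> n * inner (\<Sum>j\<in>UNIV. ?g j) (?y - p)) = \<alpha> n * inner (mean ?g) (?y - p)"
      unfolding mean_def by simp
    ultimately show ?thesis by (simp add: right_diff_distrib)
  qed
  have e2: "(norm ?e)\<^sup>2 \<le> ?m * ?m * dev n \<omega>"
  proof -
    have "(norm (\<Sum>i\<in>UNIV. A n \<omega> $ j $ i *\<^sub>R u i n \<omega>))\<^sup>2 \<le> ?m * dev n \<omega>" for j
    proof -
      have "(norm (\<Sum>i\<in>UNIV. A n \<omega> $ j $ i *\<^sub>R u i n \<omega>))\<^sup>2
          \<le> (\<Sum>i\<in>UNIV. norm (u i n \<omega>))\<^sup>2"
        by (intro power_mono norm_mix_le) simp
      also have "\<dots> \<le> dev n \<omega> * ?m" unfolding dev_eq by (rule sum_squared_le_sum_of_squares)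
      finally show ?thesis by (simp add: mult.commute)
    qed
    hence "(\<Sum>j\<in>UNIV. (norm (\<Sum>i\<in>UNIV. A n \<omega> $ j $ i *\<^sub>R u i n \<omega>))\<^sup>2)
        \<le> (\<Sum>j::'m\<in>UNIV. ?m * dev n \<omega>)"
      by (rule sum_mono)
    thus ?thesis using norm_mean_le[of "\<lambda>j. \<Sum>i\<in>UNIV. A n \<omega> $ j $ i *\<^sub>R u i n \<omega>"] by simp
  qed
  have g2: "(norm (mean ?g))\<^sup>2 \<le> (\<Sum>j\<in>UNIV. (L j (\<xi> j n \<omega>))\<^sup>2)"
    by (rule order_trans[OF norm_mean_le]) (intro sum_mono norm_g_le)
  \<comment> \<open>Separating the squares avoids the product of the mixing term with the gradients;
    the factor 2 cancels against the 2 in the smoothness constant.\<close>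
  have "(norm (?e - \<alpha> n *\<^sub>R mean ?g))\<^sup>2 \<le> 2 * (norm ?e)\<^sup>2
      + 2 * ((\<alpha> n)\<^sup>2 * (norm (mean ?g))\<^sup>2)"
    using norm_diff_squared_le[of ?e "\<alpha> n *\<^sub>R mean ?g"] by (simp add: power_mult_distrib)
  also have "\<dots> \<le> 2 * (?m * ?m * dev n \<omega>)
      + 2 * ((\<alpha> n)\<^sup>2 * (\<Sum>j\<in>UNIV. (L j (\<xi> j n \<omega>))\<^sup>2))"
    by (intro add_mono mult_left_mono e2 g2) auto
  finally have "(norm (?e - \<alpha> n *\<^sub>R mean ?g))\<^sup>2 / (2 * \<sigma>) \<le>
     (2 * (?m * ?m * dev n \<omega>)
         + 2 * ((\<alpha> n)\<^sup>2 * (\<Sum>j\<in>UNIV. (L j (\<xi> j n \<omega>))\<^sup>2))) / (2 * \<sigma>)"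
    using sigma_pos by (intro divide_right_mono) auto
  also have "\<dots> = 1 / \<sigma> * (?m * ?m * dev n \<omega>
      + (\<alpha> n)\<^sup>2 * (\<Sum>j\<in>UNIV. (L j (\<xi> j n \<omega>))\<^sup>2))"
    using sigma_pos by (simp add: field_simps)
  finally have sq: "(norm (?e - \<alpha> n *\<^sub>R mean ?g))\<^sup>2 / (2 * \<sigma>) \<le>
    1 / \<sigma> * (?m * ?m * dev n \<omega> + (\<alpha> n)\<^sup>2 * (\<Sum>j\<in>UNIV. (L j (\<xi> j n \<omega>))\<^sup>2))" .
  have "R p (zbar (Suc n) \<omega>) \<le> R p (zbar n \<omega>) + inner (?e - \<alpha> n *\<^sub>R mean ?g) (?y - p)
      + (norm (?e - \<alpha> n *\<^sub>R mean ?g))\<^sup>2 / (2 * \<sigma>)"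
    using fenchel_coupling_step[of p "zbar (Suc n) \<omega>" "zbar n \<omega>"] unfolding diff xbar_def .
  moreover have "inner (?e - \<alpha> n *\<^sub>R mean ?g) (?y - p) = inner ?e (?y - p) - \<alpha> n * inner (mean ?g) (?y - p)"
    by (simp add: inner_diff_left)
  ultimately show ?thesis using g_in sq unfolding e_in by linarith
qed

lemma fenchel_coupling_continuous: "continuous_on UNIV (R p)"
proof -
  have "continuous_on UNIV (\<lambda>z. \<psi> (Q z))"
    by (rule continuous_on_compose2[OF psi_cont continuous_Q]) (auto simp: Q_maximizer)
  thus ?thesis
    unfolding fenchel_coupling_Q[abs_def] by (intro continuous_intros continuous_Q)
qed

lemma fenchel_coupling_meas[measurable]: "R p \<in> borel_measurable borel"
  by (rule borel_measurable_continuous_onI[OF fenchel_coupling_continuous])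

lemma xbar_meas: "xbar n \<in> borel_measurable (G n)"
  unfolding xbar_def[abs_def] using measurable_compose[OF zbar_meas Q_meas] .

lemma [measurable]: "xbar n \<in> borel_measurable M"
  by (rule M_lift[OF xbar_meas])

text \<open>The smoothness estimate started at the dual point 0 shows at most quadratic growth in
  \<open>zbar\<close>. It serves integrability.\<close>

lemma fenchel_coupling_le_energy:
  assumes "p \<in> X"
  shows "\<bar>R p (zbar n \<omega>)\<bar> \<le> (R p 0 + (norm (Q 0 - p))\<^sup>2) + (1
      + 1 / (2 * \<sigma>)) * energy n \<omega>"
proof -
  have "R p (zbar n \<omega>) \<le> R p 0 + inner (zbar n \<omega>) (Q 0 - p) + (norm (zbar n \<omega>))\<^sup>2 / (2 * \<sigma>)"
    using fenchel_coupling_step[of p "zbar n \<omega>" 0] by simp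
  moreover have "(norm (zbar n \<omega>))\<^sup>2 / (2 * \<sigma>) \<le> energy n \<omega> / (2 * \<sigma>)"
    using zbar_le_energy sigma_pos by (intro divide_right_mono) auto
  moreover have "inner (zbar n \<omega>) (Q 0 - p) \<le> (norm (zbar n \<omega>))\<^sup>2 + (norm (Q 0 - p))\<^sup>2"
    using inner_le_squares[of "zbar n \<omega>" "Q 0 - p"] by linarith
  ultimately show ?thesis
    using zbar_le_energy[of n \<omega>] fenchel_coupling_nonneg[OF assms, of "zbar n \<omega>"] by (simp add: algebra_simps)
qed

lemma xbar_le_energy:
  "(norm (xbar n \<omega> - p))\<^sup>2 \<le> 2 * (norm (Q 0 - p))\<^sup>2 + 2 / \<sigma>\<^sup>2 * energy n \<omega>"
proof -
  have "norm (xbar n \<omega> - Q 0) \<le> norm (zbar n \<omega>) / \<sigma>" using Q_lipschitz[of "zbar n \<omega>" 0]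
      by (simp add: xbar_def)
  hence "(norm (xbar n \<omega> - Q 0))\<^sup>2 \<le> (norm (zbar n \<omega>) / \<sigma>)\<^sup>2" by (intro power_mono) auto
  also have "\<dots> \<le> energy n \<omega> / \<sigma>\<^sup>2" using zbar_le_energy
      by (simp add: power_divide divide_right_mono)
  finally have "(norm (xbar n \<omega> - Q 0))\<^sup>2 \<le> energy n \<omega> / \<sigma>\<^sup>2" .
  moreover have "(norm (xbar n \<omega> - p))\<^sup>2 \<le> 2 * (norm (xbar n \<omega> - Q 0))\<^sup>2 + 2 * (norm (p
      - Q 0))\<^sup>2"
    using norm_diff_squared_le[of "xbar n \<omega> - Q 0" "p - Q 0"] by simp
  ultimately show ?thesis by (simp add: norm_minus_commute field_simps)
qed

lemma norm_xbar_le_energy: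
  "norm (xbar n \<omega> - p) \<le> (1 + 2 * (norm (Q 0 - p))\<^sup>2) + 2 / \<sigma>\<^sup>2 * energy n \<omega>"
proof -
  have "0 \<le> (norm (xbar n \<omega> - p) - 1)\<^sup>2" by simp
  hence "norm (xbar n \<omega> - p) \<le> 1 + (norm (xbar n \<omega> - p))\<^sup>2"
    by (simp add: power2_diff) (smt (verit) norm_ge_zero)
  thus ?thesis using xbar_le_energy[of n \<omega> p] by linarith
qed

section \<open>Expected descent on an event of the past\<close>

context
  fixes B :: "'a set" and n :: nat and N :: real
  assumes BG: "B \<in> sets (G n)" and BN: "B \<subseteq> start N"
begin

private lemma BM[measurable]: "B \<in> sets M"
  by (rule G_sets_M[OF BG])

private lemma coupling_integrable:
  assumes "p \<in> X"
  shows "integrable M (\<lambda>\<omega>. indicator B \<omega> * R p (zbar n \<omega>))"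
  by (rule energy_dominated[OF _ BM BN fenchel_coupling_le_energy[OF assms]]) simp

private lemma gap_integrable:
  assumes "p \<in> X"
  shows "integrable M (\<lambda>\<omega>. indicator B \<omega> * (objective (xbar n \<omega>) - objective p))"
proof (rule energy_dominated[OF _ BM BN])
  fix \<omega>
  let ?S = "\<Sum>j\<in>UNIV. EL j"
  have "\<bar>objective (xbar n \<omega>) - objective p\<bar> \<le> ?S * norm (xbar n \<omega> - p)"
    by (rule objective_lip[OF xbar_X assms])
  also have "\<dots> \<le> ?S * ((1 + 2 * (norm (Q 0 - p))\<^sup>2) + 2 / \<sigma>\<^sup>2 * energy n \<omega>)"
    by (intro mult_left_mono norm_xbar_le_energy sum_nonneg EL_nonneg)
  finally show "\<bar>objective (xbar n \<omega>) - objective p\<bar> \<le> ?S * (1 + 2 * (norm (Q 0 - p))\<^sup>2)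
      + ?S * (2 / \<sigma>\<^sup>2) * energy n \<omega>"
    by (simp add: distrib_left)
qed simp

text \<open>Independence replaces every coefficient by the same number 1/m, and the remaining past
  factors sum to zero because the deviations do. No single summand need vanish.\<close>

private lemma noise_term:
  assumes p: "p \<in> X"
  defines "T \<equiv> \<lambda>i \<omega>. weight i (A n \<omega>) * (indicator B \<omega> * inner (u i n \<omega>)
      (xbar n \<omega> - p))"
  shows "integrable M (T i)" "(\<Sum>i\<in>UNIV. LINT \<omega>|M. T i \<omega>) = 0"
proof -
  let ?Y = "\<lambda>i \<omega>. indicator B \<omega> * inner (u i n \<omega>) (xbar n \<omega> - p)"
  have YG: "?Y i \<in> borel_measurable (G n)" for i
  proof -
    note u_meas[measurable] xbar_meas[measurable] BG[measurable]
    show ?thesis by measurable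
  qed
  have Yint: "integrable M (?Y i)" for i
  proof (rule energy_dominated[OF _ BM BN])
    fix \<omega>
    show "\<bar>inner (u i n \<omega>) (xbar n \<omega> - p)\<bar> \<le> 2 * (norm (Q 0 - p))\<^sup>2 + (1
        + 2 / \<sigma>\<^sup>2) * energy n \<omega>"
      using inner_le_squares[of "u i n \<omega>" "xbar n \<omega>
          - p"] norm_u_le[of i n \<omega>] dev_le_energy[of n \<omega>] xbar_le_energy[of n \<omega> p]
      by (simp add: distrib_right)
  qed simp
  have T: "integrable M (T i)" "(LINT \<omega>|M. T i \<omega>) = 1 / real CARD('m) * (LINT \<omega>|M. ?Y i \<omega>)" for i
    unfolding T_def using expectation_fresh_mult[OF sub A_fresh YG weight_meas weight_A(1) Yint] weight_A(2) by auto
  show "integrable M (T i)" by (rule T)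
  have "(\<Sum>i\<in>UNIV. LINT \<omega>|M. T i \<omega>)
      = 1 / real CARD('m) * (LINT \<omega>|M. (\<Sum>i\<in>UNIV. ?Y i \<omega>))"
    unfolding T(2) by (subst Bochner_Integration.integral_sum) (auto simp: Yint sum_distrib_left)
  also have "(\<lambda>\<omega>. \<Sum>i\<in>UNIV. ?Y i \<omega>) = (\<lambda>\<omega>. 0)"
    by (simp add: sum_distrib_left[symmetric] inner_sum_left[symmetric] sum_u)
  finally show "(\<Sum>i\<in>UNIV. LINT \<omega>|M. T i \<omega>) = 0" by simp
qed

text \<open>The sample sits inside F together with \<open>xbar\<close>, so the general freezing
  lemma is needed; the indicator is carried along as a real coordinate of the past variable.
  Integrability comes from the Lipschitz bound, a product of independent integrable factors.\<close>

private lemma sample_term: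
  assumes p: "p \<in> X"
  defines "T \<equiv> \<lambda>j \<omega>. indicator B \<omega> * (F j (xbar n \<omega>) (\<xi> j n \<omega>)
      - F j p (\<xi> j n \<omega>))"
  shows "integrable M (T j)" "(LINT \<omega>|M. T j \<omega>)
      = (LINT \<omega>|M. indicator B \<omega> * (obj j (xbar n \<omega>) - obj j p))"
    "integrable M (\<lambda>\<omega>. indicator B \<omega> * (obj j (xbar n \<omega>) - obj j p))"
proof -
  let ?\<Phi> = "\<lambda>x::(real \<times> 'v) \<times> 's. fst (fst x) * (F j (snd (fst x)) (snd x) - F j p (snd x))"
  let ?Y = "\<lambda>\<omega>. (indicator B \<omega> :: real, xbar n \<omega>)"
  have [measurable]: "(\<lambda>x::(real \<times> 'v) \<times> 's. F j (snd (fst x)) (snd x)) \<in> borel_measurable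
      ((borel \<Otimes>\<^sub>M borel) \<Otimes>\<^sub>M borel)"
    "(\<lambda>x::(real \<times> 'v) \<times> 's. F j p (snd x)) \<in> borel_measurable ((borel \<Otimes>\<^sub>M borel)
        \<Otimes>\<^sub>M borel)"
    using measurable_compose[OF _ F_meas[of j], of "\<lambda>x::(real \<times> 'v) \<times> 's. (snd (fst x), snd x)"]
      measurable_compose[OF _ F_meas[of j], of "\<lambda>x::(real \<times> 'v) \<times> 's. (p, snd x)"]
    by simp_all
  have \<Phi>m: "?\<Phi> \<in> borel_measurable ((borel \<Otimes>\<^sub>M borel) \<Otimes>\<^sub>M borel)"
    by measurable
  have YG: "?Y \<in> G n \<rightarrow>\<^sub>M borel \<Otimes>\<^sub>M borel"
  proof -
    note xbar_meas[measurable] BG[measurable]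
    show ?thesis by measurable
  qed
  have nG: "(\<lambda>\<omega>. indicator B \<omega> * norm (xbar n \<omega> - p)) \<in> borel_measurable (G n)"
  proof -
    note xbar_meas[measurable] BG[measurable]
    show ?thesis by measurable
  qed
  have nint: "integrable M (\<lambda>\<omega>. indicator B \<omega> * norm (xbar n \<omega> - p))"
    by (rule energy_dominated[OF _ BM BN, of _ "1 + 2 * (norm (Q 0 - p))\<^sup>2" "2 / \<sigma>\<^sup>2" n])
      (use norm_xbar_le_energy[of n _ p] in auto)
  have Lint: "integrable M (\<lambda>\<omega>. L j (\<xi> j n \<omega>) * (indicator B \<omega> * norm (xbar n \<omega> - p)))"
    by (rule expectation_fresh_mult(1)[OF sub xi_fresh nG L_meas L_xi(1) nint])
  have Tm: "T j \<in> borel_measurable M"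
    using measurable_compose[OF measurable_Pair[OF M_lift[OF YG], of "\<xi> j n" borel] \<Phi>m] by (simp add: T_def)
  show Tint: "integrable M (T j)"
  proof (rule Bochner_Integration.integrable_bound[OF Lint Tm], rule AE_I2)
    fix \<omega>
    show "norm (T j \<omega>) \<le> norm (L j (\<xi> j n \<omega>) * (indicator B \<omega> * norm (xbar n \<omega> - p)))"
      using F_lip[OF xbar_X p, of j n \<omega> "\<xi> j n \<omega>"] L_nonneg[of j "\<xi> j n \<omega>"]
      by (cases "\<omega> \<in> B") (auto simp: T_def abs_mult)
  qed
  have "(LINT \<omega>|M. T j \<omega>) = (LINT \<omega>|M. ?\<Phi> (?Y \<omega>, \<xi> j n \<omega>))" by (simp add: T_def)
  also have "\<dots> = (LINT \<omega>|M. (LINT s|D j. ?\<Phi> (?Y \<omega>, s)))"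
    by (subst expectation_fresh[OF sub _ xi_fresh YG \<Phi>m, unfolded xi_distr]) (use Tint in \<open>auto simp: T_def\<close>)
  also have "\<dots> = (LINT \<omega>|M. indicator B \<omega> * (obj j (xbar n \<omega>) - obj j p))"
    using F_int xbar_X p by (simp add: obj_def)
  finally show "(LINT \<omega>|M. T j \<omega>) = (LINT \<omega>|M. indicator B \<omega> * (obj j (xbar n \<omega>) - obj j p))" .
  have "integrable M (\<lambda>\<omega>. EL j * (indicator B \<omega> * norm (xbar n \<omega> - p)))" using nint by simp
  thus "integrable M (\<lambda>\<omega>. indicator B \<omega> * (obj j (xbar n \<omega>) - obj j p))"
  proof (rule Bochner_Integration.integrable_bound, goal_cases)
    case 2
    show ?case
    proof (rule AE_I2)
      fix \<omega>
      show "norm (indicator B \<omega> * (obj j (xbar n \<omega>) - obj j p))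
          \<le> norm (EL j * (indicator B \<omega> * norm (xbar n \<omega> - p)))"
        using obj_lip[OF xbar_X p, of j n \<omega>] EL_nonneg(1)[of j]
        by (cases "\<omega> \<in> B") (auto simp: abs_mult)
    qed
  qed simp
qed

lemma expected_descent:
  assumes p: "p \<in> X"
  shows "integrable M (\<lambda>\<omega>. indicator B \<omega> * R p (zbar n \<omega>))"
    "integrable M (\<lambda>\<omega>. indicator B \<omega> * (objective (xbar n \<omega>) - objective p))"
    "(LINT \<omega>|M. indicator B \<omega> * R p (zbar (Suc n) \<omega>)) \<le>
       (LINT \<omega>|M. indicator B \<omega> * R p (zbar n \<omega>))
       - \<alpha> n / real CARD('m) * (LINT \<omega>|M. indicator B \<omega> * (objective (xbar n \<omega>) - objective p))
       + drift * (LINT \<omega>|M. indicator B \<omega> * ((\<alpha> n)\<^sup>2 + dev n \<omega>))"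
proof -
  let ?I = "indicator B :: 'a \<Rightarrow> real" and ?m = "real CARD('m)"
  \<comment> \<open>W dominates both of its nonnegative parts, the squared step and the deviation,
    so all error terms collapse to one multiple of it. The coefficients collected this way make up
    \<open>drift\<close>.\<close>
  define W where "W = (LINT \<omega>|M. ?I \<omega> * ((\<alpha> n)\<^sup>2 + dev n \<omega>))"
  define T0 where "T0 \<omega> = ?I \<omega> * R p (zbar n \<omega>)" for \<omega>
  define T1 where "T1 i \<omega> = weight i (A n \<omega>) * (?I \<omega> * inner (u i n \<omega>) (xbar n \<omega>
      - p))" for i \<omega>
  define T2 where "T2 j \<omega> = ?I \<omega> * (F j (xbar n \<omega>) (\<xi> j n \<omega>)
      - F j p (\<xi> j n \<omega>))" for j \<omega>
  define T3 where "T3 j \<omega> = L j (\<xi> j n \<omega>) * (?I \<omega> * ((\<alpha> n)\<^sup>2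
      + dev n \<omega>))" for j \<omega>
  define T4 where "T4 j \<omega> = (L j (\<xi> j n \<omega>))\<^sup>2 * ?I \<omega>" for j \<omega>
  define T5 where "T5 \<omega> = ?I \<omega> * dev n \<omega>" for \<omega>
  show c: "integrable M (\<lambda>\<omega>. ?I \<omega> * R p (zbar n \<omega>))" by (rule coupling_integrable[OF p])
  show gi: "integrable M (\<lambda>\<omega>. ?I \<omega> * (objective (xbar n \<omega>) - objective p))"
      by (rule gap_integrable[OF p])
  have Iint: "integrable M ?I" by (simp add: emeasure_eq_measure)
  have T5i: "integrable M T5" unfolding T5_def by (rule dev_integrable[OF BM BN])
  have Wint: "integrable M (\<lambda>\<omega>. ?I \<omega> * ((\<alpha> n)\<^sup>2 + dev n \<omega>))"
    using Iint T5i unfolding T5_def distrib_left by auto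
  have IG: "?I \<in> borel_measurable (G n)" "(\<lambda>\<omega>. ?I \<omega> * ((\<alpha> n)\<^sup>2
      + dev n \<omega>)) \<in> borel_measurable (G n)"
  proof -
    note dev_meas[measurable] BG[measurable]
    show "?I \<in> borel_measurable (G n)" "(\<lambda>\<omega>. ?I \<omega> * ((\<alpha> n)\<^sup>2
        + dev n \<omega>)) \<in> borel_measurable (G n)"
      by measurable
  qed
  have L2m: "(\<lambda>s. (L j s)\<^sup>2) \<in> borel_measurable borel" for j using L_meas by simp
  have T3: "integrable M (T3 j)" "(LINT \<omega>|M. T3 j \<omega>) = EL j * W" for j
    unfolding T3_def W_def using expectation_fresh_mult[OF sub xi_fresh IG(2) L_meas L_xi(1) Wint] L_xi(2) by auto
  have T4: "integrable M (T4 j)" "(LINT \<omega>|M. T4 j \<omega>) = EL2 j * (LINT \<omega>|M. ?I \<omega>)" for j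
    unfolding T4_def using expectation_fresh_mult[OF sub xi_fresh IG(1) L2m L_xi(3) Iint] L_xi(4) by auto
  note T1 = noise_term[OF p, folded T1_def]
  note T2 = sample_term[OF p, folded T2_def]
  have T2sum: "(\<Sum>j\<in>UNIV. LINT \<omega>|M. T2 j \<omega>)
      = (LINT \<omega>|M. ?I \<omega> * (objective (xbar n \<omega>) - objective p))"
  proof -
    have "(\<Sum>j\<in>UNIV. LINT \<omega>|M. T2 j \<omega>)
        = (LINT \<omega>|M. (\<Sum>j\<in>UNIV. ?I \<omega> * (obj j (xbar n \<omega>) - obj j p)))"
      unfolding T2(2) by (rule Bochner_Integration.integral_sum[symmetric]) (rule T2(3))
    thus ?thesis by (simp add: objective_def sum_distrib_left[symmetric] sum_subtractf)
  qed
  have W: "W = (\<alpha> n)\<^sup>2 * (LINT \<omega>|M. ?I \<omega>) + (LINT \<omega>|M. T5 \<omega>)"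
    using Iint T5i unfolding W_def T5_def distrib_left by simp
  have W5: "(LINT \<omega>|M. T5 \<omega>) \<le> W" and WI: "(\<alpha> n)\<^sup>2 * (LINT \<omega>|M. ?I \<omega>) \<le> W"
  proof -
    have "0 \<le> (LINT \<omega>|M. T5 \<omega>)" "0 \<le> (LINT \<omega>|M. ?I \<omega>)" by (simp_all add: T5_def dev_nonneg)
    thus "(LINT \<omega>|M. T5 \<omega>) \<le> W" "(\<alpha> n)\<^sup>2 * (LINT \<omega>|M. ?I \<omega>) \<le> W" unfolding W
        by auto
  qed
  have "(LINT \<omega>|M. ?I \<omega> * R p (zbar (Suc n) \<omega>)) \<le>
    (LINT \<omega>|M. T0 \<omega> + (\<Sum>i\<in>UNIV. T1 i \<omega>) - \<alpha> n / ?m * (\<Sum>j\<in>UNIV. T2 j \<omega>)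
        + 2 / \<sigma> * (\<Sum>j\<in>UNIV. T3 j \<omega>)
      + 1 / \<sigma> * (?m * ?m * T5 \<omega> + (\<alpha> n)\<^sup>2 * (\<Sum>j\<in>UNIV. T4 j \<omega>)))" (is "_
          \<le> integral\<^sup>L M ?rhs")
  proof (rule integral_mono)
    show "integrable M (\<lambda>\<omega>. ?I \<omega> * R p (zbar (Suc n) \<omega>))"
      by (rule energy_dominated[OF _ BM BN fenchel_coupling_le_energy[OF p]]) simp
    show "integrable M ?rhs"
      using c[folded T0_def] T1(1) T2(1) T3(1) T4(1) T5i
      by (intro Bochner_Integration.integrable_add Bochner_Integration.integrable_diff Bochner_Integration.integrable_sum
          Bochner_Integration.integrable_mult_right) auto
    fix \<omega>
    show "?I \<omega> * R p (zbar (Suc n) \<omega>) \<le> ?rhs \<omega>"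
      using descent[OF p, of n \<omega>]
      by (cases "\<omega> \<in> B") (auto simp: T0_def T1_def T2_def T3_def T4_def T5_def)
  qed
  also have "\<dots> = (LINT \<omega>|M. T0 \<omega>) + (\<Sum>i\<in>UNIV. LINT \<omega>|M. T1 i \<omega>)
      - \<alpha> n / ?m * (\<Sum>j\<in>UNIV. LINT \<omega>|M. T2 j \<omega>)
      + 2 / \<sigma> * (\<Sum>j\<in>UNIV. LINT \<omega>|M. T3 j \<omega>)
      + 1 / \<sigma> * (?m * ?m * (LINT \<omega>|M. T5 \<omega>)
          + (\<alpha> n)\<^sup>2 * (\<Sum>j\<in>UNIV. LINT \<omega>|M. T4 j \<omega>))"
    using c[folded T0_def] T1(1) T2(1) T3(1) T4(1) T5i by simp
  also have "\<dots> = (LINT \<omega>|M. T0 \<omega>)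
      - \<alpha> n / ?m * (LINT \<omega>|M. ?I \<omega> * (objective (xbar n \<omega>) - objective p))
      + 2 / \<sigma> * ((\<Sum>j\<in>UNIV. EL j) * W)
      + 1 / \<sigma> * (?m * ?m * (LINT \<omega>|M. T5 \<omega>)
          + (\<Sum>j\<in>UNIV. EL2 j) * ((\<alpha> n)\<^sup>2 * (LINT \<omega>|M. ?I \<omega>)))"
    unfolding T1(2) T2sum T3(2) T4(2) by (simp add: sum_distrib_right[symmetric])
  also have "\<dots> \<le> (LINT \<omega>|M. T0 \<omega>)
      - \<alpha> n / ?m * (LINT \<omega>|M. ?I \<omega> * (objective (xbar n \<omega>) - objective p))
      + 2 / \<sigma> * ((\<Sum>j\<in>UNIV. EL j) * W)
      + 1 / \<sigma> * (?m * ?m * W + (\<Sum>j\<in>UNIV. EL2 j) * W)"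
    using sigma_pos by (intro add_mono order_refl mult_left_mono W5 WI sum_nonneg EL_nonneg) auto
  also have "\<dots> = (LINT \<omega>|M. T0 \<omega>)
      - \<alpha> n / ?m * (LINT \<omega>|M. ?I \<omega> * (objective (xbar n \<omega>) - objective p)) + drift * W"
    unfolding drift_def by (simp add: algebra_simps add_divide_distrib)
  finally show "(LINT \<omega>|M. ?I \<omega> * R p (zbar (Suc n) \<omega>)) \<le>
       (LINT \<omega>|M. ?I \<omega> * R p (zbar n \<omega>))
       - \<alpha> n / real CARD('m) * (LINT \<omega>|M. ?I \<omega> * (objective (xbar n \<omega>) - objective p))
       + drift * (LINT \<omega>|M. ?I \<omega> * ((\<alpha> n)\<^sup>2 + dev n \<omega>))"
    unfolding T0_def W_def .
qed

end

text \<open>Adding the objective gains already made to the coupling absorbs the negative drift, so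
  the sum is a nonnegative almost supermartingale. Once it converges, nonnegativity of the coupling
  bounds the gains; they form a convergent series, and subtracting it leaves a convergent
  coupling.\<close>

lemma coupling_converges:
  assumes p: "p \<in> X" and p_min: "\<And>y. y \<in> X \<Longrightarrow> objective p \<le> objective y"
    and a2: "summable (\<lambda>n. (\<alpha> n)\<^sup>2)"
    and dev_sum: "summable (\<lambda>n. LINT \<omega>|M. indicator (start N) \<omega> * dev n \<omega>)"
  shows "AE \<omega> in M. \<omega> \<in> start N \<longrightarrow> convergent (\<lambda>n. R p (zbar n \<omega>)) \<and>
    summable (\<lambda>n. \<alpha> n * (objective (xbar n \<omega>) - objective p))"
proof -
  let ?m = "real CARD('m)"
  let ?I = "indicator (start N) :: 'a \<Rightarrow> real"
  define gain where "gain n \<omega> = (\<Sum>i<n. \<alpha> i / ?m * (objective (xbar i \<omega>) - objective p))" for n \<omega>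
  define Y where "Y n \<omega> = ?I \<omega> * (R p (zbar n \<omega>) + gain n \<omega>)" for n \<omega>
  define b where "b n \<omega> = drift * (?I \<omega> * ((\<alpha> n)\<^sup>2 + dev n \<omega>))" for n \<omega>
  have gap0: "0 \<le> objective (xbar i \<omega>) - objective p" for i \<omega> using p_min[OF xbar_X] by simp
  have gain0: "0 \<le> gain n \<omega>" for n \<omega>
    unfolding gain_def using alpha_pos
        by (intro sum_nonneg mult_nonneg_nonneg gap0 divide_nonneg_nonneg) (auto intro: less_imp_le)
  have gap_G: "(\<lambda>\<omega>. objective (xbar i \<omega>) - objective p) \<in> borel_measurable (G n)" if "i \<le> n" for i n
    using measurable_compose[OF G_lift[OF that xbar_meas] objective_meas] by simp
  have gap_int: "integrable M (\<lambda>\<omega>. indicator B \<omega> * (objective (xbar i \<omega>) - objective p))"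
    if "B \<in> sets M" "B \<subseteq> start N" for B i
  proof -
    have "integrable M (\<lambda>\<omega>. indicator B \<omega> * (?I \<omega> * (objective (xbar i \<omega>) - objective p)))"
      by (rule integrable_indicator_mult[OF that(1) expected_descent(2)[OF start_sets order_refl p]])
    also have "(\<lambda>\<omega>. indicator B \<omega> * (?I \<omega> * (objective (xbar i \<omega>) - objective p)))
        = (\<lambda>\<omega>. indicator B \<omega> * (objective (xbar i \<omega>) - objective p))"
      using that(2) by (auto simp: indicator_def fun_eq_iff)
    finally show ?thesis .
  qed
  have gain_int: "integrable M (\<lambda>\<omega>. indicator B \<omega> * gain n \<omega>)" if "B \<in> sets M" "B
      \<subseteq> start N" for B n
  proof -
    have "(\<lambda>\<omega>. indicator B \<omega> * gain n \<omega>)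
        = (\<lambda>\<omega>. \<Sum>i<n. \<alpha> i / ?m * (indicator B \<omega> * (objective (xbar i \<omega>) - objective p)))"
      unfolding gain_def sum_distrib_left by (simp add: mult_ac)
    thus ?thesis using gap_int[OF that]
        by (simp only:) (intro Bochner_Integration.integrable_sum Bochner_Integration.integrable_mult_right)
  qed
  have coup_int: "integrable M (\<lambda>\<omega>. ?I \<omega> * R p (zbar n \<omega>))" for n
    by (rule expected_descent(1)[OF start_sets order_refl p])
  have dev_int: "integrable M (\<lambda>\<omega>. ?I \<omega> * dev n \<omega>)" for n
    by (rule dev_integrable[OF start_sets_M order_refl])
  have I_int: "integrable M ?I" by (simp add: emeasure_eq_measure)
  have b_int: "integrable M (b n)" for n
    unfolding b_def distrib_left using dev_int I_int by auto
  have AE_Y: "AE \<omega> in M. convergent (\<lambda>n. Y n \<omega>)"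
  proof (rule almost_supermartingale_converges[where G = G and b = b])
    show "subalgebra M (G n)" "sets (G n) \<subseteq> sets (G (Suc n))" for n by (fact sub G_mono)+
    show "Y n \<in> borel_measurable (G n)" for n
    proof -
      have "gain n \<in> borel_measurable (G n)"
        unfolding gain_def[abs_def] by (intro borel_measurable_sum borel_measurable_times borel_measurable_const gap_G) auto
      moreover have "(\<lambda>\<omega>. R p (zbar n \<omega>)) \<in> borel_measurable (G n)"
        by (rule measurable_compose[OF zbar_meas fenchel_coupling_meas])
      moreover have "?I \<in> borel_measurable (G n)" by (rule borel_measurable_indicator[OF start_sets])
      ultimately show ?thesis unfolding Y_def[abs_def] by (intro borel_measurable_times borel_measurable_add)
    qed
    show "b n \<in> borel_measurable (G n)" for n
    proof -
      have "?I \<in> borel_measurable (G n)" by (rule borel_measurable_indicator[OF start_sets])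
      thus ?thesis unfolding b_def[abs_def]
        by (intro borel_measurable_times borel_measurable_add borel_measurable_const dev_meas)
    qed
    show "integrable M (Y n)" for n
      unfolding Y_def distrib_left using coup_int gain_int[OF start_sets_M order_refl] by auto
    show "integrable M (b n)" for n by (rule b_int)
    show "0 \<le> Y n \<omega>" for n \<omega>
      unfolding Y_def using fenchel_coupling_nonneg[OF p] gain0 by auto
    show "0 \<le> b n \<omega>" for n \<omega>
      unfolding b_def using drift_nonneg dev_nonneg by auto
    show "summable (\<lambda>n. LINT \<omega>|M. b n \<omega>)"
    proof -
      have "(\<lambda>n. LINT \<omega>|M. b n \<omega>)
          = (\<lambda>n. drift * ((LINT \<omega>|M. ?I \<omega>) * (\<alpha> n)\<^sup>2
              + (LINT \<omega>|M. ?I \<omega> * dev n \<omega>)))"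
        unfolding b_def distrib_left using dev_int I_int by (simp add: fun_eq_iff distrib_left)
      thus ?thesis by (simp only:) (intro summable_mult summable_add a2 dev_sum)
    qed
    fix n B assume "B \<in> sets (G n)"
    \<comment> \<open>The truncation in Y is moved into the test event, which stays in
      \<open>G n\<close> because the initial values are part of every past.\<close>
    define B' where "B' = B \<inter> start N"
    have B': "B' \<in> sets (G n)" "B' \<subseteq> start N" unfolding B'_def
        using \<open>B \<in> sets (G n)\<close> start_sets by auto
    note B'M = G_sets_M[OF B'(1)]
    let ?J = "indicator B' :: 'a \<Rightarrow> real"
    have J: "indicator B \<omega> * (?I \<omega> * x) = ?J \<omega> * x" for \<omega> x by (simp add: B'_def indicator_def)
    have devJ: "integrable M (\<lambda>\<omega>. ?J \<omega> * ((\<alpha> n)\<^sup>2 + dev n \<omega>))"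
      unfolding distrib_left using dev_integrable[OF B'M B'(2)] B'M by (auto simp: emeasure_eq_measure)
    have RJ: "integrable M (\<lambda>\<omega>. ?J \<omega> * R p (zbar (Suc n) \<omega>))"
      using expected_descent(1)[OF _ B'(2) p, of "Suc n"] B'(1) G_mono[of n] by blast
    have "(LINT \<omega>|M. indicator B \<omega> * Y (Suc n) \<omega>)
        = (LINT \<omega>|M. ?J \<omega> * R p (zbar (Suc n) \<omega>) + ?J \<omega> * gain (Suc n) \<omega>)"
      unfolding Y_def J distrib_left ..
    also have "\<dots> = (LINT \<omega>|M. ?J \<omega> * R p (zbar (Suc n) \<omega>))
        + (LINT \<omega>|M. ?J \<omega> * gain (Suc n) \<omega>)"
      by (rule Bochner_Integration.integral_add[OF RJ gain_int[OF B'M B'(2)]])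
    also have "(LINT \<omega>|M. ?J \<omega> * gain (Suc n) \<omega>) = (LINT \<omega>|M. ?J \<omega> * gain n \<omega>)
        + \<alpha> n / ?m * (LINT \<omega>|M. ?J \<omega> * (objective (xbar n \<omega>) - objective p))"
    proof -
      have "(LINT \<omega>|M. ?J \<omega> * gain (Suc n) \<omega>) = (LINT \<omega>|M. ?J \<omega> * gain n \<omega>
          + \<alpha> n / ?m * (?J \<omega> * (objective (xbar n \<omega>) - objective p)))"
        by (simp add: gain_def distrib_left mult_ac)
      also have "\<dots> = (LINT \<omega>|M. ?J \<omega> * gain n \<omega>)
          + (LINT \<omega>|M. \<alpha> n / ?m * (?J \<omega> * (objective (xbar n \<omega>) - objective p)))"
        by (intro Bochner_Integration.integral_add gain_int[OF B'M B'(2)] Bochner_Integration.integrable_mult_right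
            gap_int[OF B'M B'(2)])
      finally show ?thesis by (simp only: Bochner_Integration.integral_mult_right_zero)
    qed
    also have "(LINT \<omega>|M. ?J \<omega> * R p (zbar (Suc n) \<omega>)) + ((LINT \<omega>|M. ?J \<omega> * gain n \<omega>)
        + \<alpha> n / ?m * (LINT \<omega>|M. ?J \<omega> * (objective (xbar n \<omega>) - objective p)))
      \<le> (LINT \<omega>|M. ?J \<omega> * R p (zbar n \<omega>)) + (LINT \<omega>|M. ?J \<omega> * gain n \<omega>)
          + drift * (LINT \<omega>|M. ?J \<omega> * ((\<alpha> n)\<^sup>2 + dev n \<omega>))"
      using expected_descent(3)[OF B' p] by linarith
    also have "\<dots> = (LINT \<omega>|M. ?J \<omega> * R p (zbar n \<omega>) + ?J \<omega> * gain n \<omega>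
        + drift * (?J \<omega> * ((\<alpha> n)\<^sup>2 + dev n \<omega>)))"
      using expected_descent(1)[OF B' p] gain_int[OF B'M B'(2), of n] devJ
      by (simp only: Bochner_Integration.integral_add Bochner_Integration.integrable_add Bochner_Integration.integrable_mult_right
          Bochner_Integration.integral_mult_right_zero)
    also have "\<dots> = (LINT \<omega>|M. indicator B \<omega> * (Y n \<omega> + b n \<omega>))"
    proof -
      have "indicator B \<omega> * (Y n \<omega> + b n \<omega>) = ?J \<omega> * R p (zbar n \<omega>)
          + ?J \<omega> * gain n \<omega> + drift * (?J \<omega> * ((\<alpha> n)\<^sup>2 + dev n \<omega>))" for \<omega>
        unfolding Y_def b_def B'_def by (simp add: indicator_def distrib_left)
      thus ?thesis by simp
    qed
    finally show "(LINT \<omega>|M. indicator B \<omega> * Y (Suc n) \<omega>)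
        \<le> (LINT \<omega>|M. indicator B \<omega> * (Y n \<omega> + b n \<omega>))" .
  qed
  show ?thesis
    using AE_Y
  proof (eventually_elim, intro impI)
    fix \<omega> assume conv: "convergent (\<lambda>n. Y n \<omega>)" and w: "\<omega> \<in> start N"
    have Y: "Y n \<omega> = R p (zbar n \<omega>) + gain n \<omega>" for n using w by (simp add: Y_def)
    obtain c where c: "\<And>n. norm (Y n \<omega>) \<le> c" using convergent_imp_Bseq[OF conv] by (auto simp: Bseq_def)
    \<comment> \<open>The gains are partial sums of a nonnegative series, so this bound already
      yields summability.\<close>
    have "gain n \<omega> \<le> c" for n
      using c[of n] fenchel_coupling_nonneg[OF p, of "zbar n \<omega>"] unfolding Y real_norm_def by linarith
    hence s: "summable (\<lambda>n. \<alpha> n / ?m * (objective (xbar n \<omega>) - objective p))"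
      unfolding gain_def
      by (intro summableI_nonneg_bounded[of _ c] mult_nonneg_nonneg gap0 divide_nonneg_nonneg less_imp_le[OF alpha_pos]) auto
    have "summable (\<lambda>n. ?m * (\<alpha> n / ?m * (objective (xbar n \<omega>) - objective p)))"
        by (rule summable_mult[OF s])
    hence s2: "summable (\<lambda>n. \<alpha> n * (objective (xbar n \<omega>) - objective p))" by simp
    have "convergent (\<lambda>n. gain n \<omega>)" using s unfolding gain_def summable_iff_convergent .
    from convergent_diff[OF conv this] have "convergent (\<lambda>n. R p (zbar n \<omega>))" by (simp add: Y)
    thus "convergent (\<lambda>n. R p (zbar n \<omega>)) \<and> summable (\<lambda>n. \<alpha> n * (objective (xbar n
        \<omega>) - objective p))"
      using s2 by simp
  qed
qed

theorem converges_to_minimizer: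
  assumes recip: "\<And>y zs. y \<in> X \<Longrightarrow> (\<lambda>k. Q (zs k)) \<longlonglongrightarrow> y
      \<Longrightarrow> (\<lambda>k. R y (zs k)) \<longlonglongrightarrow> 0"
    and x0: "x0 \<in> X" and x0_min: "\<And>y. y \<in> X \<Longrightarrow> objective x0 \<le> objective y"
    and a2: "summable (\<lambda>n. (\<alpha> n)\<^sup>2)" and a1: "\<not> summable \<alpha>"
    and dev_sum: "\<And>N. summable (\<lambda>n. LINT \<omega>|M. indicator (start N) \<omega> * dev n \<omega>)"
  shows "AE \<omega> in M. \<exists>y\<in>{y\<in>X. objective y = objective x0}.
    (\<forall>j. (\<lambda>n. Q (z j n \<omega>)) \<longlonglongrightarrow> y) \<and> (\<lambda>n. xbar n \<omega>)
        \<longlonglongrightarrow> y"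
proof -
  define Xs where "Xs = {y\<in>X. objective y = objective x0}"
  have "x0 \<in> Xs" using x0 by (simp add: Xs_def)
  obtain P where P: "\<not> affine_dependent P" "P \<subseteq> Xs" "affine hull P = affine hull Xs"
    using affine_basis_exists by blast
  have finP: "finite P" using P(1) aff_independent_finite by blast
  have P': "P \<subseteq> X" "P \<noteq> {}" "Xs \<subseteq> affine hull P"
    using P \<open>x0 \<in> Xs\<close> hull_subset[of Xs affine] by (auto simp: Xs_def)
  have "AE \<omega> in M. \<forall>p\<in>P. \<omega> \<in> start N \<longrightarrow> convergent (\<lambda>n. R p (zbar n
      \<omega>)) \<and>
    summable (\<lambda>n. \<alpha> n * (objective (xbar n \<omega>) - objective p))" for N
    using P(2) x0_min
    by (intro AE_finite_allI[OF finP] coupling_converges a2 dev_sum) (auto simp: Xs_def)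
  moreover have "AE \<omega> in M. summable (\<lambda>n. indicator (start N) \<omega> * dev n \<omega>)" for N
    by (rule AE_summable_if_integrals_summable[OF dev_integrable[OF start_sets_M order_refl] _ dev_sum]) (simp add: dev_nonneg)
  \<comment> \<open>Natural bounds N suffice: the events \<open>start N\<close> cover the space, so
    countably many exceptional sets are combined and the truncation disappears.\<close>
  ultimately have "AE \<omega> in M. \<forall>N::nat. (\<forall>p\<in>P. \<omega> \<in> start (real N) \<longrightarrow>
      convergent (\<lambda>n. R p (zbar n \<omega>)) \<and>
    summable (\<lambda>n. \<alpha> n * (objective (xbar n \<omega>)
        - objective p))) \<and> summable (\<lambda>n. indicator (start (real N)) \<omega> * dev n \<omega>)"
    by (simp add: AE_all_countable)
  with AE_space show ?thesis
  proof eventually_elim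
    case (elim \<omega>)
    obtain N :: nat where N: "(\<Sum>j\<in>UNIV. norm (z j 0 \<omega>)) \<le> real N" using real_arch_simple by blast
    have "norm (z j 0 \<omega>) \<le> real N" for j
      using N member_le_sum[of j UNIV "\<lambda>j. norm (z j 0 \<omega>)"] by simp
    hence w: "\<omega> \<in> start (real N)" using elim(1) by (simp add: start_def)
    have conv: "convergent (\<lambda>n. R p (zbar n \<omega>))" if "p \<in> P" for p
      using elim(2) w that by blast
    obtain p where p: "p \<in> P" using P' by blast
    have "objective p = objective x0" using p P(2) by (auto simp: Xs_def)
    hence sum: "summable (\<lambda>n. \<alpha> n * (objective (Q (zbar n \<omega>)) - objective x0))"
      using elim(2) w p unfolding xbar_def by metis
    have "\<exists>y\<in>{y\<in>X. objective y = objective x0}. (\<lambda>n. Q (zbar n \<omega>)) \<longlonglongrightarrow> y"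
      by (rule mirror_convergence[OF recip x0_min objective_continuous P'[unfolded Xs_def] conv alpha_pos a1 sum])
    then obtain y where y: "y \<in> {y\<in>X. objective y
        = objective x0}" "(\<lambda>n. xbar n \<omega>) \<longlonglongrightarrow> y"
      unfolding xbar_def by blast
    \<comment> \<open>Summability of the expectations gives more than convergence in mean: the
      deviation tends to 0 along this outcome, so every agent follows the average.\<close>
    have "summable (\<lambda>n. dev n \<omega>)" using elim(2)[rule_format, of N] w by simp
    hence dev0: "(\<lambda>n. dev n \<omega>) \<longlonglongrightarrow> 0" by (rule summable_LIMSEQ_zero)
    have "(\<lambda>n. Q (z j n \<omega>)) \<longlonglongrightarrow> y" for j
    proof -
      have "(\<lambda>n. Q (z j n \<omega>) - xbar n \<omega>) \<longlonglongrightarrow> 0"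
      proof (rule Lim_null_comparison)
        have "norm (Q (z j n \<omega>) - xbar n \<omega>) \<le> sqrt (dev n \<omega>) / \<sigma>" for n
          using Q_z_xbar[of j n \<omega>] real_le_rsqrt[OF norm_u_le[of j n \<omega>]] sigma_pos
          by (meson divide_right_mono less_imp_le order_trans)
        thus "\<forall>\<^sub>F n in sequentially. norm (Q (z j n \<omega>) - xbar n \<omega>)
            \<le> sqrt (dev n \<omega>) / \<sigma>" by simp
        show "(\<lambda>n. sqrt (dev n \<omega>) / \<sigma>) \<longlonglongrightarrow> 0"
          using tendsto_divide[OF tendsto_real_sqrt[OF dev0] tendsto_const[of \<sigma>]] sigma_pos by simp
      qed
      from tendsto_add[OF this y(2)] show ?thesis by simp
    qed
    thus ?case using y by blast
  qed
qed

end

section \<open>Almost sure convergence\<close>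

text \<open>A positive liminf leaves room for a constant c below it, valid eventually. The second
  claim compares the squared steps with k^(-2 \<beta>), whose exponent is below -1.\<close>

lemma step_size_bounds:
  fixes \<alpha> \<rho> :: "nat \<Rightarrow> real"
  assumes pos: "\<And>k. k \<ge> 1 \<Longrightarrow> \<alpha> k > 0"
    and lim: "(\<lambda>k. real k powr \<beta> * \<alpha> k) \<longlonglongrightarrow> 0" and \<beta>: "\<beta> > 1 / 2"
    and inf: "liminf (\<lambda>k. ereal ((1 - \<rho> k) / (real k powr \<beta> * \<alpha> k))) > 0"
  shows "\<exists>c>0. \<forall>\<^sub>F n in sequentially. 1
      - \<rho> (Suc n) \<ge> c * (real (Suc n) powr \<beta> * \<alpha> (Suc n))"
    and "summable (\<lambda>n. (\<alpha> (Suc n))\<^sup>2)"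
proof -
  obtain c where c: "0 < ereal c" "ereal c < liminf (\<lambda>k. ereal ((1 - \<rho> k) / (real k powr \<beta> * \<alpha> k)))"
    using ereal_dense2[OF inf] by blast
  have pos': "0 < real k powr \<beta> * \<alpha> k" if "k \<ge> 1" for k using pos[OF that] that by simp
  have "\<forall>\<^sub>F k in sequentially. ereal c < ereal ((1 - \<rho> k) / (real k powr \<beta> * \<alpha> k))"
    by (rule less_LiminfD[OF c(2)])
  hence "\<forall>\<^sub>F k in sequentially. 1 - \<rho> k \<ge> c * (real k powr \<beta> * \<alpha> k)"
    using eventually_ge_at_top[of "1::nat"]
  proof eventually_elim
    case (elim k)
    thus ?case using pos'[of k] by (simp add: pos_less_divide_eq less_imp_le)
  qed
  hence "\<forall>\<^sub>F n in sequentially. 1 - \<rho> (Suc n) \<ge> c * (real (Suc n) powr \<beta> * \<alpha> (Suc n))"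
    by (subst (asm) eventually_sequentially_Suc[symmetric])
  thus "\<exists>c>0. \<forall>\<^sub>F n in sequentially. 1
      - \<rho> (Suc n) \<ge> c * (real (Suc n) powr \<beta> * \<alpha> (Suc n))"
    using c(1) by auto
  have "\<forall>\<^sub>F k in sequentially. real k powr \<beta> * \<alpha> k < 1"
    using lim by (rule order_tendstoD) simp
  then obtain K where K: "\<And>k. k \<ge> K \<Longrightarrow> real k powr \<beta> * \<alpha> k < 1"
      by (auto simp: eventually_sequentially)
  have "summable (\<lambda>k. (\<alpha> k)\<^sup>2)"
  proof (rule summable_comparison_test)
    show "summable (\<lambda>k. real k powr (- (2 * \<beta>)))" using \<beta> by (simp add: summable_real_powr_iff)
    show "\<exists>N. \<forall>n\<ge>N. norm ((\<alpha> n)\<^sup>2) \<le> real n powr (- (2 * \<beta>))"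
    proof (intro exI[of _ "max K 1"] allI impI)
      fix k assume k: "k \<ge> max K 1"
      have "\<alpha> k \<le> real k powr - \<beta>"
        using K[of k] k by (simp add: powr_minus field_simps)
      hence "(\<alpha> k)\<^sup>2 \<le> (real k powr - \<beta>)\<^sup>2" using pos[of k] k by (intro power_mono) auto
      also have "\<dots> = real k powr (- (2 * \<beta>))" by (simp add: power2_eq_square powr_add[symmetric])
      finally show "norm ((\<alpha> k)\<^sup>2) \<le> real k powr (- (2 * \<beta>))" by simp
    qed
  qed
  thus "summable (\<lambda>n. (\<alpha> (Suc n))\<^sup>2)" by (subst summable_Suc_iff)
qed

section \<open>Replacing the weights by matrices that are row-stochastic everywhere\<close>

definition row_stochastic :: "real^'m^'m \<Rightarrow> bool" where
  "row_stochastic B \<longleftrightarrow> (\<forall>i j. B $ i $ j \<ge> 0) \<and> B *v 1 = 1"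

text \<open>The identity is a row-stochastic default. Since the replacement is a fixed Borel
  function of the matrix, it preserves measurability and independence of the past.\<close>

definition stochastic_part :: "real^'m^'m \<Rightarrow> real^'m^'m" where
  "stochastic_part B = (if row_stochastic B then B else mat 1)"

lemma stochastic_part:
  fixes B :: "real^'m::finite^'m"
  shows "0 \<le> stochastic_part B $ i $ j" "(\<Sum>j\<in>UNIV. stochastic_part B $ i $ j) = 1"
proof -
  have "0 \<le> (mat 1 :: real^'m^'m) $ i $ j" for i j by (simp add: mat_def)
  hence "row_stochastic (stochastic_part B)"
    by (simp add: stochastic_part_def row_stochastic_def)
  thus "0 \<le> stochastic_part B $ i $ j" "(\<Sum>j\<in>UNIV. stochastic_part B $ i $ j) = 1"
    by (auto simp: row_stochastic_def vec_eq_iff matrix_vector_mult_def)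
qed

lemma stochastic_part_measurable[measurable]:
  "stochastic_part \<in> borel_measurable (borel :: (real^'m::finite^'m) measure)"
proof -
  have entry: "(\<lambda>B::real^'m^'m. B $ i $ j) \<in> borel_measurable borel" for i j
    by (intro borel_measurable_continuous_onI continuous_intros)
  have "row_stochastic B \<longleftrightarrow> (\<forall>i j. B $ i $ j \<ge> 0) \<and> (\<forall>i. (\<Sum>j\<in>UNIV.
      B $ i $ j) = 1)" for B :: "real^'m^'m"
    by (simp add: row_stochastic_def vec_eq_iff matrix_vector_mult_def)
  hence "Measurable.pred borel (row_stochastic :: real^'m^'m \<Rightarrow> bool)"
    using entry by (simp add: row_stochastic_def[abs_def] vec_eq_iff matrix_vector_mult_def) measurable
  thus ?thesis unfolding stochastic_part_def[abs_def] by measurable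
qed

theorem theorem1:
  fixes M :: "'a measure"
    and X :: "(real ^ 'd) set"
    and \<psi> :: "real ^ 'd \<Rightarrow> real"
    and F :: "'m::finite \<Rightarrow> real ^ 'd \<Rightarrow> real ^ 'p \<Rightarrow> real"
    and L0 :: "'m \<Rightarrow> real ^ 'p \<Rightarrow> real"
    and \<xi> :: "'m \<Rightarrow> 'a \<Rightarrow> real ^ 'p"
    and \<xi>s :: "'m \<Rightarrow> nat \<Rightarrow> 'a \<Rightarrow> real ^ 'p"
    and A :: "nat \<Rightarrow> 'a \<Rightarrow> real ^ 'm ^ 'm"
    and \<alpha> :: "nat \<Rightarrow> real"
    and x z :: "'m \<Rightarrow> nat \<Rightarrow> 'a \<Rightarrow> real ^ 'd"
    and xbar zbar :: "nat \<Rightarrow> 'a \<Rightarrow> real ^ 'd"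
  defines "f \<equiv> expected_objective M F \<xi>"
    and "Xstar \<equiv> solution_set X (total_objective M F \<xi>)"
    and "Q \<equiv> mirror_map X \<psi>"
    and "R \<equiv> fenchel_coupling X \<psi>"
    and "\<F> \<equiv> history M (\<lambda>j. z j 0) \<xi>s A"
    and "\<F>' \<equiv> extended_history M (\<lambda>j. z j 0) \<xi>s A"
    and "\<rho> \<equiv> \<lambda>k. contraction_factor M (A k)"
  assumes prob: "prob_space M"
    and feasible: "closed X" "convex X" "X \<noteq> {}"
    and psi: "continuous_on X \<psi>" "strongly_convex_on X \<psi>"
    and solvable: "Xstar \<noteq> {}"
    and rv_xi: "\<And>j. \<xi> j \<in> M \<rightarrow>\<^sub>M borel"
    and rv_xis: "\<And>j k. k \<ge> 1 \<Longrightarrow> \<xi>s j k \<in> M \<rightarrow>\<^sub>M borel"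
    and rv_A: "\<And>k. k \<ge> 1 \<Longrightarrow> A k \<in> M \<rightarrow>\<^sub>M borel"
    and rv_z0: "\<And>j. z j 0 \<in> M \<rightarrow>\<^sub>M borel"
    and F_meas: "\<And>j. (\<lambda>(y, s). F j y s) \<in> borel_measurable (borel \<Otimes>\<^sub>M borel)"
    and F_int: "\<And>j y. y \<in> X \<Longrightarrow> integrable M (\<lambda>\<omega>. F j y (\<xi> j \<omega>))"
    and alg_x: "\<And>j k \<omega>. k \<ge> 1 \<Longrightarrow> \<omega> \<in> space M \<Longrightarrow> x j k \<omega> = Q (z j (k - 1) \<omega>)"
    and alg_z: "\<And>j k \<omega>. k \<ge> 1 \<Longrightarrow> \<omega> \<in> space M \<Longrightarrow>
        z j k \<omega> = (\<Sum>i\<in>UNIV. (A k \<omega> $ j $ i) *\<^sub>R z i (k - 1) \<omega>)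
                    - \<alpha> k *\<^sub>R grad (\<lambda>y. F j y (\<xi>s j k \<omega>)) (x j k \<omega>)"
    and avg_z: "\<And>k \<omega>. \<omega> \<in> space M \<Longrightarrow>
        zbar k \<omega> = (1 / real CARD('m)) *\<^sub>R (\<Sum>j\<in>UNIV. z j k \<omega>)"
    and avg_x: "\<And>k \<omega>. \<omega> \<in> space M \<Longrightarrow> xbar (k + 1) \<omega> = Q (zbar k \<omega>)"
    and F_diff: "\<And>j s y. s \<in> support_of M (\<xi> j) \<Longrightarrow> y \<in> X \<Longrightarrow>
        (\<lambda>y. F j y s) differentiable (at y)"
    and F_convex: "\<And>j s. s \<in> support_of M (\<xi> j) \<Longrightarrow> convex_on X (\<lambda>y. F j y s)"
    and F_lipschitz: "\<And>j s u v. s \<in> support_of M (\<xi> j) \<Longrightarrow> u \<in> X \<Longrightarrow> v \<in> X \<Longrightarrow>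
        \<bar>F j u s - F j v s\<bar> \<le> L0 j s * norm (u - v)"
    and L0_meas: "\<And>j. L0 j \<in> borel_measurable borel"
    and L0_square: "\<And>j. integrable M (\<lambda>\<omega>. (L0 j (\<xi> j \<omega>))\<^sup>2)"
    and grad_bound: "\<And>j s y. s \<in> support_of M (\<xi> j) \<Longrightarrow> y \<in> X \<Longrightarrow>
        norm (grad (\<lambda>y. F j y s) y) \<le> L0 j s"
    and grad_int: "\<And>j y. y \<in> X \<Longrightarrow> integrable M (\<lambda>\<omega>. grad (\<lambda>y. F j y (\<xi> j \<omega>)) y)"
    and grad_f: "\<And>j y. y \<in> X \<Longrightarrow>
        GDERIV (f j) y :> (LINT \<omega>|M. grad (\<lambda>y. F j y (\<xi> j \<omega>)) y)"
    and A_nonneg: "\<And>k. k \<ge> 1 \<Longrightarrow> AE \<omega> in M. \<forall>i j. A k \<omega> $ i $ j \<ge> 0"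
    and A_row: "\<And>k. k \<ge> 1 \<Longrightarrow> AE \<omega> in M. A k \<omega> *v 1 = 1"
    and A_col: "\<And>k. k \<ge> 1 \<Longrightarrow> 1 v* (LINT \<omega>|M. A k \<omega>) = 1"
    and rho: "filterlim (\<lambda>k. real k * (1 - \<rho> k)) at_top sequentially"
    and A_indep: "\<And>k. k \<ge> 1 \<Longrightarrow>
        prob_space.indep_set M (sigma_sets_of M (A k)) (sets (\<F> k))"
    and alpha_pos: "\<And>k. k \<ge> 1 \<Longrightarrow> \<alpha> k > 0"
    and alpha_mono: "\<And>k. k \<ge> 1 \<Longrightarrow> \<alpha> (k + 1) \<le> \<alpha> k"
    and alpha_div: "filterlim (\<lambda>n. \<Sum>k=1..n. \<alpha> k) at_top sequentially"
    and alpha_beta: "\<exists>\<beta>>1/2. (\<lambda>k. real k powr \<beta> * \<alpha> k) \<longlonglongrightarrow> 0 \<and>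
        liminf (\<lambda>k. ereal ((1 - \<rho> k) / (real k powr \<beta> * \<alpha> k))) > 0"
    and xi_iid: "\<And>j. prob_space.indep_vars M (\<lambda>_. borel) (\<xi>s j) {1..}"
    and xi_distr: "\<And>j k. k \<ge> 1 \<Longrightarrow> distr M borel (\<xi>s j k) = distr M borel (\<xi> j)"
    and xi_fresh: "\<And>j k. k \<ge> 1 \<Longrightarrow>
        prob_space.indep_set M (sigma_sets_of M (\<xi>s j k)) (sets (\<F> k))"
    and xi_cond_indep: "\<And>i j k. k \<ge> 1 \<Longrightarrow> i \<noteq> j \<Longrightarrow>
        cond_indep_set M (\<F>' k) (sigma_sets_of M (\<xi>s i k)) (sigma_sets_of M (\<xi>s j k))"
    and xi_A_cond_indep: "\<And>j k. k \<ge> 1 \<Longrightarrow>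
        cond_indep_set M (\<F> k) (sigma_sets_of M (\<xi>s j k)) (sigma_sets_of M (A k))"
    and reciprocity: "\<And>y (zs :: nat \<Rightarrow> real ^ 'd). y \<in> X \<Longrightarrow>
        (\<lambda>k. Q (zs k)) \<longlonglongrightarrow> y \<Longrightarrow> (\<lambda>k. R y (zs k)) \<longlonglongrightarrow> 0"
  shows "AE \<omega> in M. \<exists>y\<in>Xstar.
    (\<forall>j. (\<lambda>k. x j k \<omega>) \<longlonglongrightarrow> y) \<and> (\<lambda>k. xbar k \<omega>) \<longlonglongrightarrow> y"
proof -
  interpret prob_space M by (rule prob)
  obtain \<sigma> where \<sigma>: "\<sigma> > 0" "\<And>x y l. x \<in> X \<Longrightarrow> y \<in> X
      \<Longrightarrow> l \<in> {0..1} \<Longrightarrow>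
      \<psi> (l *\<^sub>R x + (1 - l) *\<^sub>R y) \<le> l * \<psi> x + (1 - l) * \<psi> y - \<sigma> / 2 * l * (1
          - l) * (norm (x - y))\<^sup>2"
    using psi(2) unfolding strongly_convex_on_def by metis
  obtain \<beta> where \<beta>: "\<beta> > 1 / 2" "(\<lambda>k. real k powr \<beta> * \<alpha> k) \<longlonglongrightarrow> 0"
      "liminf (\<lambda>k. ereal ((1 - \<rho> k) / (real k powr \<beta> * \<alpha> k))) > 0"
    using alpha_beta by blast
  note step = step_size_bounds[where \<alpha> = \<alpha> and \<rho> = \<rho>, OF alpha_pos \<beta>(2) \<beta>(1) \<beta>(3)]
  obtain c where c: "c > 0" "\<forall>\<^sub>F n in sequentially. 1
      - \<rho> (Suc n) \<ge> c * (real (Suc n) powr \<beta> * \<alpha> (Suc n))"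
    using step(1) by blast

  text \<open>Gradients are controlled only on the supports and the weights are stochastic only almost surely.
    Clipping both outside these sets yields a process \<open>z'\<close> that is measurable, satisfies the
    bounds everywhere, and agrees with \<open>z\<close> almost surely.\<close>
  define S where "S j = support_of M (\<xi> j)" for j
  define D where "D j = distr M borel (\<xi> j)" for j
  define F' where "F' j y s = (if s \<in> S j then F j y s else 0)" for j y s
  define g' where "g' j y s = (if y \<in> X \<and> s \<in> S j then grad (\<lambda>y. F j y s) y else 0)" for j y s
  define L' where "L' j s = (if s \<in> S j then L0 j s else 0)" for j s
  define A' where "A' n \<omega> = stochastic_part (A (Suc n) \<omega>)" for n \<omega>
  define G where "G n = \<F> (Suc n)" for n
  \<comment> \<open>The recursion runs over whole families of agents, because the next value of one
    agent involves the current values of all of them.\<close>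
  define z' where "z' j n \<omega> = rec_nat (\<lambda>j. z j 0 \<omega>)
      (\<lambda>n v j. (\<Sum>i\<in>UNIV. (A' n \<omega> $ j $ i) *\<^sub>R v i)
          - \<alpha> (Suc n) *\<^sub>R g' j (Q (v j)) (\<xi>s j (Suc n) \<omega>)) n j"
    for j n \<omega>

  have S_closed: "closed (S j)" for j unfolding S_def by (rule closed_support_of[OF prob rv_xi])
  have S_borel[measurable]: "S j \<in> sets borel" for j using S_closed by (rule borel_closed)
  have X_borel[measurable]: "X \<in> sets borel" using feasible(1) by (rule borel_closed)
  have AE_S: "AE \<omega> in M. \<xi> j \<omega> \<in> S j" for j unfolding S_def by (rule AE_in_support_of[OF prob rv_xi])
  have AE_D: "AE s in D j. s \<in> S j" for j
    unfolding D_def by (subst AE_distr_iff[OF rv_xi]) (use AE_S in auto)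
  \<comment> \<open>The support is that of the reference variable \<open>\<xi> j\<close>; equality
    in law carries the almost sure membership over to every sample.\<close>
  have AE_Ss: "AE \<omega> in M. \<xi>s j (Suc n) \<omega> \<in> S j" for j n
    using AE_D[of j] unfolding D_def xi_distr[of "Suc n" j, simplified, symmetric]
    by (subst (asm) AE_distr_iff) (use rv_xis in auto)
  have D_integral: "integrable (D j) h \<longleftrightarrow> integrable M (\<lambda>\<omega>. h (\<xi> j \<omega>))"
      "(LINT s|D j. h s) = (LINT \<omega>|M. h (\<xi> j \<omega>))"
    if "h \<in> borel_measurable borel" for h :: "real^'p \<Rightarrow> real" and j
    unfolding D_def using that rv_xi by (auto simp: integrable_distr_eq integral_distr)
  have F_section: "(\<lambda>s. F j y s) \<in> borel_measurable borel" for j y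
    using measurable_compose[OF _ F_meas[of j], of "\<lambda>s. (y, s)" borel] by simp
  have F'_section: "F' j y \<in> borel_measurable borel" for j y
    unfolding F'_def[abs_def] using F_section[of j y] by measurable
  have F'_ae: "AE \<omega> in M. F' j y (\<xi> j \<omega>) = F j y (\<xi> j \<omega>)" for j y
    using AE_S[of j] by eventually_elim (simp add: F'_def)
  obtain y0 where y0: "y0 \<in> X" using feasible(3) by blast
  \<comment> \<open>Nonnegativity on the support comes from the gradient bound at some feasible
    point, outside it from the default 0.\<close>
  have L'_nonneg: "0 \<le> L' j s" for j s
    using order_trans[OF norm_ge_zero grad_bound[OF _ y0]] by (auto simp: L'_def S_def)
  have A'_ae: "AE \<omega> in M. A' n \<omega> = A (Suc n) \<omega>" for n
  proof -
    have "AE \<omega> in M. \<forall>i j. A (Suc n) \<omega> $ i $ j \<ge> 0" "AE \<omega> in M. A (Suc n) \<omega> *v 1 = 1"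
      by (rule A_nonneg A_row, simp)+
    thus ?thesis by eventually_elim (simp add: A'_def stochastic_part_def row_stochastic_def)
  qed
  have A_M: "A (Suc n) \<in> borel_measurable M" for n by (rule rv_A) simp
  have A'_M: "A' n \<in> borel_measurable M" for n
    unfolding A'_def[abs_def] by (rule measurable_compose[OF A_M stochastic_part_measurable])
  have entry: "(\<lambda>B::real^'m^'m. B $ i $ l) \<in> borel_measurable borel" for i l
    by (intro borel_measurable_continuous_onI continuous_intros)
  have A'_le: "A' n \<omega> $ i $ l \<le> 1" for n \<omega> i l
    using member_le_sum[of l UNIV "\<lambda>l. A' n \<omega> $ i $ l"] unfolding A'_def by (simp add: stochastic_part)
  have A'_int: "integrable M (\<lambda>\<omega>. A' n \<omega> $ i $ l)" for n i l
  proof (rule integrable_const_bound[of _ 1])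
    show "AE \<omega> in M. norm (A' n \<omega> $ i $ l) \<le> 1"
      using A'_le by (intro AE_I2) (simp add: A'_def abs_of_nonneg stochastic_part)
    show "(\<lambda>\<omega>. A' n \<omega> $ i $ l) \<in> borel_measurable M" by (rule measurable_compose[OF A'_M entry])
  qed
  note hist = history_generators[of "\<lambda>j. z j 0" M \<xi>s A, OF rv_z0 rv_xis rv_A, folded \<F>_def]

  have loc: "dual_averaging M X \<psi> \<sigma> G A' (\<lambda>j n. \<xi>s j (Suc n)) D F' g' L' (\<lambda>n. \<alpha>
      (Suc n)) (\<lambda>n. \<rho> (Suc n)) z'"
  proof (unfold_locales)
    show "closed X" "convex X" "X \<noteq> {}" "continuous_on X \<psi>" "\<sigma> > 0" by (fact feasible psi \<sigma>)+
    show "\<psi> (l *\<^sub>R x + (1 - l) *\<^sub>R y) \<le> l * \<psi> x + (1 - l) * \<psi> y - \<sigma> / 2 * l * (1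
        - l) * (norm (x - y))\<^sup>2"
      if "x \<in> X" "y \<in> X" "l \<in> {0..1}" for x y l by (rule \<sigma>(2)[OF that])
    show "subalgebra M (G n)" for n unfolding G_def by (rule hist(1))
    show "sets (G n) \<subseteq> sets (G (Suc n))" for n unfolding G_def by (rule hist(2))
    show "z' j 0 \<in> borel_measurable (G 0)" for j
      unfolding G_def z'_def using hist(3)[of j "Suc 0"] by simp
    show "A' n \<in> borel_measurable (G (Suc n))" for n
      unfolding G_def A'_def[abs_def]
      by (rule measurable_compose[OF hist(5) stochastic_part_measurable]) auto
    show "\<xi>s j (Suc n) \<in> borel_measurable (G (Suc n))" for j n
      unfolding G_def by (rule hist(4)) auto
    show "indep_set (sigma_sets_of M (A' n)) (sets (G n))" for n
    proof -
      have "sigma_sets_of M (A' n) \<subseteq> sigma_sets_of M (A (Suc n))"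
        unfolding A'_def[abs_def] by (rule sigma_sets_of_comp_subset[OF stochastic_part_measurable])
      moreover have "indep_set (sigma_sets_of M (A (Suc n))) (sets (G n))"
        unfolding G_def by (rule A_indep) simp
      ultimately show ?thesis unfolding indep_set_def
        by (elim indep_sets_mono_sets) (auto split: bool.split)
    qed
    show "indep_set (sigma_sets_of M (\<xi>s j (Suc n))) (sets (G n))" for j n
      unfolding G_def by (rule xi_fresh) simp
    show "distr M borel (\<xi>s j (Suc n)) = D j" for j n
      unfolding D_def by (rule xi_distr) simp
    show "0 \<le> A' n \<omega> $ i $ j" "(\<Sum>j\<in>UNIV. A' n \<omega> $ i $ j) = 1" for n \<omega> i j
      unfolding A'_def by (rule stochastic_part)+
    show "(\<Sum>i\<in>UNIV. LINT \<omega>|M. A' n \<omega> $ i $ j) = 1" for n j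
    proof -
      have "(LINT \<omega>|M. A (Suc n) \<omega>) = (LINT \<omega>|M. A' n \<omega>)"
        by (rule integral_cong_AE[OF A_M A'_M]) (use A'_ae[of n] in auto)
      hence "1 = (1 v* (LINT \<omega>|M. A' n \<omega>)) $ j" using A_col[of "Suc n"] by simp
      also have "\<dots> = (\<Sum>i\<in>UNIV. (LINT \<omega>|M. A' n \<omega>) $ i $ j)"
        by (simp add: vector_matrix_mult_def)
      finally show ?thesis using matrix_integral_entries[OF A'_int] by simp
    qed
    show "(\<Sum>i\<in>UNIV. \<Sum>l\<in>UNIV. (LINT \<omega>|M. (transpose (A' n \<omega>) ** centering_matrix ** A' n
        \<omega>) $ i $ l) * (v i * v l))
        \<le> \<rho> (Suc n) * (\<Sum>i\<in>UNIV. (v i)\<^sup>2)" for n and v :: "'m \<Rightarrow> real"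
    proof -
      let ?P = "\<lambda>B::real^'m^'m. transpose B ** (centering_matrix :: real^'m^'m) ** B"
      have P_cont: "continuous_on UNIV ?P"
        unfolding matrix_matrix_mult_def transpose_def
        by (intro continuous_intros)
      have P_entry: "(\<lambda>B. ?P B $ i $ l) \<in> borel_measurable borel" for i l
        by (rule measurable_compose[OF borel_measurable_continuous_onI[OF P_cont] entry])
      have P_int: "integrable M (\<lambda>\<omega>. ?P (A' n \<omega>) $ i $ l)" for i l
      proof -
        have bd: "\<bar>?P (A' n \<omega>) $ i $ l\<bar>
            \<le> (\<Sum>k\<in>UNIV. \<Sum>j\<in>UNIV. \<bar>(centering_matrix :: real^'m^'m) $ j $ k\<bar>)" for \<omega>
          by (rule abs_contraction_entry_le) (use A'_le in \<open>auto simp: A'_def stochastic_part\<close>)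
        show ?thesis
          by (rule integrable_const_bound[OF _ measurable_compose[OF A'_M P_entry]]) (use bd in auto)
      qed
      \<comment> \<open>Clipping changes the matrices on a null set only, so the contraction factor
        of the original weights equals that of the clipped ones.\<close>
      have "(LINT \<omega>|M. ?P (A (Suc n) \<omega>)) = (LINT \<omega>|M. ?P (A' n \<omega>))"
        by (rule integral_cong_AE) (use A'_ae[of n] measurable_compose[OF A_M borel_measurable_continuous_onI[OF P_cont]]
            measurable_compose[OF A'_M borel_measurable_continuous_onI[OF P_cont]] in auto)
      hence "\<rho> (Suc n) = spectral_norm (LINT \<omega>|M. ?P (A' n \<omega>))"
        unfolding \<rho>_def contraction_factor_def by simp
      thus ?thesis
        using quadratic_form_le_spectral_norm[of "LINT \<omega>|M. ?P (A' n \<omega>)" v]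
        by (simp add: matrix_integral_entries[OF P_int])
    qed
    show "(\<lambda>(y, s). F' j y s) \<in> borel_measurable (borel \<Otimes>\<^sub>M borel)" for j
    proof -
      have [measurable]: "(\<lambda>p. F j (fst p) (snd p)) \<in> borel_measurable (borel \<Otimes>\<^sub>M borel)"
        using F_meas[of j] by (simp add: split_beta')
      have "(\<lambda>p. if snd p \<in> S j then F j (fst p) (snd p) else 0) \<in> borel_measurable (borel
          \<Otimes>\<^sub>M borel)"
        by measurable
      thus ?thesis by (simp add: F'_def split_beta')
    qed
    show "(\<lambda>(y, s). g' j y s) \<in> borel_measurable (borel \<Otimes>\<^sub>M borel)" for j
      unfolding g'_def by (rule clipped_grad_measurable[OF F_meas X_borel S_borel]) (auto simp: S_def intro: F_diff)
    show L'm: "L' j \<in> borel_measurable borel" for j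
      unfolding L'_def[abs_def] using L0_meas by measurable
    show "integrable (D j) (F' j y)" if "y \<in> X" for j y
    proof -
      have "integrable M (\<lambda>\<omega>. F' j y (\<xi> j \<omega>)) \<longleftrightarrow> integrable M
          (\<lambda>\<omega>. F j y (\<xi> j \<omega>))"
        by (rule integrable_cong_AE)
            (use F'_ae measurable_compose[OF rv_xi F'_section] measurable_compose[OF rv_xi F_section] in auto)
      thus ?thesis using F_int[OF that] D_integral(1)[OF F'_section] by simp
    qed
    show "integrable (D j) (\<lambda>s. (L' j s)\<^sup>2)" for j
    proof -
      have "integrable M (\<lambda>\<omega>. (L' j (\<xi> j \<omega>))\<^sup>2) \<longleftrightarrow> integrable M
          (\<lambda>\<omega>. (L0 j (\<xi> j \<omega>))\<^sup>2)"
      proof (rule integrable_cong_AE)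
        show "AE \<omega> in M. (L' j (\<xi> j \<omega>))\<^sup>2 = (L0 j (\<xi> j \<omega>))\<^sup>2"
          using AE_S[of j] by eventually_elim (simp add: L'_def)
        show "(\<lambda>\<omega>. (L' j (\<xi> j \<omega>))\<^sup>2) \<in> borel_measurable M" "(\<lambda>\<omega>. (L0
            j (\<xi> j \<omega>))\<^sup>2) \<in> borel_measurable M"
          using measurable_compose[OF rv_xi L'm] measurable_compose[OF rv_xi L0_meas] by simp_all
      qed
      thus ?thesis using L0_square D_integral(1)[of "\<lambda>s. (L' j s)\<^sup>2"] L'm by simp
    qed
    show "0 \<le> L' j s" for j s by (rule L'_nonneg)
    show "\<bar>F' j a s - F' j b s\<bar> \<le> L' j s * norm (a - b)" if "a \<in> X" "b \<in> X" for j s a b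
      unfolding F'_def L'_def using F_lipschitz[of s j a b] that by (auto simp: S_def)
    show "norm (g' j y s) \<le> L' j s" if "y \<in> X" for j s y
      unfolding g'_def L'_def using grad_bound that by (auto simp: S_def)
    show "F' j a s + inner (g' j a s) (b - a) \<le> F' j b s" if "a \<in> X" "b \<in> X" for j s a b
      unfolding g'_def F'_def using convex_on_grad_ineq[OF F_convex F_diff] that by (auto simp: S_def)
    show "0 < \<alpha> (Suc n)" for n by (rule alpha_pos) simp
    show "0 \<le> \<rho> (Suc n)" for n unfolding \<rho>_def contraction_factor_def by (rule spectral_norm_nonneg)
    show "z' j (Suc n) \<omega> = (\<Sum>i\<in>UNIV. A' n \<omega> $ j $ i *\<^sub>R z' i n \<omega>)
        - \<alpha> (Suc n) *\<^sub>R g' j (mirror_map X \<psi> (z' j n \<omega>)) (\<xi>s j (Suc n) \<omega>)" for j n \<omega>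
      unfolding z'_def Q_def by simp
  qed
  then interpret DA: dual_averaging M X \<psi> \<sigma> G A' "\<lambda>j n. \<xi>s j (Suc n)" D F' g' L' "\<lambda>n.
      \<alpha> (Suc n)" "\<lambda>n. \<rho> (Suc n)" z' .

  have obj: "DA.objective y = total_objective M F \<xi> y" for y
  proof -
    have "DA.obj j y = expected_objective M F \<xi> j y" for j
      unfolding DA.obj_def expected_objective_def D_integral(2)[OF F'_section]
      by (rule integral_cong_AE)
          (use F'_ae measurable_compose[OF rv_xi F'_section] measurable_compose[OF rv_xi F_section] in auto)
    thus ?thesis unfolding DA.objective_def total_objective_def by simp
  qed
  obtain x0 where "x0 \<in> Xstar" using solvable by blast
  hence x0: "x0 \<in> X" "ereal (DA.objective x0) = (INF y\<in>X. ereal (DA.objective y))"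
    unfolding Xstar_def solution_set_def obj by auto
  have x0_min: "DA.objective x0 \<le> DA.objective y" if "y \<in> X" for y
    using INF_lower[OF that, of "\<lambda>y. ereal (DA.objective y)"] unfolding x0(2)[symmetric] by simp
  have Xstar_eq: "{y \<in> X. DA.objective y = DA.objective x0} \<subseteq> Xstar"
    using x0(2) unfolding Xstar_def solution_set_def obj by auto

  have gap: "filterlim (\<lambda>n. real (Suc n) * (1 - \<rho> (Suc n))) at_top sequentially"
    using filterlim_compose[OF rho filterlim_Suc] .
  have not_summable: "\<not> summable (\<lambda>n. \<alpha> (Suc n))"
  proof
    assume s: "summable (\<lambda>n. \<alpha> (Suc n))"
    have "(\<Sum>k=1..n. \<alpha> k) \<le> (\<Sum>n. \<alpha> (Suc n))" for n
    proof -
      \<comment> \<open>Steps are numbered from 1 in the statement and from 0 in the locale.\<close>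
      have "(\<Sum>k=1..n. \<alpha> k) = (\<Sum>k<n. \<alpha> (Suc k))"
        by (rule sum.reindex_bij_witness[of _ Suc "\<lambda>k. k - 1"]) auto
      also have "\<dots> \<le> (\<Sum>n. \<alpha> (Suc n))"
        by (rule sum_le_suminf[OF s]) (simp_all add: less_imp_le[OF alpha_pos])
      finally show ?thesis .
    qed
    moreover have "\<exists>n. (\<Sum>k=1..n. \<alpha> k) \<ge> (\<Sum>n. \<alpha> (Suc n)) + 1"
      using alpha_div unfolding filterlim_at_top eventually_sequentially by blast
    ultimately show False by (metis add_le_same_cancel1 not_one_le_zero order_trans)
  qed
  have conv: "AE \<omega> in M. \<exists>y\<in>{y\<in>X. DA.objective y = DA.objective x0}.
      (\<forall>j. (\<lambda>n. mirror_map X \<psi> (z' j n \<omega>)) \<longlonglongrightarrow> y) \<and> (\<lambda>n.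
          DA.xbar n \<omega>) \<longlonglongrightarrow> y"
    by (rule DA.converges_to_minimizer[OF reciprocity[unfolded Q_def R_def] x0(1) x0_min step(2) not_summable
          DA.expected_dev_summable[OF \<beta>(1) c gap]])
  have "AE \<omega> in M. \<forall>n. A' n \<omega> = A (Suc n) \<omega> \<and> (\<forall>j. \<xi>s j (Suc n) \<omega> \<in> S j)"
    using A'_ae AE_Ss by (simp add: AE_all_countable AE_conj_iff)
  with conv AE_space show ?thesis
  proof eventually_elim
    case (elim \<omega>)
    have z_eq: "z j n \<omega> = z' j n \<omega>" for j n
    proof (induction n arbitrary: j)
      case (Suc n)
      have x: "x j (Suc n) \<omega> = Q (z' j n \<omega>)" using alg_x[of "Suc n" \<omega> j] elim(2) Suc by simp
      \<comment> \<open>Feasibility of the agent's point and membership of the sample in the support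
        put the step inside the clipping region, so both recursions use the same gradient.\<close>
      have "x j (Suc n) \<omega> \<in> X" unfolding x Q_def by (rule DA.Q_maximizer(1))
      hence "grad (\<lambda>y. F j y (\<xi>s j (Suc n) \<omega>)) (x j (Suc n) \<omega>)
          = g' j (Q (z' j n \<omega>)) (\<xi>s j (Suc n) \<omega>)"
        using elim(3) unfolding x g'_def by simp
      thus ?case
        using alg_z[of "Suc n" \<omega> j] elim(2,3) Suc unfolding DA.z_step Q_def by simp
    qed (simp add: z'_def)
    obtain y where y: "y \<in> Xstar" "\<And>j. (\<lambda>n. mirror_map X \<psi> (z' j n \<omega>))
        \<longlonglongrightarrow> y" "(\<lambda>n. DA.xbar n \<omega>) \<longlonglongrightarrow> y"
      using elim(1) Xstar_eq by blast
    \<comment> \<open>Convergence is shown for the shifted sequence: \<open>x j (Suc n)\<close> is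
      the mirror image of \<open>z j n\<close>, while the value at index 0 is not determined by the
      algorithm.\<close>
    have "(\<lambda>k. x j k \<omega>) \<longlonglongrightarrow> y" for j
      by (rule LIMSEQ_imp_Suc) (use y(2)[of j] alg_x[of "Suc _" \<omega> j] elim(2) in \<open>simp add: z_eq Q_def\<close>)
    moreover have "DA.xbar n \<omega> = xbar (Suc n) \<omega>" for n
      using avg_x[OF elim(2), of n] avg_z[OF elim(2), of n]
      by (simp add: DA.xbar_def DA.zbar_def mean_def z_eq Q_def)
    with y(3) have "(\<lambda>k. xbar k \<omega>) \<longlonglongrightarrow> y"
        by (intro LIMSEQ_imp_Suc[of "\<lambda>k. xbar k \<omega>"]) simp
    ultimately show ?case using y(1) by blast
  qed
qed

end
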